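(* Let $r\ge2$ and let $F$ be an $r$-critical graph with $f$ vertices. If $q=q(n)$ satisfies $q/n^2\to0$ and $q/n\to\infty$ as $n\to\infty$, then \[h_F(n,q)=(\beta_F+o(1))\,q\,n^{f-2}.\]
   Context: A graph $F$ is $r$-critical if $\chi(F)=r+1$ and $F$ contains an edge $e$ with $\chi(F-e)=r$. $h_F(n,q)$ is the minimum number of subgraphs isomorphic to $F$ in a graph with $n$ vertices and $\mathrm{ex}(n,F)+q$ edges, where $\mathrm{ex}(n,F)$ is the Turán number. A vertex $u$ of $F$ is critical if $\chi(F-u)=r$. Let $\mathrm{Aut}(F)$ be the number of automorphisms of $F$. For $\boldsymbol{\xi}\in\mathbb{R}^r$, $P_F(\boldsymbol{\xi})=\frac{1}{\mathrm{Aut}(F)}\sum_{u\text{ critical}}\sum_{\chi_u}\prod_{i=1}^r r^{-x_i}\xi_i^{y_i}$, the inner sum over proper colorings $\chi_u:V(F)\setminus\{u\}\to[r]$ of $F-u$, with $y_i$ (resp. $x_i$) the number of neighbors (resp. non-neighbors other than $u$) of $u$ colored $i$. Let $\mathcal{S}_\rho=\{\boldsymbol{\xi}\in[0,1/r]^r:\sum_i\xi_i=\rho\}$ and $p(\rho)=\min\{P_F(\boldsymbol{\xi}):\boldsymbol{\xi}\in\mathcal{S}_\rho\}$. Define $\beta_F=\inf\{p(\rho)/(\rho-(1-1/r)):\ \rho\in(1-1/r,1]\}$. *)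

theory Defs
  imports Complex_Main "HOL-Library.FuncSet"
begin

definition simple_graph :: "'a set \<Rightarrow> 'a set set \<Rightarrow> bool" where
  "simple_graph V E \<longleftrightarrow> finite V \<and>
     (\<forall>e\<in>E. \<exists>x y. x \<noteq> y \<and> x \<in> V \<and> y \<in> V \<and> e = {x, y})"

definition colorable :: "'a set \<Rightarrow> 'a set set \<Rightarrow> nat \<Rightarrow> bool" where
  "colorable V E k \<longleftrightarrow> (\<exists>c::'a \<Rightarrow> nat. (\<forall>v\<in>V. c v < k) \<and>
      (\<forall>x\<in>V. \<forall>y\<in>V. {x, y} \<in> E \<longrightarrow> c x \<noteq> c y))"

definition chromatic_number :: "'a set \<Rightarrow> 'a set set \<Rightarrow> nat" where
  "chromatic_number V E = (LEAST k. colorable V E k)"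

definition del_vertex_edges :: "'a set set \<Rightarrow> 'a \<Rightarrow> 'a set set" where
  "del_vertex_edges E u = {e\<in>E. u \<notin> e}"

definition r_critical :: "nat \<Rightarrow> 'a set \<Rightarrow> 'a set set \<Rightarrow> bool" where
  "r_critical r V E \<longleftrightarrow> chromatic_number V E = r + 1 \<and>
     (\<exists>e\<in>E. chromatic_number V (E - {e}) = r)"

definition critical_vertex :: "nat \<Rightarrow> 'a set \<Rightarrow> 'a set set \<Rightarrow> 'a \<Rightarrow> bool" where
  "critical_vertex r V E u \<longleftrightarrow> u \<in> V \<and>
     chromatic_number (V - {u}) (del_vertex_edges E u) = r"

definition num_aut :: "'a set \<Rightarrow> 'a set set \<Rightarrow> nat" where
  "num_aut V E = card {\<phi>. bij_betw \<phi> V V \<and> (\<forall>x. x \<notin> V \<longrightarrow> \<phi> x = x) \<and>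
      (\<forall>x\<in>V. \<forall>y\<in>V. {x, y} \<in> E \<longleftrightarrow> {\<phi> x, \<phi> y} \<in> E)}"

definition copies :: "'a set \<Rightarrow> 'a set set \<Rightarrow> nat \<Rightarrow> nat set set \<Rightarrow> (nat set \<times> nat set set) set" where
  "copies V E n EG = {(W, H). W \<subseteq> {0..<n} \<and> H \<subseteq> EG \<and> (\<forall>e\<in>H. e \<subseteq> W) \<and>
      (\<exists>\<phi>. bij_betw \<phi> V W \<and> (\<forall>x\<in>V. \<forall>y\<in>V. {x, y} \<in> E \<longleftrightarrow> {\<phi> x, \<phi> y} \<in> H))}"

definition num_copies :: "'a set \<Rightarrow> 'a set set \<Rightarrow> nat \<Rightarrow> nat set set \<Rightarrow> nat" where
  "num_copies V E n EG = card (copies V E n EG)"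

definition turan_ex :: "'a set \<Rightarrow> 'a set set \<Rightarrow> nat \<Rightarrow> nat" where
  "turan_ex V E n = Max {card EG | EG. simple_graph {0..<n} EG \<and> num_copies V E n EG = 0}"

definition h_F :: "'a set \<Rightarrow> 'a set set \<Rightarrow> nat \<Rightarrow> nat \<Rightarrow> nat" where
  "h_F V E n q = Min {num_copies V E n EG | EG. simple_graph {0..<n} EG \<and>
      card EG = turan_ex V E n + q}"

definition colorings_u :: "nat \<Rightarrow> 'a set \<Rightarrow> 'a set set \<Rightarrow> 'a \<Rightarrow> ('a \<Rightarrow> nat) set" where
  "colorings_u r V E u = {c \<in> (V - {u}) \<rightarrow>\<^sub>E {0..<r}.
      \<forall>x\<in>V - {u}. \<forall>y\<in>V - {u}. {x, y} \<in> E \<longrightarrow> c x \<noteq> c y}"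

definition P_F :: "nat \<Rightarrow> 'a set \<Rightarrow> 'a set set \<Rightarrow> (nat \<Rightarrow> real) \<Rightarrow> real" where
  "P_F r V E \<xi> = (1 / real (num_aut V E)) *
     (\<Sum>u\<in>{u\<in>V. critical_vertex r V E u}. \<Sum>c\<in>colorings_u r V E u.
        \<Prod>i<r. inverse (real r ^ card {v\<in>V - {u}. {u, v} \<notin> E \<and> c v = i}) *
               \<xi> i ^ card {v\<in>V - {u}. {u, v} \<in> E \<and> c v = i})"

definition S_rho :: "nat \<Rightarrow> real \<Rightarrow> (nat \<Rightarrow> real) set" where
  "S_rho r \<rho> = {\<xi>. (\<forall>i<r. 0 \<le> \<xi> i \<and> \<xi> i \<le> 1 / real r) \<and> (\<Sum>i<r. \<xi> i) = \<rho>}"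

definition p_F :: "nat \<Rightarrow> 'a set \<Rightarrow> 'a set set \<Rightarrow> real \<Rightarrow> real" where
  "p_F r V E \<rho> = Inf (P_F r V E ` S_rho r \<rho>)"

definition beta_F :: "nat \<Rightarrow> 'a set \<Rightarrow> 'a set set \<Rightarrow> real" where
  "beta_F r V E = Inf ((\<lambda>\<rho>. p_F r V E \<rho> / (\<rho> - (1 - 1 / real r))) ` {1 - 1 / real r<..1})"

end

theory Submission
  imports Defs "HOL-Analysis.Convex" "HOL-Combinatorics.Transposition"
begin

text \<open>
  Copies are counted through injective homomorphisms (embeddings), of which every copy of \<open>F\<close> has
  \<open>Aut(F)\<close> many.

  Lower bound. A graph with at least \<open>(1 - 1/r) n^2 / 2 + q\<close> edges and \<open>o(n^f)\<close> copies of \<open>F\<close> has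
  \<open>o(n^(r+1))\<close> cliques \<open>K_(r+1)\<close>, since cloning a vertex squares a homomorphism density at worst.
  The Moon-Moser inequalities then yield many \<open>r\<close>-cliques \<open>R\<close>, and for an average \<open>R\<close> the common
  neighbourhoods of the sets \<open>R - {x}\<close> almost partition the vertices and span few edges; neither the
  regularity lemma nor the removal lemma is needed. In a maximum \<open>r\<close>-cut the number of edges inside
  the parts exceeds the number of missing cross edges by at least \<open>q\<close>. A vertex \<open>x\<close> with linearly many
  neighbours in its own part lies in about \<open>P_F(\<xi>) n^(f-1)\<close> copies, where \<open>\<xi>\<close> is its vector of relative
  degrees, and \<open>P_F(\<xi>) \<ge> \<beta> (\<Sum>\<xi> - (1 - 1/r))\<close>; every other edge inside a part lies in at least about
  \<open>\<beta> n^(f-2)\<close> copies. Copies of the first kind meet the set of exceptional vertices exactly once and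
  those of the second kind avoid it and contain one edge inside a part, so nothing is counted twice.

  Upper bound. Choose \<open>\<xi>\<close> almost attaining \<open>\<beta>\<close> and join about \<open>q / (n (\<Sum>\<xi> - (1 - 1/r)))\<close> new vertices
  to \<open>\<xi> i * n\<close> vertices of the \<open>i\<close>-th part of a Turan graph, for each \<open>i\<close>. Almost every copy uses
  exactly one new vertex, in the role of a critical vertex of \<open>F\<close>.
\<close>

section \<open>Stability for graphs with few cliques\<close>

text \<open>The two hypotheses on \<open>q\<close> do different jobs. As \<open>q/n\<close> tends to
  infinity, errors O(n) in numbers of edges are negligible, so the Turan number is needed only up to
  O(n), and rounding of part sizes does no harm. As \<open>q/n^2\<close> tends to 0, only o(n) new
  vertices are used, so copies through two of them are negligible; and a graph with a positive
  density of cliques has far more copies than required. The obstacle in the lower bound is that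
  missing cross pairs destroy copies, and they may outnumber \<open>q\<close>. Around an exceptional
  vertex a maximum cut forces linear degree into every part, so the count there has the full order
  n^(f-1) and o(1) relative losses can be absorbed. Elsewhere own-part degrees are at most
  \<open>e * n\<close>, so one missing pair harms few same-part edges, and its loss is paid by the
  surplus of same-part edges that a missing pair forces. Pairs are ordered throughout
  (\<open>edge_pairs\<close>, \<open>missing_pairs\<close>, \<open>same_part_pairs\<close>), which
  explains the factors 2.\<close>

locale finite_adjacency =
  fixes U :: "'b set" and A :: "'b \<Rightarrow> 'b \<Rightarrow> bool"
  assumes fin: "finite U"
    and sym: "A x y \<Longrightarrow> A y x"
    and irrefl: "\<not> A x x"
begin

section \<open>Clique counts and the Moon-Moser inequalities\<close>

definition cliques :: "nat \<Rightarrow> 'b set set" where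
  "cliques s = {S. S \<subseteq> U \<and> card S = s \<and> (\<forall>x\<in>S. \<forall>y\<in>S. x \<noteq> y \<longrightarrow> A x y)}"

definition common_nbrs :: "'b set \<Rightarrow> 'b set" where
  "common_nbrs S = {v \<in> U. \<forall>x\<in>S. A v x}"

lemma finite_cliques [simp]: "finite (cliques s)"
  unfolding cliques_def by (rule finite_subset[of _ "Pow U"]) (use fin in auto)

lemma finite_common_nbrs [simp]: "finite (common_nbrs S)"
  unfolding common_nbrs_def using fin by auto

lemma finite_clique: "S \<in> cliques s \<Longrightarrow> finite S"
  unfolding cliques_def using fin finite_subset by blast

text \<open>Insertion and deletion match the pairs of an \<open>s\<close>-clique and a vertex
  extending it with the pairs of an \<open>(s+1)\<close>-clique and one of its vertices. The weight
  \<open>g\<close> is free, so that clique counts, sums of squared degrees and edges in common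
  neighbourhoods are all instances.\<close>

lemma sum_cliques_Suc:
  fixes g :: "'b set \<Rightarrow> 'b \<Rightarrow> real"
  shows "(\<Sum>S\<in>cliques s. \<Sum>y\<in>common_nbrs S. g S y)
       = (\<Sum>R\<in>cliques (Suc s). \<Sum>y\<in>R. g (R - {y}) y)"
proof -
  have "(\<Sum>S\<in>cliques s. \<Sum>y\<in>common_nbrs S. g S y)
      = (\<Sum>(S, y)\<in>Sigma (cliques s) common_nbrs. g S y)"
    by (subst sum.Sigma) auto
  also have "\<dots> = (\<Sum>(R, y)\<in>Sigma (cliques (Suc s)) (\<lambda>R. R). g (R - {y}) y)"
  proof (rule sum.reindex_bij_witness[where i = "\<lambda>(R, y). (R - {y}, y)" and j = "\<lambda>(S, y). (insert y S, y)"],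
      goal_cases)
    case (1 a)
    then obtain S y where a: "a = (S, y)" "y \<in> common_nbrs S" by auto
    then have "y \<notin> S" using irrefl unfolding common_nbrs_def by auto
    then show ?case using a by auto
  next
    case (2 a)
    then obtain S y where a: "a = (S, y)" "S \<in> cliques s" "y \<in> common_nbrs S" by auto
    have "y \<notin> S" using a irrefl unfolding common_nbrs_def by auto
    then have "card (insert y S) = Suc s"
      using a finite_clique[OF a(2)] by (simp add: cliques_def)
    then show ?case using a sym by (auto simp: cliques_def common_nbrs_def)
  next
    case (3 b)
    then show ?case by auto
  next
    case (4 b)
    then obtain R y where b: "b = (R, y)" "R \<in> cliques (Suc s)" "y \<in> R" by auto
    then have "card (R - {y}) = s" using finite_clique[OF b(2)] by (simp add: cliques_def)
    then show ?case using b by (auto simp: cliques_def common_nbrs_def)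
  next
    case (5 a)
    then obtain S y where a: "a = (S, y)" "y \<in> common_nbrs S" by auto
    then have "y \<notin> S" using irrefl unfolding common_nbrs_def by auto
    then show ?case using a by auto
  qed
  also have "\<dots> = (\<Sum>R\<in>cliques (Suc s). \<Sum>y\<in>R. g (R - {y}) y)"
    by (subst sum.Sigma) (auto intro: finite_clique)
  finally show ?thesis .
qed

lemma sum_card_common_nbrs:
  "(\<Sum>S\<in>cliques s. real (card (common_nbrs S))) = real (Suc s) * real (card (cliques (Suc s)))"
proof -
  have "(\<Sum>S\<in>cliques s. real (card (common_nbrs S))) = (\<Sum>S\<in>cliques s. \<Sum>y\<in>common_nbrs S. 1)" by simp
  also have "\<dots> = (\<Sum>R\<in>cliques (Suc s). \<Sum>y\<in>R. 1)" by (rule sum_cliques_Suc)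
  also have "\<dots> = (\<Sum>R\<in>cliques (Suc s). real (Suc s))"
    by (intro sum.cong) (auto simp: cliques_def)
  finally show ?thesis by simp
qed

lemma sum_card_common_nbrs_squared:
  "(\<Sum>S\<in>cliques s. (real (card (common_nbrs S)))\<^sup>2)
    = (\<Sum>R\<in>cliques (Suc s). \<Sum>y\<in>R. real (card (common_nbrs (R - {y}))))"
  using sum_cliques_Suc[of "\<lambda>S y. real (card (common_nbrs S))" s]
  by (simp add: power2_eq_square)

text \<open>A vertex with a non-neighbour \<open>z\<close> in \<open>R\<close> can lie only in
  \<open>common_nbrs (R - {z})\<close>, so it is counted at most once. A vertex adjacent to all of
  \<open>R\<close> is counted at most \<open>s + 1\<close> times, \<open>s\<close> more than in the
  union.\<close>

lemma sum_card_common_nbrs_delete: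
  assumes "R \<in> cliques (Suc s)"
  shows "(\<Sum>y\<in>R. real (card (common_nbrs (R - {y}))))
    \<le> real (card (\<Union>y\<in>R. common_nbrs (R - {y}))) + real s * real (card (common_nbrs R))"
proof -
  let ?W = "\<Union>y\<in>R. common_nbrs (R - {y})"
  have fR: "finite R" using assms by (rule finite_clique)
  have cR: "card R = Suc s" using assms by (simp add: cliques_def)
  have fW: "finite ?W" using fR by auto
  have "(\<Sum>y\<in>R. real (card (common_nbrs (R - {y}))))
      = (\<Sum>y\<in>R. \<Sum>v\<in>?W. if v \<in> common_nbrs (R - {y}) then 1 else 0)"
  proof (rule sum.cong)
    fix y assume "y \<in> R"
    then have "{v \<in> ?W. v \<in> common_nbrs (R - {y})} = common_nbrs (R - {y})" by auto
    then show "real (card (common_nbrs (R - {y}))) = (\<Sum>v\<in>?W. if v \<in> common_nbrs (R - {y}) then 1 else 0)"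
      using fW by (simp add: sum.inter_filter[symmetric])
  qed simp
  also have "\<dots> = (\<Sum>v\<in>?W. \<Sum>y\<in>R. if v \<in> common_nbrs (R - {y}) then 1 else 0)"
    by (rule sum.swap)
  also have "\<dots> \<le> (\<Sum>v\<in>?W. 1 + (if v \<in> common_nbrs R then real s else 0))"
  proof (rule sum_mono)
    fix v assume v: "v \<in> ?W"
    have eq: "(\<Sum>y\<in>R. if v \<in> common_nbrs (R - {y}) then 1 else 0)
        = real (card {y\<in>R. v \<in> common_nbrs (R - {y})})"
      using fR by (simp add: sum.inter_filter[symmetric])
    show "(\<Sum>y\<in>R. if v \<in> common_nbrs (R - {y}) then 1 else 0)
        \<le> 1 + (if v \<in> common_nbrs R then real s else 0)"
    proof (cases "v \<in> common_nbrs R")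
      case True
      have "card {y\<in>R. v \<in> common_nbrs (R - {y})} \<le> Suc s"
        using fR cR by (metis (no_types, lifting) card_mono mem_Collect_eq subsetI)
      then show ?thesis using True eq by simp
    next
      case False
      obtain z where z: "z \<in> R" "\<not> A v z"
        using False v unfolding common_nbrs_def by auto
      have "{y\<in>R. v \<in> common_nbrs (R - {y})} \<subseteq> {z}"
        using z unfolding common_nbrs_def by auto
      then have "card {y\<in>R. v \<in> common_nbrs (R - {y})} \<le> 1"
        using card_mono[of "{z}"] by auto
      then show ?thesis using False eq by simp
    qed
  qed
  also have "\<dots> = real (card ?W) + real s * real (card {v\<in>?W. v \<in> common_nbrs R})"
    using fW by (simp add: sum.distrib sum.inter_filter[symmetric])
  also have "\<dots> \<le> real (card ?W) + real s * real (card (common_nbrs R))"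
    by (intro add_left_mono mult_left_mono) (auto intro!: card_mono)
  finally show ?thesis .
qed

text \<open>One Moon-Moser step. Cauchy-Schwarz for the clique degrees gives the second claim;
  counting the same sum over \<open>(s+1)\<close>-cliques bounds it above by \<open>n\<close> per
  clique plus a multiple of the next clique count, which gives the first. The second claim is
  exported because for \<open>s + 1 = r\<close> it says how much the sets
  \<open>common_nbrs (R - {y})\<close> cover on average.\<close>

lemma clique_density_step:
  assumes "0 < s" "s < r"
    and dens: "(1 - real s / real r) * real (card U) * real (card (cliques s))
      \<le> real (Suc s) * real (card (cliques (Suc s)))"
  shows "(1 - real (Suc s) / real r) * real (card U) * real (card (cliques (Suc s)))
      \<le> real (Suc (Suc s)) * real (card (cliques (Suc (Suc s))))"
    (is "?A * ?n * ?N1 \<le> ?L1")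
    and "(1 - real s / real r) * real (card U) * (real (Suc s) * real (card (cliques (Suc s))))
      \<le> (\<Sum>R\<in>cliques (Suc s). \<Sum>y\<in>R. real (card (common_nbrs (R - {y}))))"
      (is "?l \<le> ?r")
proof -
  define L0 where "L0 = real (Suc s) * real (card (cliques (Suc s)))"
  have cs: "L0\<^sup>2 \<le> real (card (cliques s)) * ?r"
    using sum_squared_le_sum_of_squares[of "\<lambda>S. real (card (common_nbrs S))" "cliques s"]
    unfolding L0_def by (simp only: sum_card_common_nbrs sum_card_common_nbrs_squared mult.commute)
  show 2: "?l \<le> ?r"
  proof (cases "card (cliques s) = 0")
    case True
    then have "L0 = 0" using cs by simp
    then have "?l = 0" unfolding L0_def by simp
    moreover have "0 \<le> ?r" by (intro sum_nonneg) auto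
    ultimately show ?thesis by linarith
  next
    case False
    have "real (card (cliques s)) * ?l = ((1 - real s / real r) * real (card U) * real (card (cliques s))) * L0"
      unfolding L0_def by (simp only: mult_ac)
    also have "\<dots> \<le> L0 * L0"
      using dens unfolding L0_def by (intro mult_right_mono) auto
    also have "\<dots> \<le> real (card (cliques s)) * ?r" using cs by (simp add: power2_eq_square)
    finally show ?thesis using False by simp
  qed
  have "?r \<le> (\<Sum>R\<in>cliques (Suc s). real (card U) + real s * real (card (common_nbrs R)))"
  proof (rule sum_mono)
    fix R assume R: "R \<in> cliques (Suc s)"
    have "card (\<Union>y\<in>R. common_nbrs (R - {y})) \<le> card U"
      by (rule card_mono) (use fin in \<open>auto simp: common_nbrs_def\<close>)
    then show "(\<Sum>y\<in>R. real (card (common_nbrs (R - {y}))))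
        \<le> real (card U) + real s * real (card (common_nbrs R))"
      using sum_card_common_nbrs_delete[OF R] by linarith
  qed
  also have "\<dots> = real (card (cliques (Suc s))) * real (card U) + real s * ?L1"
    by (simp only: sum.distrib sum_distrib_left[symmetric] sum_card_common_nbrs sum_constant)
  finally have "?l \<le> ?N1 * ?n + real s * ?L1" using 2 by linarith
  then have "((1 - real s / real r) * real (Suc s) - 1) * ?n * ?N1 \<le> real s * ?L1"
    by (simp only: algebra_simps)
  moreover have "(1 - real s / real r) * real (Suc s) - 1 = real s * ?A"
    using assms by (simp add: field_simps)
  ultimately have "real s * (?A * ?n * ?N1) \<le> real s * ?L1" by (simp only: mult.assoc)
  then show "?A * ?n * ?N1 \<le> ?L1" by (rule mult_left_le_imp_le) (use assms in simp)
qed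

lemma card_cliques_1: "card (cliques 1) = card U"
proof -
  have "cliques 1 = (\<lambda>x. {x}) ` U"
    unfolding cliques_def by (auto simp: card_1_singleton_iff irrefl)
  then show ?thesis by (simp add: card_image)
qed

lemma card_cliques_2:
  "2 * card (cliques 2) = card {(x, y) \<in> U \<times> U. A x y}"
proof -
  have "real (Suc 1) * real (card (cliques (Suc 1))) = (\<Sum>S\<in>cliques 1. real (card (common_nbrs S)))"
    by (rule sum_card_common_nbrs[symmetric])
  also have "cliques 1 = (\<lambda>x. {x}) ` U"
    unfolding cliques_def by (auto simp: card_1_singleton_iff irrefl)
  also have "(\<Sum>S\<in>(\<lambda>x. {x}) ` U. real (card (common_nbrs S))) = (\<Sum>x\<in>U. real (card {y\<in>U. A y x}))"
    by (subst sum.reindex) (auto simp: common_nbrs_def)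
  also have "\<dots> = real (card (Sigma U (\<lambda>x. {y\<in>U. A y x})))"
    using fin by simp
  also have "Sigma U (\<lambda>x. {y\<in>U. A y x}) = {(x, y) \<in> U \<times> U. A x y}"
    using sym by auto
  finally have "real (2 * card (cliques 2)) = real (card {(x, y) \<in> U \<times> U. A x y})"
    by (simp add: numeral_2_eq_2)
  then show ?thesis by (simp only: of_nat_eq_iff)
qed

lemma clique_density:
  assumes "0 < s" "s \<le> r"
    and dens: "(1 - 1 / real r) * (real (card U))\<^sup>2 \<le> real (card {(x, y) \<in> U \<times> U. A x y})"
  shows "(1 - real s / real r) * real (card U) * real (card (cliques s))
      \<le> real (Suc s) * real (card (cliques (Suc s)))"
  using assms(1,2)
proof (induction s)
  case 0
  then show ?case by simp
next
  case (Suc s)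
  show ?case
  proof (cases "s = 0")
    case True
    have "real (Suc 1) * real (card (cliques (Suc 1))) = real (2 * card (cliques 2))"
      by (simp add: numeral_2_eq_2)
    also have "\<dots> = real (card {(x, y) \<in> U \<times> U. A x y})" by (simp only: card_cliques_2)
    finally show ?thesis using True dens card_cliques_1 by (simp add: power2_eq_square mult.assoc)
  next
    case False
    then show ?thesis using Suc by (intro clique_density_step(1)) auto
  qed
qed

text \<open>Consecutive ratios from \<open>clique_density\<close> are multiplied. The product stops
  at \<open>j = s - 1 < r\<close>, so all its factors are positive, and a graph of Turan density has
  a positive density of \<open>r\<close>-cliques.\<close>

lemma card_cliques_ge:
  assumes "0 < s" "s \<le> r"
    and dens: "(1 - 1 / real r) * (real (card U))\<^sup>2 \<le> real (card {(x, y) \<in> U \<times> U. A x y})"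
  shows "(\<Prod>j\<in>{1..<s}. (1 - real j / real r) / real (Suc j)) * real (card U) ^ s \<le> real (card (cliques s))"
  using assms(1,2)
proof (induction s)
  case 0
  then show ?case by simp
next
  case (Suc s)
  show ?case
  proof (cases "s = 0")
    case True
    then show ?thesis using card_cliques_1 by simp
  next
    case False
    define P where "P = (\<Prod>j\<in>{1..<s}. (1 - real j / real r) / real (Suc j))"
    have IH: "P * real (card U) ^ s \<le> real (card (cliques s))"
      using Suc False by (auto simp: P_def)
    have pos: "0 \<le> 1 - real s / real r" using Suc by (simp add: field_simps)
    have "{1..<Suc s} = insert s {1..<s}" using False by auto
    then have "(\<Prod>j\<in>{1..<Suc s}. (1 - real j / real r) / real (Suc j)) * real (card U) ^ Suc s
      = (1 - real s / real r) * real (card U) * (P * real (card U) ^ s) / real (Suc s)"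
      by (simp add: P_def)
    also have "\<dots> \<le> (1 - real s / real r) * real (card U) * real (card (cliques s)) / real (Suc s)"
      by (intro divide_right_mono mult_left_mono IH) (use pos in auto)
    also have "\<dots> \<le> real (Suc s) * real (card (cliques (Suc s))) / real (Suc s)"
      by (intro divide_right_mono clique_density) (use Suc False dens in auto)
    finally show ?thesis by simp
  qed
qed

text \<open>For fixed \<open>S\<close> the inner sum is twice the number of edges inside
  \<open>common_nbrs S\<close>; an \<open>(s+2)\<close>-clique arises once for every ordered pair of
  its vertices.\<close>

lemma sum_edges_in_common_nbrs:
  "(\<Sum>S\<in>cliques s. \<Sum>y\<in>common_nbrs S. real (card (common_nbrs (insert y S))))
    = real (Suc s) * (real (Suc (Suc s)) * real (card (cliques (Suc (Suc s)))))"
proof -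
  have "(\<Sum>S\<in>cliques s. \<Sum>y\<in>common_nbrs S. real (card (common_nbrs (insert y S))))
      = (\<Sum>R\<in>cliques (Suc s). \<Sum>y\<in>R. real (card (common_nbrs (insert y (R - {y})))))"
    by (rule sum_cliques_Suc)
  also have "\<dots> = (\<Sum>R\<in>cliques (Suc s). real (Suc s) * real (card (common_nbrs R)))"
  proof (rule sum.cong)
    fix R assume "R \<in> cliques (Suc s)"
    then have "card R = Suc s" by (simp add: cliques_def)
    moreover have "(\<Sum>y\<in>R. real (card (common_nbrs (insert y (R - {y}))))) = (\<Sum>y\<in>R. real (card (common_nbrs R)))"
      by (intro sum.cong) (auto simp: insert_absorb)
    ultimately show "(\<Sum>y\<in>R. real (card (common_nbrs (insert y (R - {y})))))
        = real (Suc s) * real (card (common_nbrs R))" by simp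
  qed simp
  finally show ?thesis by (simp only: sum_distrib_left[symmetric] sum_card_common_nbrs)
qed

text \<open>Averaging over \<open>R\<close>. Both kinds of defect, vertices outside all sets
  \<open>common_nbrs (R - {y})\<close> and edges inside these sets, have totals controlled by the
  number of \<open>(r+1)\<close>-cliques. Uncovered vertices are weighted by \<open>n\<close> so
  that both terms count pairs.\<close>

lemma exists_good_clique:
  assumes "2 \<le> r"
    and dens: "(1 - 1 / real r) * (real (card U))\<^sup>2 \<le> real (card {(x, y) \<in> U \<times> U. A x y})"
    and ne: "cliques r \<noteq> {}"
  obtains R where "R \<in> cliques r"
    and "real (card (cliques r)) *
       (real (card U) * real (card (U - (\<Union>y\<in>R. common_nbrs (R - {y})))) +
        (\<Sum>y\<in>R. \<Sum>z\<in>common_nbrs (R - {y}). real (card (common_nbrs (insert z (R - {y}))))))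
      \<le> 4 * real (Suc r)^2 * real (card U) * real (card (cliques (Suc r)))"
proof -
  obtain s where s: "r = Suc s" "0 < s" using assms(1) by (cases r) auto
  define n where "n = real (card U)"
  define N' where "N' = real (card (cliques (Suc r)))"
  define e where "e S = (\<Sum>z\<in>common_nbrs S. real (card (common_nbrs (insert z S))))" for S
  define W where "W R = (\<Union>y\<in>R. common_nbrs (R - {y}))" for R
  define h where "h R = n * real (card (U - W R)) + (\<Sum>y\<in>R. e (R - {y}))" for R
  have fW: "finite (W R)" if "R \<in> cliques r" for R
    unfolding W_def using finite_clique[OF that] by auto
  have Wsub: "W R \<subseteq> U" for R unfolding W_def common_nbrs_def by auto
  have low: "(1 - real s / real r) * n * (real (Suc s) * real (card (cliques (Suc s))))
      \<le> (\<Sum>R\<in>cliques (Suc s). \<Sum>y\<in>R. real (card (common_nbrs (R - {y}))))"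
    unfolding n_def by (intro clique_density_step(2) clique_density) (use s dens in auto)
  \<comment> \<open>With \<open>r = s + 1\<close> the density factor cancels exactly: on average the
    sets \<open>common_nbrs (R - {y})\<close> have total size at least \<open>n\<close>. What they
    fail to cover is therefore due to overlaps, that is, to \<open>(r+1)\<close>-cliques.\<close>
  have "(1 - real s / real r) * real (Suc s) = 1" using s by (simp add: field_simps)
  then have "(1 - real s / real r) * n * (real (Suc s) * real (card (cliques (Suc s)))) = n * real (card (cliques r))"
    using s(1) by (metis (no_types, lifting) mult.assoc mult.commute mult.left_neutral)
  then have "n * real (card (cliques r)) \<le> (\<Sum>R\<in>cliques r. \<Sum>y\<in>R. real (card (common_nbrs (R - {y}))))"
    using low unfolding s(1) by linarith
  also have "\<dots> \<le> (\<Sum>R\<in>cliques r. real (card (W R)) + real s * real (card (common_nbrs R)))"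
    unfolding s(1) W_def by (intro sum_mono sum_card_common_nbrs_delete)
  also have "\<dots> = (\<Sum>R\<in>cliques r. real (card (W R))) + real s * (real (Suc r) * N')"
    by (simp only: sum.distrib sum_distrib_left[symmetric] sum_card_common_nbrs N'_def)
  finally have 1: "n * real (card (cliques r)) - (\<Sum>R\<in>cliques r. real (card (W R))) \<le> real s * (real (Suc r) * N')"
    by simp
  have "(\<Sum>R\<in>cliques r. real (card (U - W R))) = (\<Sum>R\<in>cliques r. n - real (card (W R)))"
    unfolding n_def
    by (intro sum.cong) (use Wsub fW fin in \<open>auto simp: card_Diff_subset of_nat_diff card_mono\<close>)
  then have 2: "(\<Sum>R\<in>cliques r. real (card (U - W R))) \<le> real s * (real (Suc r) * N')"
    using 1 by (simp add: sum_subtractf mult.commute)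
  have "(\<Sum>R\<in>cliques r. \<Sum>y\<in>R. e (R - {y})) = (\<Sum>S\<in>cliques s. \<Sum>y\<in>common_nbrs S. e S)"
    unfolding s(1) by (rule sum_cliques_Suc[symmetric])
  \<comment> \<open>An \<open>(r-1)\<close>-clique extends to at most \<open>n\<close> of the
    cliques \<open>R\<close>.\<close>
  also have "\<dots> \<le> (\<Sum>S\<in>cliques s. n * e S)"
  proof (rule sum_mono)
    fix S
    have "card (common_nbrs S) \<le> card U" by (rule card_mono) (use fin in \<open>auto simp: common_nbrs_def\<close>)
    moreover have "0 \<le> e S" unfolding e_def by (intro sum_nonneg) auto
    ultimately show "(\<Sum>y\<in>common_nbrs S. e S) \<le> n * e S" unfolding n_def by (auto intro: mult_right_mono)
  qed
  also have "\<dots> = n * (real r * (real (Suc r) * N'))"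
    unfolding e_def N'_def s(1) by (simp only: sum_distrib_left[symmetric] sum_edges_in_common_nbrs)
  finally have 3: "(\<Sum>R\<in>cliques r. \<Sum>y\<in>R. e (R - {y})) \<le> n * (real r * (real (Suc r) * N'))" .
  have n0: "0 \<le> n" "0 \<le> N'" unfolding n_def N'_def by auto
  have "(\<Sum>R\<in>cliques r. h R) = n * (\<Sum>R\<in>cliques r. real (card (U - W R))) + (\<Sum>R\<in>cliques r. \<Sum>y\<in>R. e (R - {y}))"
    unfolding h_def by (simp only: sum.distrib sum_distrib_left[symmetric])
  also have "\<dots> \<le> n * (real s * (real (Suc r) * N')) + n * (real r * (real (Suc r) * N'))"
    by (intro add_mono mult_left_mono 2 3 n0)
  also have "\<dots> = (real s + real r) * real (Suc r) * (n * N')" by (simp add: algebra_simps)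
  also have "\<dots> \<le> (4 * real (Suc r)^2) * (n * N')"
  proof (rule mult_right_mono)
    have "(real s + real r) * real (Suc r) \<le> (4 * real (Suc r)) * real (Suc r)"
      by (rule mult_right_mono) (use s(1) in auto)
    then show "(real s + real r) * real (Suc r) \<le> 4 * real (Suc r)^2" by (simp add: power2_eq_square)
  qed (use n0 in auto)
  finally have sumh: "(\<Sum>R\<in>cliques r. h R) \<le> 4 * real (Suc r)^2 * n * N'" by (simp add: mult.assoc)
  have "\<exists>R\<in>cliques r. real (card (cliques r)) * h R \<le> (\<Sum>R\<in>cliques r. h R)"
  proof (rule ccontr)
    assume "\<not> ?thesis"
    then have "\<And>R. R \<in> cliques r \<Longrightarrow> (\<Sum>R\<in>cliques r. h R) / real (card (cliques r)) < h R"
      using ne by (auto simp: not_le field_simps card_gt_0_iff)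
    then have "(\<Sum>R\<in>cliques r. (\<Sum>R\<in>cliques r. h R) / real (card (cliques r))) < (\<Sum>R\<in>cliques r. h R)"
      by (intro sum_strict_mono) (use ne in auto)
    then show False using ne by auto
  qed
  then obtain R where "R \<in> cliques r" "real (card (cliques r)) * h R \<le> (\<Sum>R\<in>cliques r. h R)" by blast
  then show ?thesis using sumh that[of R] unfolding h_def e_def W_def n_def N'_def by auto
qed

text \<open>A covered vertex joins a class \<open>i\<close> for which it sees all of
  \<open>R\<close> except possibly \<open>g i\<close>; uncovered vertices join class 0. An edge
  inside a class either touches an uncovered vertex, which accounts for at most \<open>2 * n\<close>
  ordered pairs per such vertex, or lies inside one set
  \<open>common_nbrs (R - {y})\<close>.\<close>

lemma stability_for_clique:
  assumes R: "R \<in> cliques r" and r: "0 < r"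
  obtains p :: "'b \<Rightarrow> nat" where "\<And>x. p x < r"
    and "real (card {(x, y) \<in> U \<times> U. A x y \<and> p x = p y})
      \<le> 2 * (real (card U) * real (card (U - (\<Union>y\<in>R. common_nbrs (R - {y}))))) +
        (\<Sum>y\<in>R. \<Sum>z\<in>common_nbrs (R - {y}). real (card (common_nbrs (insert z (R - {y})))))"
proof -
  have fR: "finite R" using R by (rule finite_clique)
  have cR: "card R = r" using R by (simp add: cliques_def)
  obtain g where g: "bij_betw g {0..<r} R"
    using ex_bij_betw_nat_finite[OF fR] cR by auto
  define W where "W = (\<Union>y\<in>R. common_nbrs (R - {y}))"
  define p where "p v = (if v \<in> W then (SOME i. i < r \<and> v \<in> common_nbrs (R - {g i})) else 0)" for v
  have pW: "p v < r \<and> v \<in> common_nbrs (R - {g (p v)})" if "v \<in> W" for v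
  proof -
    have "\<exists>i. i < r \<and> v \<in> common_nbrs (R - {g i})"
      using that g unfolding W_def bij_betw_def by auto
    then have "(SOME i. i < r \<and> v \<in> common_nbrs (R - {g i})) < r \<and>
        v \<in> common_nbrs (R - {g (SOME i. i < r \<and> v \<in> common_nbrs (R - {g i}))})"
      by (rule someI_ex)
    then show ?thesis using that by (simp add: p_def)
  qed
  have p1: "p x < r" for x using pW[of x] r by (cases "x \<in> W") (auto simp: p_def)
  define T where "T y = Sigma (common_nbrs (R - {y})) (\<lambda>z. common_nbrs (insert z (R - {y})))" for y
  have sub: "{(x, y) \<in> U \<times> U. A x y \<and> p x = p y} \<subseteq> (\<Union>y\<in>R. T y) \<union> ((U - W) \<times> U \<union> U \<times> (U - W))"
  proof (intro subrelI UnCI)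
    fix x y assume "(x, y) \<in> {(x, y) \<in> U \<times> U. A x y \<and> p x = p y}"
      and "(x, y) \<notin> (U - W) \<times> U \<union> U \<times> (U - W)"
    then have H: "x \<in> U" "y \<in> U" "A x y" "p x = p y" and W: "x \<in> W" "y \<in> W" by auto
    have "g (p x) \<in> R" using pW[OF W(1)] g unfolding bij_betw_def by auto
    moreover have "(x, y) \<in> T (g (p x))"
      using pW[OF W(1)] pW[OF W(2)] H sym unfolding T_def common_nbrs_def by auto
    ultimately show "(x, y) \<in> (\<Union>y\<in>R. T y)" by auto
  qed
  have fT: "finite (T y)" for y unfolding T_def by auto
  have "card {(x, y) \<in> U \<times> U. A x y \<and> p x = p y} \<le> card ((\<Union>y\<in>R. T y) \<union> ((U - W) \<times> U \<union> U \<times> (U - W)))"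
    by (rule card_mono[OF _ sub]) (use fR fT fin in auto)
  also have "\<dots> \<le> card (\<Union>y\<in>R. T y) + (card ((U - W) \<times> U) + card (U \<times> (U - W)))"
    by (meson card_Un_le le_trans add_left_mono)
  also have "card (\<Union>y\<in>R. T y) \<le> (\<Sum>y\<in>R. card (T y))" by (rule card_UN_le[OF fR])
  finally have "card {(x, y) \<in> U \<times> U. A x y \<and> p x = p y}
      \<le> (\<Sum>y\<in>R. card (T y)) + 2 * (card U * card (U - W))"
    by (simp add: card_cartesian_product mult.commute)
  then have "real (card {(x, y) \<in> U \<times> U. A x y \<and> p x = p y})
      \<le> real ((\<Sum>y\<in>R. card (T y)) + 2 * (card U * card (U - W)))"
    by (simp only: of_nat_le_iff)
  also have "\<dots> = 2 * (real (card U) * real (card (U - W))) +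
        (\<Sum>y\<in>R. \<Sum>z\<in>common_nbrs (R - {y}). real (card (common_nbrs (insert z (R - {y})))))"
    unfolding T_def by simp
  finally show ?thesis using that[of p] p1 unfolding W_def by blast
qed

end

lemma clique_stability:
  assumes "2 \<le> r" "0 < \<epsilon>"
  obtains \<delta> :: real where "0 < \<delta>"
    and "\<And>(U :: 'b set) A. finite_adjacency U A \<Longrightarrow>
      (1 - 1 / real r) * (real (card U))\<^sup>2 \<le> real (card {(x, y) \<in> U \<times> U. A x y}) \<Longrightarrow>
      real (card (finite_adjacency.cliques U A (Suc r))) \<le> \<delta> * real (card U) ^ Suc r \<Longrightarrow>
      \<exists>p. (\<forall>x. p x < r) \<and> real (card {(x, y) \<in> U \<times> U. A x y \<and> p x = p y}) \<le> \<epsilon> * (real (card U))\<^sup>2"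
proof -
  define \<kappa> where "\<kappa> = (\<Prod>j\<in>{1..<r}. (1 - real j / real r) / real (Suc j))"
  have \<kappa>: "0 < \<kappa>" unfolding \<kappa>_def by (intro prod_pos) auto
  \<comment> \<open>\<open>\<kappa>\<close> is the guaranteed density of \<open>r\<close>-cliques
    and \<open>4 * (r+1)^2\<close> the constant of \<open>exists_good_clique\<close>; the further
    factor 2 pays for pairs at uncovered vertices occurring in both orders.\<close>
  define \<delta> where "\<delta> = \<epsilon> * \<kappa> / (8 * real (Suc r)^2)"
  have \<delta>: "0 < \<delta>" unfolding \<delta>_def using \<kappa> assms by auto
  show ?thesis
  proof (rule that[OF \<delta>])
    fix U :: "'b set" and A
    assume "finite_adjacency U A"
      and dens: "(1 - 1 / real r) * (real (card U))\<^sup>2 \<le> real (card {(x, y) \<in> U \<times> U. A x y})"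
      and few: "real (card (finite_adjacency.cliques U A (Suc r))) \<le> \<delta> * real (card U) ^ Suc r"
    then interpret finite_adjacency U A by simp
    define n where "n = real (card U)"
    show "\<exists>p. (\<forall>x. p x < r) \<and> real (card {(x, y) \<in> U \<times> U. A x y \<and> p x = p y}) \<le> \<epsilon> * (real (card U))\<^sup>2"
    proof (cases "U = {}")
      case True
      then show ?thesis using assms by (intro exI[of _ "\<lambda>_. 0"]) auto
    next
      case False
      then have n0: "0 < n" unfolding n_def using fin by (simp add: card_gt_0_iff)
      have Nr: "\<kappa> * n ^ r \<le> real (card (cliques r))"
        unfolding \<kappa>_def n_def by (rule card_cliques_ge) (use assms dens in auto)
      have Npos: "0 < \<kappa> * n ^ r" using \<kappa> n0 by simp
      then have ne: "cliques r \<noteq> {}" using Nr by auto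
      obtain R where R: "R \<in> cliques r" and hR: "real (card (cliques r)) *
       (n * real (card (U - (\<Union>y\<in>R. common_nbrs (R - {y})))) +
        (\<Sum>y\<in>R. \<Sum>z\<in>common_nbrs (R - {y}). real (card (common_nbrs (insert z (R - {y}))))))
      \<le> 4 * real (Suc r)^2 * n * real (card (cliques (Suc r)))"
        using exists_good_clique[OF assms(1) dens ne] unfolding n_def by blast
      define a where "a = n * real (card (U - (\<Union>y\<in>R. common_nbrs (R - {y}))))"
      define b where "b = (\<Sum>y\<in>R. \<Sum>z\<in>common_nbrs (R - {y}). real (card (common_nbrs (insert z (R - {y})))))"
      have ab: "0 \<le> a" "0 \<le> b" unfolding a_def b_def using n0 by (auto intro!: sum_nonneg)
      obtain p where p: "\<And>x. p x < r"
        "real (card {(x, y) \<in> U \<times> U. A x y \<and> p x = p y}) \<le> 2 * a + b"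
        using stability_for_clique[OF R, of thesis] assms(1) unfolding a_def b_def n_def by auto
      have "(\<kappa> * n ^ r) * (a + b) \<le> real (card (cliques r)) * (a + b)"
        by (rule mult_right_mono[OF Nr]) (use ab in auto)
      also have "\<dots> \<le> 4 * real (Suc r)^2 * n * real (card (cliques (Suc r)))"
        using hR unfolding a_def b_def .
      also have "\<dots> \<le> 4 * real (Suc r)^2 * n * (\<delta> * n ^ Suc r)"
        by (rule mult_left_mono) (use few n0 in \<open>auto simp: n_def\<close>)
      also have "\<dots> = (\<kappa> * n ^ r) * (\<epsilon> / 2 * n\<^sup>2)"
        unfolding \<delta>_def by (simp add: power2_eq_square field_simps del: of_nat_Suc)
      finally have "a + b \<le> \<epsilon> / 2 * n\<^sup>2" using Npos by (rule mult_left_le_imp_le)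
      then have "2 * a + b \<le> \<epsilon> * n\<^sup>2" using ab by linarith
      then show ?thesis using p unfolding n_def by (intro exI[of _ p]) auto
    qed
  qed
qed

section \<open>Homomorphism counts of complete multipartite graphs under cloning\<close>

context finite_adjacency begin

text \<open>Homomorphisms of the complete multipartite graph on \<open>K\<close> whose classes are
  the fibres of \<open>c\<close>. It contains every graph properly coloured by \<open>c\<close>, and
  vertices of one class are interchangeable, as cloning requires.\<close>

definition multipartite_homs :: "('k \<Rightarrow> nat) \<Rightarrow> 'k set \<Rightarrow> ('k \<Rightarrow> 'b) set" where
  "multipartite_homs c K = {\<phi> \<in> K \<rightarrow>\<^sub>E U. \<forall>v\<in>K. \<forall>w\<in>K. c v \<noteq> c w \<longrightarrow> A (\<phi> v) (\<phi> w)}"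

lemma finite_multipartite_homs: "finite K \<Longrightarrow> finite (multipartite_homs c K)"
  unfolding multipartite_homs_def by (rule finite_subset[OF _ finite_PiE[of K "\<lambda>_. U"]]) (use fin in auto)

text \<open>Once the map is fixed outside \<open>v\<close>, the images allowed for \<open>v\<close>
  form a set \<open>X\<close>, and the twin \<open>v'\<close> may be placed in it independently,
  because vertices of equal colour impose no adjacency on each other. The claim is Cauchy-Schwarz
  for the sum of \<open>card X\<close> against the sum of its squares.\<close>

lemma card_multipartite_homs_clone:
  assumes "finite K" "v \<in> K" "v' \<notin> K" "c v' = c v"
  shows "(real (card (multipartite_homs c K)))\<^sup>2
    \<le> real (card U) ^ (card K - 1) * real (card (multipartite_homs c (insert v' K)))"
proof -
  define K0 where "K0 = K - {v}"
  have K: "K = insert v K0" "v \<notin> K0" "finite K0" using assms unfolding K0_def by auto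
  have v': "v' \<noteq> v" "v' \<notin> K0" using assms K by auto
  define H0 where "H0 = multipartite_homs c K0"
  have fH0: "finite H0" unfolding H0_def by (rule finite_multipartite_homs[OF K(3)])
  define X where "X \<psi> = {a \<in> U. \<forall>w\<in>K0. c w \<noteq> c v \<longrightarrow> A a (\<psi> w)}" for \<psi>
  have fX: "finite (X \<psi>)" for \<psi> unfolding X_def using fin by auto
  have "card (multipartite_homs c K) \<le> card (Sigma H0 X)"
  proof (rule card_inj_on_le[where f = "\<lambda>\<phi>. (restrict \<phi> K0, \<phi> v)"])
    show "inj_on (\<lambda>\<phi>. (restrict \<phi> K0, \<phi> v)) (multipartite_homs c K)"
    proof (rule inj_onI)
      fix f g assume f: "f \<in> multipartite_homs c K" and g: "g \<in> multipartite_homs c K"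
        and eq: "(restrict f K0, f v) = (restrict g K0, g v)"
      show "f = g"
      proof (rule PiE_ext)
        show "f \<in> K \<rightarrow>\<^sub>E U" "g \<in> K \<rightarrow>\<^sub>E U" using f g unfolding multipartite_homs_def by auto
        fix x assume "x \<in> K"
        then show "f x = g x" using eq K by (metis Pair_inject insertE restrict_apply')
      qed
    qed
    show "(\<lambda>\<phi>. (restrict \<phi> K0, \<phi> v)) ` multipartite_homs c K \<subseteq> Sigma H0 X"
    proof (rule image_subsetI)
      fix \<phi> assume "\<phi> \<in> multipartite_homs c K"
      then have fn: "\<phi> \<in> K \<rightarrow>\<^sub>E U" and hom: "\<And>v w. v \<in> K \<Longrightarrow> w \<in> K \<Longrightarrow> c v \<noteq> c w \<Longrightarrow> A (\<phi> v) (\<phi> w)"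
        unfolding multipartite_homs_def by auto
      have "restrict \<phi> K0 \<in> H0"
        using fn hom K(1) unfolding H0_def multipartite_homs_def by auto
      moreover have "\<phi> v \<in> X (restrict \<phi> K0)"
        using fn hom[of v] K(1) unfolding X_def by auto
      ultimately show "(restrict \<phi> K0, \<phi> v) \<in> Sigma H0 X" by auto
    qed
    show "finite (Sigma H0 X)" using fH0 fX by auto
  qed
  then have "real (card (multipartite_homs c K)) \<le> real (card (Sigma H0 X))"
    by (simp only: of_nat_le_iff)
  then have 1: "real (card (multipartite_homs c K)) \<le> (\<Sum>\<psi>\<in>H0. real (card (X \<psi>)))"
    using fH0 fX by simp
  have "card (Sigma H0 (\<lambda>\<psi>. X \<psi> \<times> X \<psi>)) \<le> card (multipartite_homs c (insert v' K))"
  proof (rule card_inj_on_le[where f = "\<lambda>(\<psi>, a, b). \<psi>(v := a, v' := b)"])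
    show "inj_on (\<lambda>(\<psi>, a, b). \<psi>(v := a, v' := b)) (Sigma H0 (\<lambda>\<psi>. X \<psi> \<times> X \<psi>))"
    proof (rule inj_onI)
      fix x y assume "x \<in> Sigma H0 (\<lambda>\<psi>. X \<psi> \<times> X \<psi>)" "y \<in> Sigma H0 (\<lambda>\<psi>. X \<psi> \<times> X \<psi>)"
        and eq': "(case x of (\<psi>, a, b) \<Rightarrow> \<psi>(v := a, v' := b)) = (case y of (\<psi>, a, b) \<Rightarrow> \<psi>(v := a, v' := b))"
      then obtain f a b g a' b' where xy: "x = (f, a, b)" "y = (g, a', b')" and f: "f \<in> H0" and g: "g \<in> H0"
        by auto
      then have eq: "f(v := a, v' := b) = g(v := a', v' := b')" using eq' by simp
      have "a = a'" "b = b'" using fun_cong[OF eq, of v] fun_cong[OF eq, of v'] v' by auto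
      moreover have "f = g"
      proof (rule PiE_ext)
        show "f \<in> K0 \<rightarrow>\<^sub>E U" "g \<in> K0 \<rightarrow>\<^sub>E U" using f g unfolding multipartite_homs_def H0_def by auto
        fix x assume "x \<in> K0"
        then have "x \<noteq> v" "x \<noteq> v'" using K v' by auto
        then show "f x = g x" using fun_cong[OF eq, of x] by simp
      qed
      ultimately show "x = y" using xy by simp
    qed
    show "(\<lambda>(\<psi>, a, b). \<psi>(v := a, v' := b)) ` Sigma H0 (\<lambda>\<psi>. X \<psi> \<times> X \<psi>) \<subseteq> multipartite_homs c (insert v' K)"
    proof clarify
      fix \<psi> a b assume \<psi>: "\<psi> \<in> H0" and a: "a \<in> X \<psi>" and b: "b \<in> X \<psi>"
      let ?f = "\<psi>(v := a, v' := b)"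
      have fn: "\<psi> \<in> K0 \<rightarrow>\<^sub>E U" and hom: "\<And>v w. v \<in> K0 \<Longrightarrow> w \<in> K0 \<Longrightarrow> c v \<noteq> c w \<Longrightarrow> A (\<psi> v) (\<psi> w)"
        using \<psi> unfolding H0_def multipartite_homs_def by auto
      have "?f \<in> insert v' K \<rightarrow>\<^sub>E U"
        using fn a b K unfolding X_def PiE_def extensional_def by auto
      moreover have "A (?f x) (?f y)" if "x \<in> insert v' K" "y \<in> insert v' K" "c x \<noteq> c y" for x y
      proof -
        have nb: "A a (\<psi> w)" "A b (\<psi> w)" "A (\<psi> w) a" "A (\<psi> w) b" if "w \<in> K0" "c w \<noteq> c v" for w
          using that a b sym unfolding X_def by blast+
        show ?thesis using that nb[of x] nb[of y] v' K(1,2) hom[of x y] assms(4) by (auto split: if_splits)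
      qed
      ultimately show "?f \<in> multipartite_homs c (insert v' K)" unfolding multipartite_homs_def by blast
    qed
    show "finite (multipartite_homs c (insert v' K))" using assms by (intro finite_multipartite_homs) auto
  qed
  then have "real (card (Sigma H0 (\<lambda>\<psi>. X \<psi> \<times> X \<psi>))) \<le> real (card (multipartite_homs c (insert v' K)))"
    by (simp only: of_nat_le_iff)
  then have 2: "(\<Sum>\<psi>\<in>H0. (real (card (X \<psi>)))\<^sup>2) \<le> real (card (multipartite_homs c (insert v' K)))"
    using fH0 fX by (simp add: card_cartesian_product power2_eq_square)
  have "card H0 \<le> card (K0 \<rightarrow>\<^sub>E U)" unfolding H0_def multipartite_homs_def
    by (rule card_mono) (use K fin in \<open>auto intro: finite_PiE\<close>)
  also have "\<dots> = card U ^ (card K - 1)" using K by (simp add: card_PiE)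
  finally have 3: "real (card H0) \<le> real (card U) ^ (card K - 1)" by (simp flip: of_nat_power)
  have "(real (card (multipartite_homs c K)))\<^sup>2 \<le> (\<Sum>\<psi>\<in>H0. real (card (X \<psi>)))\<^sup>2"
    using 1 by (intro power_mono) auto
  also have "\<dots> \<le> (\<Sum>\<psi>\<in>H0. (real (card (X \<psi>)))\<^sup>2) * real (card H0)"
    by (rule sum_squared_le_sum_of_squares)
  also have "\<dots> \<le> real (card (multipartite_homs c (insert v' K))) * real (card U) ^ (card K - 1)"
    by (intro mult_mono 2 3) auto
  finally show ?thesis by (simp add: mult.commute)
qed

text \<open>Each cloned vertex squares the density, whence the exponent
  \<open>2 ^ card J\<close>.\<close>

lemma card_multipartite_homs_extend:
  fixes c :: "'k \<Rightarrow> nat"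
  assumes "finite B" "finite J" "B \<inter> J = {}" "U \<noteq> {}" "0 \<le> \<delta>"
    and rep: "\<And>v. v \<in> J \<Longrightarrow> \<exists>w\<in>B. c w = c v"
    and base: "\<delta> * real (card U) ^ card B \<le> real (card (multipartite_homs c B))"
  shows "\<delta> ^ (2 ^ card J) * real (card U) ^ card (B \<union> J) \<le> real (card (multipartite_homs c (B \<union> J)))"
  using assms(2,3) rep
proof (induction J)
  case empty
  then show ?case using base by simp
next
  case (insert v' J)
  define n where "n = real (card U)"
  have n0: "0 < n" using \<open>U \<noteq> {}\<close> fin by (simp add: n_def card_gt_0_iff)
  define K where "K = B \<union> J"
  obtain v where v: "v \<in> B" "c v = c v'" using insert.prems(2)[of v'] by auto
  have K: "finite K" "v \<in> K" "v' \<notin> K" using insert assms v unfolding K_def by auto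
  then have cK: "0 < card K" by (auto simp: card_gt_0_iff)
  define h where "h = real (card (multipartite_homs c (insert v' K)))"
  have IH: "\<delta> ^ (2 ^ card J) * n ^ card K \<le> real (card (multipartite_homs c K))"
    unfolding K_def n_def by (rule insert.IH) (use insert.prems in auto)
  have "(\<delta> ^ (2 ^ card J) * n ^ card K)\<^sup>2 \<le> (real (card (multipartite_homs c K)))\<^sup>2"
    using IH assms(5) n0 by (intro power_mono) auto
  also have "\<dots> \<le> n ^ (card K - 1) * h"
    unfolding n_def h_def by (rule card_multipartite_homs_clone[OF K v(2)[symmetric]])
  finally have le: "(\<delta> ^ (2 ^ card J) * n ^ card K)\<^sup>2 \<le> n ^ (card K - 1) * h" .
  have "(\<delta> ^ (2 ^ card J) * n ^ card K)\<^sup>2 = \<delta> ^ (2 ^ Suc (card J)) * n ^ (card K * 2)"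
    by (simp add: power_mult_distrib power_mult[symmetric] mult.commute)
  also have "card K * 2 = (card K - 1) + Suc (card K)" using cK by simp
  finally have "n ^ (card K - 1) * (\<delta> ^ (2 ^ Suc (card J)) * n ^ Suc (card K)) \<le> n ^ (card K - 1) * h"
    using le by (simp only: power_add mult_ac)
  then have "\<delta> ^ (2 ^ Suc (card J)) * n ^ Suc (card K) \<le> h"
    by (rule mult_left_le_imp_le) (use n0 in simp)
  moreover have "B \<union> insert v' J = insert v' K" "card (insert v' K) = Suc (card K)" "card (insert v' J) = Suc (card J)"
    using K insert.hyps unfolding K_def by auto
  ultimately show ?case unfolding h_def n_def by simp
qed

lemma card_cliques_le_homs:
  assumes "\<And>i. i < s \<Longrightarrow> c (e i) = i" "inj_on e {..<s}"
  shows "card (cliques s) \<le> card (multipartite_homs c (e ` {..<s}))"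
proof -
  let ?H = "multipartite_homs c (e ` {..<s})"
  have "cliques s \<subseteq> (\<lambda>\<phi>. \<phi> ` (e ` {..<s})) ` ?H"
  proof
    fix S assume S: "S \<in> cliques s"
    have "card S = s" using S by (simp add: cliques_def)
    then obtain g where g: "bij_betw g {..<s} S"
      using ex_bij_betw_nat_finite[OF finite_clique[OF S]] by (auto simp: lessThan_atLeast0)
    define \<phi> where "\<phi> = restrict (\<lambda>v. g (c v)) (e ` {..<s})"
    have gS: "g i \<in> S" if "i < s" for i using g that unfolding bij_betw_def by auto
    have \<phi>e: "\<phi> (e i) = g i" if "i < s" for i using that assms(1) unfolding \<phi>_def by auto
    have "\<phi> \<in> e ` {..<s} \<rightarrow>\<^sub>E U"
      using gS S assms(1) unfolding \<phi>_def cliques_def by auto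
    moreover have "A (\<phi> v) (\<phi> w)" if vw: "v \<in> e ` {..<s}" "w \<in> e ` {..<s}" "c v \<noteq> c w" for v w
    proof -
      obtain i j where ij: "v = e i" "w = e j" "i < s" "j < s" using vw by auto
      then have "i \<noteq> j" using vw by auto
      then have "g i \<noteq> g j" using g ij unfolding bij_betw_def inj_on_def by auto
      then show ?thesis using ij gS \<phi>e S unfolding cliques_def by auto
    qed
    ultimately have "\<phi> \<in> ?H" unfolding multipartite_homs_def by blast
    moreover have "\<phi> ` (e ` {..<s}) = S"
      using g \<phi>e unfolding bij_betw_def by (auto simp: image_image)
    ultimately show "S \<in> (\<lambda>\<phi>. \<phi> ` (e ` {..<s})) ` ?H" by blast
  qed
  then show ?thesis by (intro surj_card_le) (auto intro: finite_multipartite_homs)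
qed

text \<open>A clique on fresh vertices \<open>Inl i\<close> carries one vertex of every colour, so
  that each vertex of \<open>V\<close> has something to be cloned from even if \<open>c\<close>
  omits colours on \<open>V\<close>. Restricting to \<open>V\<close> afterwards costs at most a
  factor \<open>n ^ s\<close>, the number of placements of the fresh vertices.\<close>

lemma card_multipartite_homs_blowup:
  fixes c :: "'k \<Rightarrow> nat"
  assumes "finite V" "\<And>v. v \<in> V \<Longrightarrow> c v < s" "U \<noteq> {}" "0 \<le> \<delta>"
    and many: "\<delta> * real (card U) ^ s \<le> real (card (cliques s))"
  shows "\<delta> ^ (2 ^ card V) * real (card U) ^ card V \<le> real (card (multipartite_homs c V))"
proof -
  define n where "n = real (card U)"
  have n0: "0 < n" using \<open>U \<noteq> {}\<close> fin by (simp add: n_def card_gt_0_iff)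
  define c' where "c' = case_sum (\<lambda>i::nat. i) c"
  define B :: "(nat + 'k) set" where "B = Inl ` {..<s}"
  define J :: "(nat + 'k) set" where "J = Inr ` V"
  have fin': "finite B" "finite J" "B \<inter> J = {}" using assms unfolding B_def J_def by auto
  have cB: "card B = s" "card J = card V" unfolding B_def J_def by (auto simp: card_image)
  have "card (cliques s) \<le> card (multipartite_homs c' B)"
    unfolding B_def by (rule card_cliques_le_homs) (auto simp: c'_def)
  then have "\<delta> * n ^ card B \<le> real (card (multipartite_homs c' B))"
    using many unfolding n_def cB by linarith
  then have "\<delta> ^ (2 ^ card J) * n ^ card (B \<union> J) \<le> real (card (multipartite_homs c' (B \<union> J)))"
    unfolding n_def using assms fin'
    by (intro card_multipartite_homs_extend) (auto simp: B_def J_def c'_def)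
  also have "card (multipartite_homs c' (B \<union> J)) \<le> card ((B \<rightarrow>\<^sub>E U) \<times> multipartite_homs c V)"
  proof (rule card_inj_on_le[where f = "\<lambda>\<phi>. (restrict \<phi> B, restrict (\<lambda>v. \<phi> (Inr v)) V)"])
    show "inj_on (\<lambda>\<phi>. (restrict \<phi> B, restrict (\<lambda>v. \<phi> (Inr v)) V)) (multipartite_homs c' (B \<union> J))"
    proof (rule inj_onI)
      fix f g assume f: "f \<in> multipartite_homs c' (B \<union> J)" and g: "g \<in> multipartite_homs c' (B \<union> J)"
        and eq: "(restrict f B, restrict (\<lambda>v. f (Inr v)) V) = (restrict g B, restrict (\<lambda>v. g (Inr v)) V)"
      show "f = g"
      proof (rule PiE_ext)
        show "f \<in> (B \<union> J) \<rightarrow>\<^sub>E U" "g \<in> (B \<union> J) \<rightarrow>\<^sub>E U" using f g unfolding multipartite_homs_def by auto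
        fix x assume x: "x \<in> B \<union> J"
        have eqs: "restrict f B y = restrict g B y" "restrict (\<lambda>v. f (Inr v)) V z = restrict (\<lambda>v. g (Inr v)) V z" for y z
          using eq by simp_all
        show "f x = g x"
          using x eqs(1)[of x] eqs(2) unfolding J_def by (auto split: if_splits) (metis restrict_apply')
      qed
    qed
    show "(\<lambda>\<phi>. (restrict \<phi> B, restrict (\<lambda>v. \<phi> (Inr v)) V)) ` multipartite_homs c' (B \<union> J)
        \<subseteq> (B \<rightarrow>\<^sub>E U) \<times> multipartite_homs c V"
      unfolding multipartite_homs_def J_def c'_def by (auto simp: PiE_def Pi_def)
    show "finite ((B \<rightarrow>\<^sub>E U) \<times> multipartite_homs c V)"
      using assms fin' fin by (auto intro: finite_multipartite_homs finite_PiE)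
  qed
  also have "real \<dots> = n ^ s * real (card (multipartite_homs c V))"
    using fin' cB by (simp add: card_cartesian_product card_PiE n_def)
  also have "card (B \<union> J) = s + card V" using fin' cB by (simp add: card_Un_disjoint)
  finally have "n ^ s * (\<delta> ^ (2 ^ card V) * n ^ card V) \<le> n ^ s * real (card (multipartite_homs c V))"
    unfolding cB by (simp only: power_add mult_ac of_nat_le_iff)
  then show ?thesis unfolding n_def[symmetric]
    by (rule mult_left_le_imp_le) (use n0 in simp)
qed

end

section \<open>Embeddings, copies and automorphisms\<close>

lemma simple_graphD:
  assumes "simple_graph V E"
  shows "finite V" "{x, y} \<in> E \<Longrightarrow> x \<in> V" "{x, y} \<in> E \<Longrightarrow> y \<in> V" "{x, y} \<in> E \<Longrightarrow> x \<noteq> y"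
proof -
  show "finite V" using assms unfolding simple_graph_def by simp
  have *: "x \<in> V \<and> y \<in> V \<and> x \<noteq> y" if "{x, y} \<in> E" for x y
    using assms that unfolding simple_graph_def by (metis doubleton_eq_iff)
  show "{x, y} \<in> E \<Longrightarrow> x \<in> V" "{x, y} \<in> E \<Longrightarrow> y \<in> V" "{x, y} \<in> E \<Longrightarrow> x \<noteq> y" using * by auto
qed

lemma simple_graph_edgeE:
  assumes "simple_graph V E" "e \<in> E"
  obtains x y where "x \<noteq> y" "x \<in> V" "y \<in> V" "e = {x, y}"
  using assms unfolding simple_graph_def by blast

text \<open>Embeddings as a subgraph, not as an induced one. Extensionality makes them determined by
  their values on \<open>V\<close>, so that they can be counted.\<close>

definition embeddings :: "'a set \<Rightarrow> 'a set set \<Rightarrow> nat \<Rightarrow> nat set set \<Rightarrow> ('a \<Rightarrow> nat) set" where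
  "embeddings V E n EG = {\<phi> \<in> V \<rightarrow>\<^sub>E {0..<n}. inj_on \<phi> V \<and>
      (\<forall>x\<in>V. \<forall>y\<in>V. {x, y} \<in> E \<longrightarrow> {\<phi> x, \<phi> y} \<in> EG)}"

lemma finite_embeddings: "finite V \<Longrightarrow> finite (embeddings V E n EG)"
  unfolding embeddings_def by (rule finite_subset[OF _ finite_PiE[of V "\<lambda>_. {0..<n}"]]) auto

lemma edge_image_iff:
  assumes "simple_graph V E" "inj_on \<phi> V" "x \<in> V" "y \<in> V"
  shows "{\<phi> x, \<phi> y} \<in> (\<lambda>e. \<phi> ` e) ` E \<longleftrightarrow> {x, y} \<in> E"
proof
  assume "{\<phi> x, \<phi> y} \<in> (\<lambda>e. \<phi> ` e) ` E"
  then obtain e where e: "e \<in> E" "\<phi> ` {x, y} = \<phi> ` e" by auto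
  have "e \<subseteq> V" using assms(1) e unfolding simple_graph_def by auto
  then have "{x, y} = e" using e assms inj_on_image_eq_iff[OF assms(2), of "{x, y}" e] by auto
  then show "{x, y} \<in> E" using e by simp
next
  assume "{x, y} \<in> E"
  then have "\<phi> ` {x, y} \<in> (\<lambda>e. \<phi> ` e) ` E" by (rule imageI)
  then show "{\<phi> x, \<phi> y} \<in> (\<lambda>e. \<phi> ` e) ` E" by simp
qed

definition automorphisms :: "'a set \<Rightarrow> 'a set set \<Rightarrow> ('a \<Rightarrow> 'a) set" where
  "automorphisms V E = {\<phi>. bij_betw \<phi> V V \<and> (\<forall>x. x \<notin> V \<longrightarrow> \<phi> x = x) \<and>
      (\<forall>x\<in>V. \<forall>y\<in>V. {x, y} \<in> E \<longleftrightarrow> {\<phi> x, \<phi> y} \<in> E)}"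

lemma num_aut_eq: "num_aut V E = card (automorphisms V E)"
  unfolding num_aut_def automorphisms_def ..

lemma num_aut_pos:
  assumes "finite V"
  shows "0 < num_aut V E"
proof -
  have "automorphisms V E \<subseteq> {\<phi>. (\<forall>x. x \<in> V \<longrightarrow> \<phi> x \<in> V) \<and> (\<forall>x. x \<notin> V \<longrightarrow> \<phi> x = x)}"
    unfolding automorphisms_def bij_betw_def by auto
  also have "\<dots> \<subseteq> (\<lambda>\<psi> x. if x \<in> V then \<psi> x else x) ` (V \<rightarrow>\<^sub>E V)"
  proof clarify
    fix \<phi> :: "'a \<Rightarrow> 'a" assume "\<forall>x. x \<in> V \<longrightarrow> \<phi> x \<in> V" "\<forall>x. x \<notin> V \<longrightarrow> \<phi> x = x"
    then have "restrict \<phi> V \<in> V \<rightarrow>\<^sub>E V" "\<phi> = (\<lambda>x. if x \<in> V then restrict \<phi> V x else x)" by auto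
    then show "\<phi> \<in> (\<lambda>\<psi> x. if x \<in> V then \<psi> x else x) ` (V \<rightarrow>\<^sub>E V)" by (simp add: image_iff, blast)
  qed
  finally have "finite (automorphisms V E)"
    using assms by (meson finite_PiE finite_imageI finite_subset)
  moreover have "id \<in> automorphisms V E" unfolding automorphisms_def by auto
  ultimately show ?thesis unfolding num_aut_eq by (auto simp: card_gt_0_iff)
qed

text \<open>The equivalence of edges in \<open>copies\<close> is asked against \<open>H\<close> and
  not against \<open>EG\<close>, so a copy is a plain subgraph and \<open>H\<close> is exactly the
  image of \<open>E\<close>.\<close>

lemma copies_eq_image:
  assumes F: "simple_graph V E" and G: "simple_graph {0..<n} EG"
  shows "copies V E n EG = (\<lambda>\<phi>. (\<phi> ` V, (\<lambda>e. \<phi> ` e) ` E)) ` embeddings V E n EG"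
proof (rule set_eqI, rule iffI)
  fix c assume "c \<in> copies V E n EG"
  then obtain W H \<phi> where c: "c = (W, H)" and W: "W \<subseteq> {0..<n}" and H: "H \<subseteq> EG" and HW: "\<forall>e\<in>H. e \<subseteq> W"
    and b: "bij_betw \<phi> V W" and iff: "\<forall>x\<in>V. \<forall>y\<in>V. {x, y} \<in> E \<longleftrightarrow> {\<phi> x, \<phi> y} \<in> H"
    unfolding copies_def by auto
  define \<psi> where "\<psi> = restrict \<phi> V"
  have e: "\<psi> x = \<phi> x" if "x \<in> V" for x using that unfolding \<psi>_def by simp
  have "inj_on \<phi> V" "\<phi> ` V = W" using b unfolding bij_betw_def by auto
  then have im: "\<psi> ` V = W" and inj: "inj_on \<psi> V" using e by (auto simp: inj_on_def)
  have emb: "\<psi> \<in> embeddings V E n EG"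
    unfolding embeddings_def using inj im W H iff e by (auto simp: \<psi>_def)
  have "(\<lambda>e. \<psi> ` e) ` E = H"
  proof
    show "(\<lambda>e. \<psi> ` e) ` E \<subseteq> H"
    proof clarify
      fix d assume d: "d \<in> E"
      obtain x y where "x \<in> V" "y \<in> V" "d = {x, y}" using F d by (rule simple_graph_edgeE)
      then show "\<psi> ` d \<in> H" using d iff e by auto
    qed
    show "H \<subseteq> (\<lambda>e. \<psi> ` e) ` E"
    proof
      fix h assume h: "h \<in> H"
      then have "h \<in> EG" using H by auto
      then obtain a b where ab: "h = {a, b}" using G by (meson simple_graph_edgeE)
      then have "a \<in> \<psi> ` V" "b \<in> \<psi> ` V" using HW h im by auto
      then obtain x y where xy: "x \<in> V" "y \<in> V" "a = \<psi> x" "b = \<psi> y" by auto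
      then have "{x, y} \<in> E" using iff h ab e by auto
      then show "h \<in> (\<lambda>e. \<psi> ` e) ` E" using edge_image_iff[OF F inj xy(1,2)] ab xy by simp
    qed
  qed
  then show "c \<in> (\<lambda>\<phi>. (\<phi> ` V, (\<lambda>e. \<phi> ` e) ` E)) ` embeddings V E n EG"
    using emb c im by auto
next
  fix c assume "c \<in> (\<lambda>\<phi>. (\<phi> ` V, (\<lambda>e. \<phi> ` e) ` E)) ` embeddings V E n EG"
  then obtain \<phi> where c: "c = (\<phi> ` V, (\<lambda>e. \<phi> ` e) ` E)" and \<phi>: "\<phi> \<in> embeddings V E n EG" by auto
  have inj: "inj_on \<phi> V" and fn: "\<phi> \<in> V \<rightarrow>\<^sub>E {0..<n}"
    and hom: "\<And>x y. x \<in> V \<Longrightarrow> y \<in> V \<Longrightarrow> {x, y} \<in> E \<Longrightarrow> {\<phi> x, \<phi> y} \<in> EG"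
    using \<phi> unfolding embeddings_def by auto
  have "(\<lambda>e. \<phi> ` e) ` E \<subseteq> EG"
  proof clarify
    fix d assume d: "d \<in> E"
    obtain x y where "x \<in> V" "y \<in> V" "d = {x, y}" using F d by (rule simple_graph_edgeE)
    then show "\<phi> ` d \<in> EG" using d hom by auto
  qed
  moreover have "\<forall>e\<in>(\<lambda>e. \<phi> ` e) ` E. e \<subseteq> \<phi> ` V"
    using F unfolding simple_graph_def by auto
  moreover have "\<forall>x\<in>V. \<forall>y\<in>V. {x, y} \<in> E \<longleftrightarrow> {\<phi> x, \<phi> y} \<in> (\<lambda>e. \<phi> ` e) ` E"
    using edge_image_iff[OF F inj] by blast
  moreover have "\<phi> ` V \<subseteq> {0..<n}" "bij_betw \<phi> V (\<phi> ` V)" using fn inj unfolding bij_betw_def by auto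
  ultimately show "c \<in> copies V E n EG" unfolding copies_def c by blast
qed

text \<open>Two embeddings with the same image differ by an automorphism, namely the inverse of
  \<open>\<phi>0\<close> after \<open>\<phi>\<close>, extended by the identity outside
  \<open>V\<close> to match the normalisation in \<open>num_aut\<close>.\<close>

lemma card_embeddings_fibre:
  assumes F: "simple_graph V E" and \<phi>0: "\<phi>0 \<in> embeddings V E n EG"
  shows "card {\<phi> \<in> embeddings V E n EG. (\<phi> ` V, (\<lambda>e. \<phi> ` e) ` E) = (\<phi>0 ` V, (\<lambda>e. \<phi>0 ` e) ` E)}
    = num_aut V E"
proof -
  let ?S = "{\<phi> \<in> embeddings V E n EG. (\<phi> ` V, (\<lambda>e. \<phi> ` e) ` E) = (\<phi>0 ` V, (\<lambda>e. \<phi>0 ` e) ` E)}"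
  have inj0: "inj_on \<phi>0 V" and fn0: "\<phi>0 \<in> V \<rightarrow>\<^sub>E {0..<n}"
    and hom0: "\<And>x y. x \<in> V \<Longrightarrow> y \<in> V \<Longrightarrow> {x, y} \<in> E \<Longrightarrow> {\<phi>0 x, \<phi>0 y} \<in> EG"
    using \<phi>0 unfolding embeddings_def by auto
  have "bij_betw (\<lambda>\<sigma>. restrict (\<lambda>x. \<phi>0 (\<sigma> x)) V) (automorphisms V E) ?S"
  proof (rule bij_betw_byWitness[where f' = "\<lambda>\<phi> x. if x \<in> V then inv_into V \<phi>0 (\<phi> x) else x"])
    show "\<forall>\<sigma>\<in>automorphisms V E. (\<lambda>x. if x \<in> V then inv_into V \<phi>0 (restrict (\<lambda>x. \<phi>0 (\<sigma> x)) V x) else x) = \<sigma>"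
    proof
      fix \<sigma> assume "\<sigma> \<in> automorphisms V E"
      then have "\<sigma> x \<in> V" if "x \<in> V" for x
        using that unfolding automorphisms_def bij_betw_def by auto
      moreover have "\<sigma> x = x" if "x \<notin> V" for x
        using that \<open>\<sigma> \<in> automorphisms V E\<close> unfolding automorphisms_def by auto
      ultimately show "(\<lambda>x. if x \<in> V then inv_into V \<phi>0 (restrict (\<lambda>x. \<phi>0 (\<sigma> x)) V x) else x) = \<sigma>"
        using inj0 by (auto simp: fun_eq_iff inv_into_f_f)
    qed
    show "\<forall>\<phi>\<in>?S. restrict (\<lambda>x. \<phi>0 (if x \<in> V then inv_into V \<phi>0 (\<phi> x) else x)) V = \<phi>"
    proof
      fix \<phi> assume "\<phi> \<in> ?S"
      then have fn: "\<phi> \<in> V \<rightarrow>\<^sub>E {0..<n}" and im: "\<phi> ` V = \<phi>0 ` V" unfolding embeddings_def by auto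
      show "restrict (\<lambda>x. \<phi>0 (if x \<in> V then inv_into V \<phi>0 (\<phi> x) else x)) V = \<phi>"
      proof
        fix x
        show "restrict (\<lambda>x. \<phi>0 (if x \<in> V then inv_into V \<phi>0 (\<phi> x) else x)) V x = \<phi> x"
        proof (cases "x \<in> V")
          case True
          then have "\<phi> x \<in> \<phi>0 ` V" using im by auto
          then show ?thesis using True by (simp add: f_inv_into_f)
        next
          case False
          then have "\<phi> x = undefined" using fn by (auto simp: PiE_def extensional_def)
          then show ?thesis using False by simp
        qed
      qed
    qed
    show "(\<lambda>\<sigma>. restrict (\<lambda>x. \<phi>0 (\<sigma> x)) V) ` automorphisms V E \<subseteq> ?S"
    proof (rule image_subsetI)
      fix \<sigma> assume "\<sigma> \<in> automorphisms V E"
      then have inj: "inj_on \<sigma> V" and im: "\<sigma> ` V = V"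
        and iff: "\<And>x y. x \<in> V \<Longrightarrow> y \<in> V \<Longrightarrow> {x, y} \<in> E \<longleftrightarrow> {\<sigma> x, \<sigma> y} \<in> E"
        unfolding automorphisms_def bij_betw_def by auto
      have \<sigma>V: "\<sigma> x \<in> V" if "x \<in> V" for x using im that by auto
      define \<phi> where "\<phi> = restrict (\<lambda>x. \<phi>0 (\<sigma> x)) V"
      have \<phi>x: "\<phi> x = \<phi>0 (\<sigma> x)" if "x \<in> V" for x using that unfolding \<phi>_def by simp
      have injp: "inj_on \<phi> V" using inj inj0 \<sigma>V \<phi>x unfolding inj_on_def by auto
      have emb: "\<phi> \<in> embeddings V E n EG"
      proof -
        have "\<phi> \<in> V \<rightarrow>\<^sub>E {0..<n}" using fn0 \<sigma>V unfolding \<phi>_def by (auto dest: PiE_mem)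
        moreover have "{\<phi> x, \<phi> y} \<in> EG" if xy: "x \<in> V" "y \<in> V" "{x, y} \<in> E" for x y
          using hom0[of "\<sigma> x" "\<sigma> y"] iff[OF xy(1,2)] \<sigma>V xy \<phi>x by simp
        ultimately show ?thesis unfolding embeddings_def using injp by blast
      qed
      have imV: "\<phi> ` V = \<phi>0 ` V" using \<phi>x im by (metis (mono_tags, lifting) image_cong image_image)
      have "(\<lambda>e. \<phi> ` e) ` E = (\<lambda>e. \<phi>0 ` e) ` E"
      proof
        show "(\<lambda>e. \<phi> ` e) ` E \<subseteq> (\<lambda>e. \<phi>0 ` e) ` E"
        proof (rule image_subsetI)
          fix d assume d: "d \<in> E"
          obtain x y where xy: "x \<in> V" "y \<in> V" "d = {x, y}" using F d by (rule simple_graph_edgeE)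
          then have "{\<sigma> x, \<sigma> y} \<in> E" using iff[of x y] d by simp
          moreover have "\<phi> ` d = \<phi>0 ` {\<sigma> x, \<sigma> y}" using xy \<phi>x by auto
          ultimately show "\<phi> ` d \<in> (\<lambda>e. \<phi>0 ` e) ` E" by blast
        qed
        show "(\<lambda>e. \<phi>0 ` e) ` E \<subseteq> (\<lambda>e. \<phi> ` e) ` E"
        proof (rule image_subsetI)
          fix d assume d: "d \<in> E"
          obtain a b where ab: "a \<in> V" "b \<in> V" "d = {a, b}" using F d by (rule simple_graph_edgeE)
          then obtain x y where xy: "x \<in> V" "y \<in> V" "a = \<sigma> x" "b = \<sigma> y" using im by (metis imageE)
          then have "{x, y} \<in> E" using iff[of x y] d ab by simp
          moreover have "\<phi>0 ` d = \<phi> ` {x, y}" using xy ab \<phi>x by auto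
          ultimately show "\<phi>0 ` d \<in> (\<lambda>e. \<phi> ` e) ` E" by blast
        qed
      qed
      then show "restrict (\<lambda>x. \<phi>0 (\<sigma> x)) V \<in> ?S" using emb imV unfolding \<phi>_def by simp
    qed
    show "(\<lambda>\<phi> x. if x \<in> V then inv_into V \<phi>0 (\<phi> x) else x) ` ?S \<subseteq> automorphisms V E"
    proof (rule image_subsetI)
      fix \<phi> assume \<phi>: "\<phi> \<in> ?S"
      then have inj: "inj_on \<phi> V" and im: "\<phi> ` V = \<phi>0 ` V" and imE: "(\<lambda>e. \<phi> ` e) ` E = (\<lambda>e. \<phi>0 ` e) ` E"
        unfolding embeddings_def by auto
      define \<sigma> where "\<sigma> = (\<lambda>x. if x \<in> V then inv_into V \<phi>0 (\<phi> x) else x)"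
      have \<phi>\<sigma>: "\<phi>0 (\<sigma> x) = \<phi> x" and \<sigma>V: "\<sigma> x \<in> V" if "x \<in> V" for x
      proof -
        have "\<phi> x \<in> \<phi>0 ` V" using im that by auto
        then show "\<phi>0 (\<sigma> x) = \<phi> x" "\<sigma> x \<in> V" using that unfolding \<sigma>_def by (auto simp: f_inv_into_f inv_into_into)
      qed
      have "inj_on \<sigma> V"
      proof (rule inj_onI)
        fix x y assume "x \<in> V" "y \<in> V" "\<sigma> x = \<sigma> y"
        then show "x = y" using \<phi>\<sigma> inj by (metis inj_onD)
      qed
      moreover have "\<sigma> ` V = V"
      proof
        show "\<sigma> ` V \<subseteq> V" using \<sigma>V by auto
        show "V \<subseteq> \<sigma> ` V"
        proof
          fix y assume y: "y \<in> V"
          then have "\<phi>0 y \<in> \<phi> ` V" using im by auto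
          then obtain x where x: "x \<in> V" "\<phi> x = \<phi>0 y" by auto
          then have "\<sigma> x = y" using \<phi>\<sigma>[OF x(1)] \<sigma>V[OF x(1)] inj0 y by (metis inj_onD)
          then show "y \<in> \<sigma> ` V" using x by auto
        qed
      qed
      moreover have "{x, y} \<in> E \<longleftrightarrow> {\<sigma> x, \<sigma> y} \<in> E" if "x \<in> V" "y \<in> V" for x y
        using edge_image_iff[OF F inj that] edge_image_iff[OF F inj0 \<sigma>V[OF that(1)] \<sigma>V[OF that(2)]] imE
          \<phi>\<sigma>[OF that(1)] \<phi>\<sigma>[OF that(2)] by simp
      ultimately have "\<sigma> \<in> automorphisms V E"
        unfolding automorphisms_def bij_betw_def by (auto simp: \<sigma>_def)
      then show "(\<lambda>x. if x \<in> V then inv_into V \<phi>0 (\<phi> x) else x) \<in> automorphisms V E"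
        unfolding \<sigma>_def .
    qed
  qed
  from bij_betw_same_card[OF this] show ?thesis unfolding num_aut_eq by (rule sym)
qed

lemma card_embeddings:
  assumes F: "simple_graph V E" and G: "simple_graph {0..<n} EG"
  shows "card (embeddings V E n EG) = num_aut V E * num_copies V E n EG"
proof -
  let ?f = "\<lambda>\<phi>. (\<phi> ` V, (\<lambda>e. \<phi> ` e) ` E)"
  let ?S = "embeddings V E n EG"
  have "card ?S = (\<Sum>\<phi>\<in>?S. 1)" by simp
  also have "\<dots> = (\<Sum>c\<in>?f ` ?S. \<Sum>\<phi>\<in>{\<phi> \<in> ?S. ?f \<phi> = c}. 1)"
    by (rule sum.image_gen) (intro finite_embeddings simple_graphD(1)[OF F])
  also have "\<dots> = (\<Sum>c\<in>?f ` ?S. num_aut V E)"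
  proof (rule sum.cong)
    fix c assume "c \<in> ?f ` ?S"
    then obtain \<phi>0 where "\<phi>0 \<in> ?S" "c = ?f \<phi>0" by auto
    then show "(\<Sum>\<phi>\<in>{\<phi> \<in> ?S. ?f \<phi> = c}. 1) = num_aut V E"
      using card_embeddings_fibre[OF F, of \<phi>0] by simp
  qed simp
  finally show ?thesis unfolding num_copies_def copies_eq_image[OF F G] by simp
qed

section \<open>Critical vertices and pointed colourings\<close>

lemma colorable_mono: "colorable V E k \<Longrightarrow> k \<le> l \<Longrightarrow> colorable V E l"
  unfolding colorable_def by (meson less_le_trans)

lemma colorable_card:
  assumes "simple_graph V E"
  shows "colorable V E (card V)"
proof -
  obtain c where c: "bij_betw c V {0..<card V}"
    using ex_bij_betw_finite_nat[OF simple_graphD(1)[OF assms]] by auto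
  then have "\<forall>v\<in>V. c v < card V" "inj_on c V" unfolding bij_betw_def by auto
  then show ?thesis
    unfolding colorable_def using simple_graphD(4)[OF assms] by (metis inj_onD)
qed

lemma colorable_chromatic_number:
  assumes "simple_graph V E"
  shows "colorable V E k \<longleftrightarrow> chromatic_number V E \<le> k"
proof
  assume "colorable V E k"
  then show "chromatic_number V E \<le> k" unfolding chromatic_number_def by (rule Least_le)
next
  assume "chromatic_number V E \<le> k"
  moreover have "colorable V E (chromatic_number V E)"
    unfolding chromatic_number_def by (rule LeastI) (rule colorable_card[OF assms])
  ultimately show "colorable V E k" using colorable_mono by blast
qed

lemma simple_graph_subset: "simple_graph V E \<Longrightarrow> D \<subseteq> E \<Longrightarrow> simple_graph V D"
  unfolding simple_graph_def by auto

lemma simple_graph_del_vertex: "simple_graph V E \<Longrightarrow> simple_graph (V - {u}) (del_vertex_edges E u)"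
  unfolding simple_graph_def del_vertex_edges_def by fastforce

lemma colorings_uD:
  assumes "c \<in> colorings_u r V E u"
  shows "v \<in> V \<Longrightarrow> v \<noteq> u \<Longrightarrow> c v < r"
    and "x \<in> V \<Longrightarrow> x \<noteq> u \<Longrightarrow> y \<in> V \<Longrightarrow> y \<noteq> u \<Longrightarrow> {x, y} \<in> E \<Longrightarrow> c x \<noteq> c y"
  using assms unfolding colorings_u_def by (auto dest: PiE_mem[of c _ _ v])

text \<open>If colour \<open>i\<close> were absent around \<open>u\<close>, then \<open>u\<close>
  could take it and \<open>c\<close> would become an \<open>r\<close>-colouring of the whole
  graph.\<close>

lemma not_colorableD:
  assumes "simple_graph V E" "\<not> colorable V E r" "u \<in> V" "c \<in> colorings_u r V E u" "i < r"
  shows "\<exists>v\<in>V - {u}. {u, v} \<in> E \<and> c v = i"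
proof (rule ccontr)
  assume none: "\<not> ?thesis"
  define c' where "c' = c(u := i)"
  have "c' v < r" if "v \<in> V" for v
    using that assms(5) colorings_uD(1)[OF assms(4), of v] unfolding c'_def by auto
  moreover have "c' x \<noteq> c' y" if xy: "x \<in> V" "y \<in> V" "{x, y} \<in> E" for x y
  proof -
    have "x \<noteq> y" using simple_graphD(4)[OF assms(1) xy(3)] .
    moreover have "{y, x} \<in> E" using xy by (simp add: insert_commute)
    moreover have "c v \<noteq> i" if "v \<in> V - {u}" "{u, v} \<in> E" for v using none that by auto
    moreover have "c x \<noteq> c y" if "x \<noteq> u" "y \<noteq> u" using assms(4) xy that unfolding colorings_u_def by auto
    ultimately show ?thesis using xy unfolding c'_def by (auto; metis)
  qed
  ultimately have "colorable V E r" unfolding colorable_def by blast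
  then show False using assms by simp
qed

text \<open>A colouring of F - u bounds its chromatic number by \<open>r\<close>, and one new colour
  for \<open>u\<close> shows that it cannot be smaller. Hence non-critical vertices have no
  colourings, and sums over critical vertices may run over all of \<open>V\<close>.\<close>

lemma critical_vertexI:
  assumes F: "simple_graph V E" and ch: "chromatic_number V E = r + 1" and u: "u \<in> V"
    and c: "c \<in> colorings_u r V E u"
  shows "critical_vertex r V E u"
proof -
  let ?D = "del_vertex_edges E u"
  have sg: "simple_graph (V - {u}) ?D" using F by (rule simple_graph_del_vertex)
  have "colorable (V - {u}) ?D r"
    unfolding colorable_def del_vertex_edges_def using colorings_uD[OF c]
    by (intro exI[of _ c]) auto
  then have le: "chromatic_number (V - {u}) ?D \<le> r" using colorable_chromatic_number[OF sg] by simp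
  define s where "s = chromatic_number (V - {u}) ?D"
  have "colorable (V - {u}) ?D s" using colorable_chromatic_number[OF sg] s_def by simp
  then obtain d :: "'a \<Rightarrow> nat" where d: "\<And>v. v \<in> V - {u} \<Longrightarrow> d v < s"
    "\<And>x y. x \<in> V - {u} \<Longrightarrow> y \<in> V - {u} \<Longrightarrow> {x, y} \<in> ?D \<Longrightarrow> d x \<noteq> d y"
    unfolding colorable_def by blast
  have "colorable V E (Suc s)" unfolding colorable_def
  proof (intro exI[of _ "d(u := s)"] conjI ballI impI)
    fix v assume "v \<in> V"
    then show "(d(u := s)) v < Suc s" using d(1)[of v] by auto
  next
    fix x y assume xy: "x \<in> V" "y \<in> V" "{x, y} \<in> E"
    have "x \<noteq> y" using simple_graphD(4)[OF F xy(3)] .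
    moreover have "{x, y} \<in> ?D" if "x \<noteq> u" "y \<noteq> u" using xy that unfolding del_vertex_edges_def by auto
    ultimately show "(d(u := s)) x \<noteq> (d(u := s)) y"
      using d(1)[of x] d(1)[of y] d(2)[of x y] xy by (cases "x = u"; cases "y = u") auto
  qed
  then have "r + 1 \<le> Suc s" using colorable_chromatic_number[OF F] ch by simp
  then show ?thesis unfolding critical_vertex_def using le u s_def by simp
qed

section \<open>The polynomial \<open>P_F\<close> as a sum of products over vertices\<close>

lemma finite_colorings_u: "finite V \<Longrightarrow> finite (colorings_u r V E u)"
  unfolding colorings_u_def by (rule finite_subset[OF _ finite_PiE[of "V - {u}" "\<lambda>_. {0..<r}"]]) auto

text \<open>A monomial of \<open>P_F\<close> regrouped vertex by vertex. With the image of
  \<open>u\<close> fixed, it is the probability that independent random images fall where the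
  colouring wants them: a neighbour of \<open>u\<close> of colour \<open>i\<close> in the
  \<open>\<xi> i\<close> fraction joined to that image, any other vertex in a part of density
  \<open>1 / r\<close>.\<close>

definition coloring_weight :: "nat \<Rightarrow> 'a set \<Rightarrow> 'a set set \<Rightarrow> (nat \<Rightarrow> real) \<Rightarrow> 'a \<Rightarrow> ('a \<Rightarrow> nat) \<Rightarrow> real" where
  "coloring_weight r V E \<xi> u c = (\<Prod>v\<in>V - {u}. if {u, v} \<in> E then \<xi> (c v) else 1 / real r)"

lemma coloring_weight_eq:
  assumes "finite V" "c \<in> colorings_u r V E u"
  shows "(\<Prod>i<r. inverse (real r ^ card {v\<in>V - {u}. {u, v} \<notin> E \<and> c v = i}) *
               \<xi> i ^ card {v\<in>V - {u}. {u, v} \<in> E \<and> c v = i}) = coloring_weight r V E \<xi> u c"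
proof -
  let ?h = "\<lambda>v. if {u, v} \<in> E then \<xi> (c v) else 1 / real r"
  have "coloring_weight r V E \<xi> u c = (\<Prod>i<r. \<Prod>v\<in>{v \<in> V - {u}. c v = i}. ?h v)"
    unfolding coloring_weight_def
    by (rule prod.group[symmetric]) (use assms(1) colorings_uD(1)[OF assms(2)] in auto)
  also have "\<dots> = (\<Prod>i<r. inverse (real r ^ card {v\<in>V - {u}. {u, v} \<notin> E \<and> c v = i}) *
               \<xi> i ^ card {v\<in>V - {u}. {u, v} \<in> E \<and> c v = i})"
  proof (rule prod.cong)
    fix i
    have "(\<Prod>v\<in>{v \<in> V - {u}. c v = i}. ?h v)
      = (\<Prod>v\<in>{v \<in> {v \<in> V - {u}. c v = i}. {u, v} \<in> E}. \<xi> (c v)) * (\<Prod>v\<in>{v \<in> {v \<in> V - {u}. c v = i}. {u, v} \<notin> E}. 1 / real r)"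
    proof -
      let ?S = "{v \<in> V - {u}. c v = i}"
      have "?S \<inter> {v. {u, v} \<in> E} = {v \<in> ?S. {u, v} \<in> E}" "?S \<inter> - {v. {u, v} \<in> E} = {v \<in> ?S. {u, v} \<notin> E}"
        by auto
      then show ?thesis using prod.If_cases[of ?S "\<lambda>v. {u, v} \<in> E" "\<lambda>v. \<xi> (c v)" "\<lambda>_. 1 / real r"] assms(1)
        by simp
    qed
    also have "(\<Prod>v\<in>{v \<in> {v \<in> V - {u}. c v = i}. {u, v} \<in> E}. \<xi> (c v))
        = (\<Prod>v\<in>{v \<in> {v \<in> V - {u}. c v = i}. {u, v} \<in> E}. \<xi> i)" by (rule prod.cong) auto
    also have "{v \<in> {v \<in> V - {u}. c v = i}. {u, v} \<in> E} = {v\<in>V - {u}. {u, v} \<in> E \<and> c v = i}" by auto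
    also have "{v \<in> {v \<in> V - {u}. c v = i}. {u, v} \<notin> E} = {v\<in>V - {u}. {u, v} \<notin> E \<and> c v = i}" by auto
    finally show "(\<Prod>v\<in>{v \<in> V - {u}. c v = i}. ?h v)
      = inverse (real r ^ card {v\<in>V - {u}. {u, v} \<notin> E \<and> c v = i}) *
               \<xi> i ^ card {v\<in>V - {u}. {u, v} \<in> E \<and> c v = i}"
      by (simp add: power_one_over inverse_eq_divide mult.commute)
  qed simp
  finally show ?thesis by simp
qed

lemma num_aut_P_F:
  assumes F: "simple_graph V E" and ch: "chromatic_number V E = r + 1"
  shows "real (num_aut V E) * P_F r V E \<xi> = (\<Sum>u\<in>V. \<Sum>c\<in>colorings_u r V E u. coloring_weight r V E \<xi> u c)"
proof -
  have fV: "finite V" using simple_graphD(1)[OF F] .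
  have "real (num_aut V E) * P_F r V E \<xi>
      = (\<Sum>u\<in>{u\<in>V. critical_vertex r V E u}. \<Sum>c\<in>colorings_u r V E u. coloring_weight r V E \<xi> u c)"
    unfolding P_F_def using num_aut_pos[OF fV, of E] coloring_weight_eq[OF fV] by simp
  also have "\<dots> = (\<Sum>u\<in>V. \<Sum>c\<in>colorings_u r V E u. coloring_weight r V E \<xi> u c)"
  proof (rule sum.mono_neutral_left)
    show "\<forall>u\<in>V - {u\<in>V. critical_vertex r V E u}. (\<Sum>c\<in>colorings_u r V E u. coloring_weight r V E \<xi> u c) = 0"
    proof
      fix u assume u: "u \<in> V - {u\<in>V. critical_vertex r V E u}"
      then have "colorings_u r V E u = {}" using critical_vertexI[OF F ch, of u] by blast
      then show "(\<Sum>c\<in>colorings_u r V E u. coloring_weight r V E \<xi> u c) = 0" by simp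
    qed
  qed (use fV in auto)
  finally show ?thesis .
qed

text \<open>The colour class \<open>i\<close> meets the neighbourhood of \<open>u\<close> only in \<open>v\<close>; equivalently,
  giving \<open>u\<close> colour \<open>i\<close> makes \<open>c\<close> an \<open>r\<close>-colouring of the graph minus the edge \<open>uv\<close>.\<close>

definition single_nbr :: "'a set \<Rightarrow> 'a set set \<Rightarrow> 'a \<Rightarrow> ('a \<Rightarrow> nat) \<Rightarrow> nat \<Rightarrow> 'a \<Rightarrow> bool" where
  "single_nbr V E u c i v \<longleftrightarrow> {w \<in> V - {u}. {u, w} \<in> E \<and> c w = i} = {v}"

text \<open>The ends of a critical edge get the same colour in every \<open>r\<close>-colouring of
  the graph without it, since otherwise the colouring would be proper for the whole graph. The
  prescribed colour \<open>i\<close> is obtained by permuting colours.\<close>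

lemma exists_single_nbr:
  assumes F: "simple_graph V E" and crit: "r_critical r V E" and i: "i < r"
  obtains u c v where "u \<in> V" "c \<in> colorings_u r V E u" "single_nbr V E u c i v"
proof -
  obtain e where e: "e \<in> E" "chromatic_number V (E - {e}) = r" and ch: "chromatic_number V E = r + 1"
    using crit unfolding r_critical_def by auto
  have F': "simple_graph V (E - {e})" using F by (rule simple_graph_subset) auto
  obtain u v where uv: "u \<noteq> v" "u \<in> V" "v \<in> V" "e = {u, v}" using F e(1) by (rule simple_graph_edgeE)
  have "colorable V (E - {e}) r" using colorable_chromatic_number[OF F'] e by simp
  then obtain d :: "'a \<Rightarrow> nat" where d: "\<And>x. x \<in> V \<Longrightarrow> d x < r"
    "\<And>x y. x \<in> V \<Longrightarrow> y \<in> V \<Longrightarrow> {x, y} \<in> E - {e} \<Longrightarrow> d x \<noteq> d y"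
    unfolding colorable_def by blast
  have nc: "\<not> colorable V E r" using colorable_chromatic_number[OF F] ch by simp
  have duv: "d u = d v"
  proof (rule ccontr)
    assume ne: "d u \<noteq> d v"
    have "d x \<noteq> d y" if "x \<in> V" "y \<in> V" "{x, y} \<in> E" for x y
      using d(2)[of x y] that ne uv by (cases "{x, y} = e") (auto simp: doubleton_eq_iff)
    then show False using nc d(1) unfolding colorable_def by blast
  qed
  define \<tau> where "\<tau> = Transposition.transpose (d v) i"
  have \<tau>: "\<tau> (d v) = i" "inj \<tau>" "\<And>j. j < r \<Longrightarrow> \<tau> j < r"
    using d(1)[OF uv(3)] i unfolding \<tau>_def by (auto simp: Transposition.transpose_def)
  define c where "c = restrict (\<lambda>x. \<tau> (d x)) (V - {u})"
  have "c \<in> colorings_u r V E u"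
  proof -
    have "d x \<noteq> d y" if "x \<in> V - {u}" "y \<in> V - {u}" "{x, y} \<in> E" for x y
      using d(2)[of x y] that uv by (auto simp: doubleton_eq_iff)
    then show ?thesis unfolding colorings_u_def c_def using d(1) \<tau>(2,3) by (auto simp: inj_eq)
  qed
  moreover have "single_nbr V E u c i v"
  proof -
    have "d w \<noteq> d v" if "w \<in> V" "{u, w} \<in> E" "w \<noteq> v" for w
      using d(2)[of u w] that uv duv by (auto simp: doubleton_eq_iff)
    moreover have "c w = i \<longleftrightarrow> d w = d v" if "w \<in> V - {u}" for w
      using that \<tau>(1,2) unfolding c_def by (metis injD restrict_apply')
    ultimately show ?thesis unfolding single_nbr_def using uv e by auto
  qed
  ultimately show ?thesis using that uv by blast
qed

section \<open>The constant beta\<close>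

lemma single_nbrD:
  assumes "single_nbr V E u c i v"
  shows "v \<in> V" "v \<noteq> u" "{u, v} \<in> E" "c v = i"
    "w \<in> V \<Longrightarrow> w \<noteq> u \<Longrightarrow> w \<noteq> v \<Longrightarrow> {u, w} \<in> E \<Longrightarrow> c w \<noteq> i"
  using assms unfolding single_nbr_def by blast+

lemma coloring_weight_single_nbr:
  assumes "finite V" "single_nbr V E u c i v"
  shows "coloring_weight r V E \<xi> u c = \<xi> i * (\<Prod>w\<in>V - {u, v}. if {u, w} \<in> E then \<xi> (c w) else 1 / real r)"
proof -
  note s = single_nbrD[OF assms(2)]
  have "V - {u} = insert v (V - {u, v})" using s(1,2) by auto
  then show ?thesis unfolding coloring_weight_def using assms(1) s by simp
qed

lemma P_F_nonneg:
  assumes "\<And>i. i < r \<Longrightarrow> 0 \<le> \<xi> i"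
  shows "0 \<le> P_F r V E \<xi>"
  unfolding P_F_def using assms by (intro mult_nonneg_nonneg sum_nonneg prod_nonneg) auto

lemma S_rho_nonempty:
  assumes "0 < r" "0 \<le> \<rho>" "\<rho> \<le> 1"
  shows "S_rho r \<rho> \<noteq> {}"
proof -
  have "(\<lambda>_. \<rho> / real r) \<in> S_rho r \<rho>" unfolding S_rho_def using assms by (auto simp: divide_right_mono)
  then show ?thesis by auto
qed

lemma bdd_below_P_F: "bdd_below (P_F r V E ` S_rho r \<rho>)"
  by (rule bdd_belowI[of _ 0]) (auto simp: S_rho_def intro!: P_F_nonneg)

lemma p_F_nonneg:
  assumes "0 < r" "0 \<le> \<rho>" "\<rho> \<le> 1"
  shows "0 \<le> p_F r V E \<rho>"
  unfolding p_F_def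
  by (rule cInf_greatest) (use S_rho_nonempty[OF assms] in \<open>auto simp: S_rho_def intro!: P_F_nonneg\<close>)

lemma nonneg_if_gt_one_minus_inverse:
  assumes "0 < r" "1 - 1 / real r < \<rho>"
  shows "0 \<le> \<rho>"
proof -
  have "1 / real r \<le> 1" using assms(1) by simp
  then show ?thesis using assms(2) by linarith
qed

text \<open>Both infima are unwound. This linear lower bound on \<open>P_F\<close> is what converts
  the excess degree of a vertex into copies.\<close>

lemma beta_F_mult_le:
  assumes r: "0 < r" and \<xi>: "\<And>i. i < r \<Longrightarrow> 0 \<le> \<xi> i" "\<And>i. i < r \<Longrightarrow> \<xi> i \<le> 1 / real r"
    and d: "1 - 1 / real r < (\<Sum>i<r. \<xi> i)"
  shows "beta_F r V E * ((\<Sum>i<r. \<xi> i) - (1 - 1 / real r)) \<le> P_F r V E \<xi>"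
proof -
  define \<rho> where "\<rho> = (\<Sum>i<r. \<xi> i)"
  have "\<rho> \<le> (\<Sum>i<r. 1 / real r)" unfolding \<rho>_def using \<xi> by (intro sum_mono) auto
  then have \<rho>: "\<rho> \<in> {1 - 1 / real r<..1}" using d r unfolding \<rho>_def by simp
  have "0 \<le> p_F r V E x / (x - (1 - 1 / real r))" if "x \<in> {1 - 1 / real r<..1}" for x
    using that r nonneg_if_gt_one_minus_inverse[OF r, of x] by (intro divide_nonneg_nonneg p_F_nonneg) auto
  then have "bdd_below ((\<lambda>\<rho>. p_F r V E \<rho> / (\<rho> - (1 - 1 / real r))) ` {1 - 1 / real r<..1})"
    by (intro bdd_belowI[of _ 0]) auto
  then have "beta_F r V E \<le> p_F r V E \<rho> / (\<rho> - (1 - 1 / real r))"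
    unfolding beta_F_def using \<rho> by (intro cInf_lower) auto
  then have "beta_F r V E * (\<rho> - (1 - 1 / real r)) \<le> p_F r V E \<rho>"
    using \<rho> by (simp add: pos_le_divide_eq)
  also have "\<dots> \<le> P_F r V E \<xi>"
    unfolding p_F_def by (rule cInf_lower[OF _ bdd_below_P_F]) (use \<xi> in \<open>auto simp: S_rho_def \<rho>_def\<close>)
  finally show ?thesis unfolding \<rho>_def .
qed

lemma beta_F_approx:
  assumes r: "0 < r" and \<epsilon>: "0 < \<epsilon>"
  obtains \<xi> where "\<And>i. i < r \<Longrightarrow> 0 \<le> \<xi> i" "\<And>i. i < r \<Longrightarrow> \<xi> i \<le> 1 / real r"
    "1 - 1 / real r < (\<Sum>i<r. \<xi> i)" "P_F r V E \<xi> < (beta_F r V E + \<epsilon>) * ((\<Sum>i<r. \<xi> i) - (1 - 1 / real r))"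
proof -
  let ?I = "{1 - 1 / real r<..1}"
  have "1 \<in> ?I" using r by simp
  moreover have "beta_F r V E < beta_F r V E + \<epsilon>" using \<epsilon> by simp
  ultimately obtain \<rho> where \<rho>: "\<rho> \<in> ?I" "p_F r V E \<rho> / (\<rho> - (1 - 1 / real r)) < beta_F r V E + \<epsilon>"
    using cInf_lessD[of "(\<lambda>\<rho>. p_F r V E \<rho> / (\<rho> - (1 - 1 / real r))) ` ?I"] unfolding beta_F_def by blast
  then have "p_F r V E \<rho> < (beta_F r V E + \<epsilon>) * (\<rho> - (1 - 1 / real r))"
    by (simp add: pos_divide_less_eq)
  moreover have "S_rho r \<rho> \<noteq> {}" using r \<rho> nonneg_if_gt_one_minus_inverse[OF r, of \<rho>] by (intro S_rho_nonempty) auto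
  ultimately obtain \<xi> where "\<xi> \<in> S_rho r \<rho>" "P_F r V E \<xi> < (beta_F r V E + \<epsilon>) * (\<rho> - (1 - 1 / real r))"
    using cInf_lessD[of "P_F r V E ` S_rho r \<rho>"] unfolding p_F_def by blast
  then show ?thesis using that[of \<xi>] \<rho> unfolding S_rho_def by auto
qed

locale critical_graph =
  fixes r :: nat and V :: "'a set" and E :: "'a set set"
  assumes r2: "2 \<le> r" and F: "simple_graph V E" and crit: "r_critical r V E"
begin

lemma fV: "finite V" using simple_graphD(1)[OF F] .

lemma chrom: "chromatic_number V E = r + 1"
  using crit unfolding r_critical_def by simp

lemma ncol: "\<not> colorable V E r"
  using colorable_chromatic_number[OF F] chrom by simp

abbreviation "f \<equiv> card V"
abbreviation "aut \<equiv> real (num_aut V E)"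
abbreviation "\<beta> \<equiv> beta_F r V E"
abbreviation "pointed_colorings \<equiv> Sigma V (colorings_u r V E)"

lemma aut_pos: "0 < aut" using num_aut_pos[OF fV] by simp

lemma finite_pointed_colorings [simp]: "finite pointed_colorings"
  using fV finite_colorings_u[OF fV] by auto

lemma aut_P_F: "aut * P_F r V E \<xi> = (\<Sum>(u, c)\<in>pointed_colorings. coloring_weight r V E \<xi> u c)"
  unfolding num_aut_P_F[OF F chrom] using fV finite_colorings_u[OF fV] by (simp add: sum.Sigma)

lemma coloring_weight_nonneg:
  assumes "c \<in> colorings_u r V E u" "\<And>i. i < r \<Longrightarrow> 0 \<le> \<xi> i"
  shows "0 \<le> coloring_weight r V E \<xi> u c"
  unfolding coloring_weight_def by (rule prod_nonneg) (use assms colorings_uD(1)[OF assms(1)] in auto)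

lemma coloring_weight_le_aut_P_F:
  assumes "u \<in> V" "c \<in> colorings_u r V E u" "\<And>i. i < r \<Longrightarrow> 0 \<le> \<xi> i"
  shows "coloring_weight r V E \<xi> u c \<le> aut * P_F r V E \<xi>"
proof -
  have "(case (u, c) of (u, c) \<Rightarrow> coloring_weight r V E \<xi> u c)
      \<le> (\<Sum>(u, c)\<in>pointed_colorings. coloring_weight r V E \<xi> u c)"
    by (rule member_le_sum) (use assms coloring_weight_nonneg in auto)
  then show ?thesis unfolding aut_P_F by simp
qed

lemma card_V_minus: "u \<in> V \<Longrightarrow> v \<in> V \<Longrightarrow> u \<noteq> v \<Longrightarrow> card (V - {u, v}) = f - 2"
  using fV by (subst card_Diff_subset) auto

lemma some_pointed_coloring:
  obtains u c v where "u \<in> V" "c \<in> colorings_u r V E u" "single_nbr V E u c 0 v"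
proof -
  have "0 < r" using r2 by simp
  from exists_single_nbr[OF F crit this] that show ?thesis by blast
qed

lemma f2: "2 \<le> f"
proof -
  obtain u c v where u: "u \<in> V" and s: "single_nbr V E u c 0 v" by (rule some_pointed_coloring)
  have "card {u, v} \<le> f" by (rule card_mono[OF fV]) (use u single_nbrD(1)[OF s] in auto)
  then show ?thesis using single_nbrD(2)[OF s] by simp
qed

text \<open>The smallest coordinate \<open>\<xi> i\<close> is at least
  \<open>\<rho> - (1 - 1/r)\<close> because the others are at most \<open>1/r\<close>. Any other
  coordinate is at least \<open>1/(2r)\<close>: its sum with \<open>\<xi> i\<close> is at least
  \<open>1/r\<close> and it is the larger of the two. A pointed colouring in which \<open>u\<close>
  has a single neighbour of colour \<open>i\<close> uses the small coordinate only once, so its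
  weight is linear in it.\<close>

lemma P_F_lower_bound:
  assumes \<xi>: "\<And>i. i < r \<Longrightarrow> 0 \<le> \<xi> i" "\<And>i. i < r \<Longrightarrow> \<xi> i \<le> 1 / real r"
    and d: "1 - 1 / real r < (\<Sum>i<r. \<xi> i)"
  shows "(1 / (2 * real r)) ^ (f - 2) / aut * ((\<Sum>i<r. \<xi> i) - (1 - 1 / real r)) \<le> P_F r V E \<xi>"
proof -
  define \<rho> where "\<rho> = (\<Sum>i<r. \<xi> i)"
  have "0 \<in> {..<r}" using r2 by simp
  then have "finite (\<xi> ` {..<r})" "\<xi> ` {..<r} \<noteq> {}" by blast+
  then have "Min (\<xi> ` {..<r}) \<in> \<xi> ` {..<r}" by (rule Min_in)
  then obtain i where i: "i < r" "\<xi> i = Min (\<xi> ` {..<r})" by auto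
  then have imin: "\<xi> i \<le> \<xi> j" if "j < r" for j using that by simp
  have sum_le: "(\<Sum>k\<in>S. \<xi> k) \<le> real (card S) / real r" if "S \<subseteq> {..<r}" for S
  proof -
    have "(\<Sum>k\<in>S. \<xi> k) \<le> (\<Sum>k\<in>S. 1 / real r)" using that \<xi> by (intro sum_mono) auto
    then show ?thesis by simp
  qed
  have "\<rho> = \<xi> i + (\<Sum>k\<in>{..<r} - {i}. \<xi> k)" unfolding \<rho>_def using i by (simp add: sum.remove)
  then have xi: "\<rho> - (1 - 1 / real r) \<le> \<xi> i"
    using sum_le[of "{..<r} - {i}"] i r2 by (simp add: of_nat_diff field_simps)
  have xj: "1 / (2 * real r) \<le> \<xi> j" if j: "j < r" "j \<noteq> i" for j
  proof -
    have "\<rho> = \<xi> i + (\<xi> j + (\<Sum>k\<in>{..<r} - {i} - {j}. \<xi> k))"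
      unfolding \<rho>_def using i j by (simp add: sum.remove)
    moreover have "card ({..<r} - {i} - {j}) = r - 2" using i j by (simp add: card_Diff_singleton_if)
    ultimately have "\<rho> - (real r - 2) / real r \<le> \<xi> i + \<xi> j"
      using sum_le[of "{..<r} - {i} - {j}"] r2 by (auto simp: of_nat_diff)
    then have "1 / real r \<le> \<xi> i + \<xi> j" using d r2 unfolding \<rho>_def[symmetric] by (simp add: field_simps)
    then show ?thesis using imin[OF j(1)] by (simp add: field_simps)
  qed
  obtain u c v where ucv: "u \<in> V" "c \<in> colorings_u r V E u" "single_nbr V E u c i v"
    using exists_single_nbr[OF F crit i(1)] .
  note s = single_nbrD[OF ucv(3)]
  have "\<xi> i * (1 / (2 * real r)) ^ (f - 2) = \<xi> i * (\<Prod>w\<in>V - {u, v}. 1 / (2 * real r))"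
    using card_V_minus[of u v] ucv s by simp
  also have "\<dots> \<le> \<xi> i * (\<Prod>w\<in>V - {u, v}. if {u, w} \<in> E then \<xi> (c w) else 1 / real r)"
  proof (intro mult_left_mono prod_mono conjI)
    fix w assume w: "w \<in> V - {u, v}"
    show "1 / (2 * real r) \<le> (if {u, w} \<in> E then \<xi> (c w) else 1 / real r)"
      using xj[of "c w"] s(5)[of w] colorings_uD(1)[OF ucv(2), of w] w r2 by (auto simp: field_simps)
  qed (use \<xi>(1)[OF i(1)] in auto)
  also have "\<dots> = coloring_weight r V E \<xi> u c" using coloring_weight_single_nbr[OF fV ucv(3)] by simp
  also have "\<dots> \<le> aut * P_F r V E \<xi>" by (rule coloring_weight_le_aut_P_F) (use ucv \<xi> in auto)
  finally have "\<xi> i * (1 / (2 * real r)) ^ (f - 2) \<le> aut * P_F r V E \<xi>" .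
  moreover have "(\<rho> - (1 - 1 / real r)) * (1 / (2 * real r)) ^ (f - 2) \<le> \<xi> i * (1 / (2 * real r)) ^ (f - 2)"
    by (rule mult_right_mono[OF xi]) simp
  ultimately have "(\<rho> - (1 - 1 / real r)) * (1 / (2 * real r)) ^ (f - 2) \<le> aut * P_F r V E \<xi>" by linarith
  then show ?thesis using aut_pos unfolding \<rho>_def by (simp add: pos_divide_le_eq mult.commute)
qed

text \<open>The lower bound on \<open>P_F\<close> has a slope independent of \<open>\<rho>\<close>,
  so the quotient stays away from 0 even as \<open>\<rho>\<close> approaches \<open>1 - 1/r\<close>.
  Positivity allows additive errors to be treated as fractions of \<open>\<beta>\<close>.\<close>

lemma beta_pos: "0 < \<beta>"
proof -
  define \<kappa> where "\<kappa> = (1 / (2 * real r)) ^ (f - 2) / aut"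
  have \<kappa>: "0 < \<kappa>" unfolding \<kappa>_def using aut_pos r2 by simp
  have r0: "0 < r" using r2 by simp
  have "\<kappa> \<le> p_F r V E \<rho> / (\<rho> - (1 - 1 / real r))" if \<rho>: "\<rho> \<in> {1 - 1 / real r<..1}" for \<rho>
  proof -
    have "\<kappa> * (\<rho> - (1 - 1 / real r)) \<le> p_F r V E \<rho>"
      unfolding p_F_def
    proof (rule cInf_greatest)
      show "P_F r V E ` S_rho r \<rho> \<noteq> {}"
        using S_rho_nonempty[of r \<rho>] \<rho> nonneg_if_gt_one_minus_inverse[OF r0, of \<rho>] r0 by auto
      fix x assume "x \<in> P_F r V E ` S_rho r \<rho>"
      then obtain \<xi> where "x = P_F r V E \<xi>" "\<forall>i<r. 0 \<le> \<xi> i \<and> \<xi> i \<le> 1 / real r" "(\<Sum>i<r. \<xi> i) = \<rho>"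
        unfolding S_rho_def by auto
      then show "\<kappa> * (\<rho> - (1 - 1 / real r)) \<le> x"
        using P_F_lower_bound[of \<xi>] \<rho> unfolding \<kappa>_def by auto
    qed
    then show ?thesis using \<rho> by (simp add: pos_le_divide_eq)
  qed
  then have "\<kappa> \<le> \<beta>" unfolding beta_F_def by (intro cInf_greatest) (use r0 in auto)
  then show ?thesis using \<kappa> by simp
qed

text \<open>Ways to split \<open>F\<close> among \<open>r\<close> parts with exactly one edge inside
  a part, that part being \<open>i\<close>: \<open>u\<close> is put there, and only the edge to its
  single neighbour of colour \<open>i\<close> stays inside. Either end of that edge can play
  \<open>u\<close>, so the two orientations are separate elements.\<close>

definition critical_pairs :: "nat \<Rightarrow> ('a \<times> ('a \<Rightarrow> nat)) set" where
  "critical_pairs i = {(u, c) \<in> pointed_colorings. \<exists>v. single_nbr V E u c i v}"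

lemma critical_pairs_subset: "critical_pairs i \<subseteq> pointed_colorings"
  unfolding critical_pairs_def by auto

text \<open>Adding one edge to the Turan graph costs at least \<open>\<beta>\<close>: let \<open>\<xi> i\<close> tend to \<open>0\<close> while all other
  coordinates equal \<open>1 / r\<close>.\<close>

lemma aut_beta_le:
  assumes i: "i < r"
  shows "aut * \<beta> \<le> real (card (critical_pairs i)) * (1 / real r) ^ (f - 2)"
proof (rule field_le_epsilon)
  fix e :: real assume e: "0 < e"
  define C where "C = real (card pointed_colorings)"
  \<comment> \<open>The total \<open>C * d^2\<close> of second-order terms is then at most
    \<open>d * e\<close>, and division by \<open>d\<close> leaves the error
    \<open>e\<close>.\<close>
  define d where "d = min (1 / real r) (e / (C + 1))"
  have C: "0 \<le> C" unfolding C_def by simp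
  have d: "0 < d" "d \<le> 1 / real r" "d \<le> e / (C + 1)" unfolding d_def using r2 e C by auto
  have "1 / real r \<le> 1" using r2 by simp
  then have d1: "d \<le> 1" using d(2) by linarith
  have Cd: "C * d \<le> e"
  proof -
    have "(C + 1) * d \<le> e" using d(3) C by (simp add: field_simps)
    then show ?thesis using d(1) by (simp add: algebra_simps)
  qed
  define \<xi> where "\<xi> = (\<lambda>j. if j = i then d else 1 / real r)"
  have \<xi>: "0 \<le> \<xi> j" "\<xi> j \<le> 1 / real r" "\<xi> j \<le> 1" for j
    using d d1 r2 unfolding \<xi>_def by auto
  have "(\<Sum>j<r. \<xi> j) = \<xi> i + (\<Sum>j\<in>{..<r} - {i}. \<xi> j)" using i by (simp add: sum.remove)
  also have "(\<Sum>j\<in>{..<r} - {i}. \<xi> j) = (\<Sum>j\<in>{..<r} - {i}. 1 / real r)"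
    by (rule sum.cong) (auto simp: \<xi>_def)
  also have "\<xi> i + \<dots> = d + (1 - 1 / real r)" using i r2 by (simp add: \<xi>_def of_nat_diff field_simps)
  finally have sum: "(\<Sum>j<r. \<xi> j) - (1 - 1 / real r) = d" by simp
  have "\<beta> * d \<le> P_F r V E \<xi>"
    using beta_F_mult_le[of r \<xi> V E] \<xi> sum d(1) r2 by simp
  then have "aut * (\<beta> * d) \<le> aut * P_F r V E \<xi>" using aut_pos by simp
  also have "\<dots> = (\<Sum>(u, c)\<in>pointed_colorings. coloring_weight r V E \<xi> u c)" by (rule aut_P_F)
  also have "\<dots> \<le> (\<Sum>p\<in>pointed_colorings. (if p \<in> critical_pairs i then d * (1 / real r) ^ (f - 2) else 0) + d * d)"
  proof (rule sum_mono)
    fix p assume "p \<in> pointed_colorings"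
    then obtain u c where p: "p = (u, c)" "u \<in> V" "c \<in> colorings_u r V E u" by auto
    have dd: "0 \<le> d * d" using d by simp
    have "coloring_weight r V E \<xi> u c \<le> (if p \<in> critical_pairs i then d * (1 / real r) ^ (f - 2) else 0) + d * d"
    proof (cases "p \<in> critical_pairs i")
      case True
      then obtain v where v: "single_nbr V E u c i v" unfolding critical_pairs_def p by auto
      note s = single_nbrD[OF v]
      have "(\<Prod>w\<in>V - {u, v}. if {u, w} \<in> E then \<xi> (c w) else 1 / real r) = (\<Prod>w\<in>V - {u, v}. 1 / real r)"
        by (rule prod.cong) (use s(5) in \<open>auto simp: \<xi>_def\<close>)
      also have "\<dots> = (1 / real r) ^ (f - 2)" using card_V_minus[of u v] p s by simp
      finally have "coloring_weight r V E \<xi> u c = d * (1 / real r) ^ (f - 2)"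
        unfolding coloring_weight_single_nbr[OF fV v] by (simp add: \<xi>_def)
      then show ?thesis using True dd by simp
    next
      case False
      \<comment> \<open>Colour \<open>i\<close> always occurs around \<open>u\<close>; if it occurs
        twice, two factors equal \<open>d\<close> and the weight is of second order.\<close>
      obtain v where v: "v \<in> V" "v \<noteq> u" "{u, v} \<in> E" "c v = i"
        using not_colorableD[OF F ncol p(2,3) i] by auto
      have "\<not> single_nbr V E u c i v" using False p unfolding critical_pairs_def by auto
      then obtain w where w: "w \<in> V" "w \<noteq> u" "{u, w} \<in> E" "c w = i" "w \<noteq> v"
        unfolding single_nbr_def using v by auto
      let ?h = "\<lambda>v. if {u, v} \<in> E then \<xi> (c v) else 1 / real r"
      have "V - {u} = insert v (insert w (V - {u} - {v, w}))" using v w by auto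
      then have "coloring_weight r V E \<xi> u c = (\<Prod>x\<in>insert v (insert w (V - {u} - {v, w})). ?h x)"
        unfolding coloring_weight_def by (rule arg_cong)
      also have "\<dots> = ?h v * (?h w * (\<Prod>x\<in>V - {u} - {v, w}. ?h x))" using fV w(5) by simp
      also have "\<dots> = d * d * (\<Prod>x\<in>V - {u} - {v, w}. ?h x)" using v w by (simp add: \<xi>_def)
      also have "\<dots> \<le> d * d * 1"
        using dd \<xi> r2 by (intro mult_left_mono prod_le_1) auto
      finally show ?thesis using False by simp
    qed
    then show "(case p of (u, c) \<Rightarrow> coloring_weight r V E \<xi> u c)
        \<le> (if p \<in> critical_pairs i then d * (1 / real r) ^ (f - 2) else 0) + d * d" using p by simp
  qed
  also have "\<dots> = real (card (critical_pairs i)) * (d * (1 / real r) ^ (f - 2)) + C * (d * d)"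
  proof -
    have "{p \<in> pointed_colorings. p \<in> critical_pairs i} = critical_pairs i" using critical_pairs_subset by auto
    then show ?thesis by (simp add: sum.distrib sum.inter_filter[symmetric] C_def)
  qed
  also have "\<dots> = d * (real (card (critical_pairs i)) * (1 / real r) ^ (f - 2) + C * d)"
    by (simp add: algebra_simps)
  finally have "d * (aut * \<beta>) \<le> d * (real (card (critical_pairs i)) * (1 / real r) ^ (f - 2) + C * d)"
    by (simp only: mult_ac)
  then have "aut * \<beta> \<le> real (card (critical_pairs i)) * (1 / real r) ^ (f - 2) + C * d"
    using d(1) by (rule mult_left_le_imp_le)
  then show "aut * \<beta> \<le> real (card (critical_pairs i)) * (1 / real r) ^ (f - 2) + e" using Cd by linarith
qed

end

section \<open>Counting embeddings through a vertex or an edge\<close>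

lemma sum_card_le_if_card_Sigma_le:
  assumes "finite A" "\<And>a. finite (B a)" "card (Sigma A B) \<le> m"
  shows "(\<Sum>a\<in>A. real (card (B a))) \<le> real m"
proof -
  have "(\<Sum>a\<in>A. card (B a)) \<le> m" using assms by (simp add: card_SigmaI)
  then have "real (\<Sum>a\<in>A. card (B a)) \<le> real m" by (simp only: of_nat_le_iff)
  then show ?thesis by simp
qed

text \<open>Union bound: for each of at most \<open>card K ^ 2\<close> ordered pairs
  \<open>v, w\<close>, at most \<open>card R * n ^ (card K - 2)\<close> maps send it into
  \<open>R\<close>. The normalisation by powers of \<open>n\<close> makes the main term a product of
  relative slot sizes.\<close>

lemma card_PiE_avoiding:
  fixes S :: "'k \<Rightarrow> nat set"
  assumes K: "finite K" and S: "\<And>v. v \<in> K \<Longrightarrow> S v \<subseteq> {0..<n}" and n: "0 < n"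
    and R: "finite R"
  shows "real n ^ card K * ((\<Prod>v\<in>K. real (card (S v)) / real n) - (real (card K))\<^sup>2 * real (card R) / (real n)\<^sup>2)
    \<le> real (card {\<psi> \<in> Pi\<^sub>E K S. \<forall>v\<in>K. \<forall>w\<in>K. v \<noteq> w \<longrightarrow> (\<psi> v, \<psi> w) \<notin> R})"
proof -
  let ?G = "{\<psi> \<in> Pi\<^sub>E K S. \<forall>v\<in>K. \<forall>w\<in>K. v \<noteq> w \<longrightarrow> (\<psi> v, \<psi> w) \<notin> R}"
  define P where "P = {(v, w) \<in> K \<times> K. v \<noteq> w}"
  define B where "B = (\<lambda>(v, w). {\<psi> \<in> K \<rightarrow>\<^sub>E {0..<n}. (\<psi> v, \<psi> w) \<in> R})"
  have fP: "finite P" unfolding P_def by (rule finite_subset[of _ "K \<times> K"]) (use K in auto)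
  have fB: "finite (B q)" for q
    unfolding B_def using K by (auto split: prod.splits intro: finite_subset[OF _ finite_PiE[of K "\<lambda>_. {0..<n}"]])
  have fS: "finite (S v)" if "v \<in> K" for v using S[OF that] finite_subset by blast
  have fG: "finite ?G" using K fS by (auto intro: finite_subset[OF _ finite_PiE[of K S]])
  have sub: "Pi\<^sub>E K S \<subseteq> ?G \<union> (\<Union>q\<in>P. B q)"
  proof
    fix \<psi> assume \<psi>: "\<psi> \<in> Pi\<^sub>E K S"
    then have "\<psi> \<in> K \<rightarrow>\<^sub>E {0..<n}" using S unfolding PiE_def Pi_def by blast
    then show "\<psi> \<in> ?G \<union> (\<Union>q\<in>P. B q)" using \<psi> unfolding B_def P_def by auto
  qed
  have cB: "real (card (B q)) \<le> real (card R) * real n ^ card K / (real n)\<^sup>2" if q: "q \<in> P" for q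
  proof -
    obtain v w where vw: "q = (v, w)" "v \<in> K" "w \<in> K" "v \<noteq> w" using q unfolding P_def by auto
    have ck: "card (K - {v, w}) = card K - 2" using vw K by (subst card_Diff_subset) auto
    have c2: "2 \<le> card K" using card_mono[OF K, of "{v, w}"] vw by simp
    have "card (B q) \<le> card (((K - {v, w}) \<rightarrow>\<^sub>E {0..<n}) \<times> R)"
    proof (rule card_inj_on_le[where f = "\<lambda>\<psi>. (restrict \<psi> (K - {v, w}), (\<psi> v, \<psi> w))"])
      show "inj_on (\<lambda>\<psi>. (restrict \<psi> (K - {v, w}), (\<psi> v, \<psi> w))) (B q)"
      proof (rule inj_onI)
        fix f g assume fg: "f \<in> B q" "g \<in> B q"
          and eq: "(restrict f (K - {v, w}), (f v, f w)) = (restrict g (K - {v, w}), (g v, g w))"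
        show "f = g"
        proof (rule PiE_ext)
          show "f \<in> K \<rightarrow>\<^sub>E {0..<n}" "g \<in> K \<rightarrow>\<^sub>E {0..<n}" using fg unfolding B_def vw by auto
          fix x assume x: "x \<in> K"
          have "restrict f (K - {v, w}) x = restrict g (K - {v, w}) x" using eq by simp
          then show "f x = g x" using x eq by (cases "x \<in> {v, w}") auto
        qed
      qed
      show "(\<lambda>\<psi>. (restrict \<psi> (K - {v, w}), (\<psi> v, \<psi> w))) ` B q \<subseteq> ((K - {v, w}) \<rightarrow>\<^sub>E {0..<n}) \<times> R"
      proof (rule image_subsetI)
        fix \<psi> assume "\<psi> \<in> B q"
        then have \<psi>: "\<psi> \<in> K \<rightarrow>\<^sub>E {0..<n}" "(\<psi> v, \<psi> w) \<in> R" unfolding B_def vw by auto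
        have "restrict \<psi> (K - {v, w}) \<in> (K - {v, w}) \<rightarrow>\<^sub>E {0..<n}"
          using PiE_mem[OF \<psi>(1)] by (intro restrict_PiE_iff[THEN iffD2]) auto
        then show "(restrict \<psi> (K - {v, w}), (\<psi> v, \<psi> w)) \<in> ((K - {v, w}) \<rightarrow>\<^sub>E {0..<n}) \<times> R" using \<psi>(2) by simp
      qed
      show "finite (((K - {v, w}) \<rightarrow>\<^sub>E {0..<n}) \<times> R)" using K R by (auto intro: finite_PiE)
    qed
    also have "\<dots> = n ^ (card K - 2) * card R" using K ck by (simp add: card_cartesian_product card_PiE)
    finally have "real (card (B q)) \<le> real n ^ (card K - 2) * real (card R)"
      by (metis of_nat_le_iff of_nat_mult of_nat_power)
    also have "real n ^ (card K - 2) = real n ^ card K / (real n)\<^sup>2"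
      using n c2 by (simp add: power_diff)
    finally show ?thesis by (simp add: mult.commute)
  qed
  have "real n ^ card K * (\<Prod>v\<in>K. real (card (S v)) / real n) = real (card (Pi\<^sub>E K S))"
    using K n by (simp add: card_PiE prod_dividef)
  also have "card (Pi\<^sub>E K S) \<le> card ?G + card (\<Union>q\<in>P. B q)"
    by (rule order.trans[OF card_mono[OF _ sub] card_Un_le]) (use fG fP fB in auto)
  also have "card (\<Union>q\<in>P. B q) \<le> (\<Sum>q\<in>P. card (B q))" by (rule card_UN_le[OF fP])
  finally have "real n ^ card K * (\<Prod>v\<in>K. real (card (S v)) / real n) \<le> real (card ?G) + (\<Sum>q\<in>P. real (card (B q)))"
    by simp
  also have "(\<Sum>q\<in>P. real (card (B q))) \<le> (\<Sum>q\<in>P. real (card R) * real n ^ card K / (real n)\<^sup>2)"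
    by (rule sum_mono[OF cB])
  also have "\<dots> = real (card P) * (real (card R) * real n ^ card K / (real n)\<^sup>2)" by simp
  also have "\<dots> \<le> (real (card K))\<^sup>2 * (real (card R) * real n ^ card K / (real n)\<^sup>2)"
  proof (rule mult_right_mono)
    have "card P \<le> card (K \<times> K)" unfolding P_def by (rule card_mono) (use K in auto)
    then show "real (card P) \<le> (real (card K))\<^sup>2"
      by (metis card_cartesian_product of_nat_le_iff of_nat_mult power2_eq_square)
  qed simp
  finally show ?thesis by (simp add: algebra_simps)
qed

definition missing_pairs :: "nat \<Rightarrow> nat set set \<Rightarrow> (nat \<Rightarrow> nat) \<Rightarrow> (nat \<times> nat) set" where
  "missing_pairs n EG p = {(a, b). a < n \<and> b < n \<and> p a \<noteq> p b \<and> {a, b} \<notin> EG}"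

lemma finite_missing_pairs [simp]: "finite (missing_pairs n EG p)"
  unfolding missing_pairs_def by (rule finite_subset[of _ "{..<n} \<times> {..<n}"]) auto

text \<open>The diagonal is included so that avoiding these pairs gives two things at once: the map
  is injective, and images in different parts are adjacent.\<close>

definition conflict_pairs :: "nat \<Rightarrow> nat set set \<Rightarrow> (nat \<Rightarrow> nat) \<Rightarrow> (nat \<times> nat) set" where
  "conflict_pairs n EG p = missing_pairs n EG p \<union> (\<lambda>a. (a, a)) ` {..<n}"

lemma finite_conflict_pairs [simp]: "finite (conflict_pairs n EG p)"
  unfolding conflict_pairs_def by simp

lemma card_conflict_pairs: "real (card (conflict_pairs n EG p)) \<le> real (card (missing_pairs n EG p)) + real n"
proof -
  have "card (conflict_pairs n EG p) \<le> card (missing_pairs n EG p) + card ((\<lambda>a. (a, a)) ` {..<n})"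
    unfolding conflict_pairs_def by (rule card_Un_le)
  also have "card ((\<lambda>a. (a, a)) ` {..<n}) \<le> n" using card_image_le[of "{..<n}" "\<lambda>a. (a, a)"] by simp
  finally show ?thesis by simp
qed

context critical_graph begin

definition vertex_slots :: "nat \<Rightarrow> nat set set \<Rightarrow> (nat \<Rightarrow> nat) \<Rightarrow> nat set \<Rightarrow> nat \<Rightarrow> 'a \<times> ('a \<Rightarrow> nat) \<Rightarrow> 'a \<Rightarrow> nat set" where
  "vertex_slots n EG p X x q v = {a. a < n \<and> a \<notin> X \<and> p a = snd q v \<and> ({fst q, v} \<in> E \<longrightarrow> {x, a} \<in> EG)}"

text \<open>Send \<open>u\<close> to \<open>x\<close> and every other vertex into the part named by
  its colour, outside \<open>X\<close>. The slots guarantee the edges at \<open>u\<close>; all other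
  edges join different parts and are guaranteed by avoiding conflicts. The embedding determines the
  pointed colouring: \<open>u\<close> is the only vertex sent into \<open>X\<close>, and
  \<open>c\<close> is read off from the parts.\<close>

lemma embeddings_through_vertex:
  assumes X: "x \<in> X" "x < n" and n: "0 < n"
    and \<tau>: "0 \<le> \<tau>" "\<And>i. i < r \<Longrightarrow> \<tau> \<le> real (card {a. a < n \<and> a \<notin> X \<and> p a = i}) / real n"
    and \<zeta>: "\<And>i. i < r \<Longrightarrow> 0 \<le> \<zeta> i"
      "\<And>i. i < r \<Longrightarrow> \<zeta> i \<le> real (card {a. a < n \<and> a \<notin> X \<and> p a = i \<and> {x, a} \<in> EG}) / real n"
  shows "real n ^ (f - 1) * ((\<Sum>(u, c)\<in>pointed_colorings. \<Prod>v\<in>V - {u}. if {u, v} \<in> E then \<zeta> (c v) else \<tau>)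
      - real (card pointed_colorings) * (real f)\<^sup>2 * (real (card (missing_pairs n EG p)) + real n) / (real n)\<^sup>2)
    \<le> real (card {\<phi> \<in> embeddings V E n EG. \<phi> ` V \<inter> X = {x}})"
proof -
  let ?D = "{\<phi> \<in> embeddings V E n EG. \<phi> ` V \<inter> X = {x}}"
  let ?S = "vertex_slots n EG p X x"
  define R where "R = conflict_pairs n EG p"
  note fR = finite_conflict_pairs[of n EG p, folded R_def] and cR = card_conflict_pairs[of n EG p, folded R_def]
  define Good where "Good = (\<lambda>q. {\<psi> \<in> Pi\<^sub>E (V - {fst q}) (?S q).
      \<forall>v\<in>V - {fst q}. \<forall>w\<in>V - {fst q}. v \<noteq> w \<longrightarrow> (\<psi> v, \<psi> w) \<notin> R})"
  have slot_sub: "?S q v \<subseteq> {0..<n}" for q v unfolding vertex_slots_def by auto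
  have fGood: "finite (Good q)" for q
    unfolding Good_def using fV slot_sub[of q]
    by (intro finite_subset[OF _ finite_PiE[of "V - {fst q}" "?S q"]]) (auto intro: finite_subset)
  have slot: "\<psi> v < n \<and> \<psi> v \<notin> X \<and> p (\<psi> v) = c v \<and> ({u, v} \<in> E \<longrightarrow> {x, \<psi> v} \<in> EG)"
    if "\<psi> \<in> Good (u, c)" "v \<in> V" "v \<noteq> u" for \<psi> u c v
  proof -
    have "\<psi> \<in> Pi\<^sub>E (V - {u}) (?S (u, c))" using that unfolding Good_def by simp
    then have "\<psi> v \<in> ?S (u, c) v" by (rule PiE_mem) (use that in auto)
    then show ?thesis unfolding vertex_slots_def by simp
  qed
  have ext: "\<psi> v = undefined" if "\<psi> \<in> Good (u, c)" "v \<notin> V - {u}" for \<psi> u c v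
  proof -
    have "\<psi> \<in> Pi\<^sub>E (V - {u}) (?S (u, c))" using that unfolding Good_def by simp
    then show ?thesis using that(2) by (rule PiE_arb)
  qed
  have avoid: "(\<psi> v, \<psi> w) \<notin> R" if "\<psi> \<in> Good (u, c)" "v \<in> V" "v \<noteq> u" "w \<in> V" "w \<noteq> u" "v \<noteq> w" for \<psi> u c v w
    using that unfolding Good_def by auto
  have "card (Sigma pointed_colorings Good) \<le> card ?D"
  proof (rule card_inj_on_le[where f = "\<lambda>(q, \<psi>). \<psi>(fst q := x)"])
    show "inj_on (\<lambda>(q, \<psi>). \<psi>(fst q := x)) (Sigma pointed_colorings Good)"
    proof (rule inj_onI)
      fix s t assume "s \<in> Sigma pointed_colorings Good" "t \<in> Sigma pointed_colorings Good"
        and eq0: "(case s of (q, \<psi>) \<Rightarrow> \<psi>(fst q := x)) = (case t of (q, \<psi>) \<Rightarrow> \<psi>(fst q := x))"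
      then obtain u c \<psi> u' c' \<psi>' where s: "s = ((u, c), \<psi>)" and t: "t = ((u', c'), \<psi>')"
        and u: "u \<in> V" and c: "c \<in> colorings_u r V E u" and \<psi>: "\<psi> \<in> Good (u, c)"
        and u': "u' \<in> V" and c': "c' \<in> colorings_u r V E u'" and \<psi>': "\<psi>' \<in> Good (u', c')" by auto
      have eq: "(\<psi>(u := x)) y = (\<psi>'(u' := x)) y" for y using eq0 s t by simp
      have uu: "u = u'"
      proof (rule ccontr)
        assume ne: "u \<noteq> u'"
        then have "\<psi>' u = x" using eq[of u] by simp
        then show False using slot[OF \<psi>' u ne] X by auto
      qed
      have "\<psi> y = \<psi>' y" for y
      proof (cases "y = u")
        case True
        then show ?thesis using ext[OF \<psi>, of y] ext[OF \<psi>', of y] uu by simp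
      next
        case False
        then show ?thesis using eq[of y] uu by simp
      qed
      then have pp: "\<psi> = \<psi>'" by auto
      have "c = c'"
      proof (rule PiE_ext)
        show "c \<in> (V - {u}) \<rightarrow>\<^sub>E {0..<r}" "c' \<in> (V - {u}) \<rightarrow>\<^sub>E {0..<r}"
          using c c' uu unfolding colorings_u_def by auto
        fix y assume y: "y \<in> V - {u}"
        then show "c y = c' y" using slot[OF \<psi>, of y] slot[OF \<psi>', of y] uu pp by auto
      qed
      then show "s = t" using s t uu pp by simp
    qed
    show "(\<lambda>(q, \<psi>). \<psi>(fst q := x)) ` Sigma pointed_colorings Good \<subseteq> ?D"
    proof (rule image_subsetI)
      fix s assume "s \<in> Sigma pointed_colorings Good"
      then obtain u c \<psi> where s: "s = ((u, c), \<psi>)" and u: "u \<in> V" and c: "c \<in> colorings_u r V E u"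
        and \<psi>: "\<psi> \<in> Good (u, c)" by auto
      define \<phi> where "\<phi> = \<psi>(u := x)"
      have \<phi>u: "\<phi> u = x" and \<phi>v: "\<And>v. v \<noteq> u \<Longrightarrow> \<phi> v = \<psi> v" unfolding \<phi>_def by auto
      have "\<phi> \<in> V \<rightarrow>\<^sub>E {0..<n}"
      proof (rule PiE_I)
        fix v assume "v \<in> V"
        then show "\<phi> v \<in> {0..<n}" using slot[OF \<psi>, of v] X \<phi>u \<phi>v by (cases "v = u") auto
      next
        fix v assume "v \<notin> V"
        then show "\<phi> v = undefined" using ext[OF \<psi>, of v] \<phi>v u by (cases "v = u") auto
      qed
      moreover have "inj_on \<phi> V"
      proof (rule inj_onI, rule ccontr)
        fix v w assume vw: "v \<in> V" "w \<in> V" "\<phi> v = \<phi> w" "v \<noteq> w"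
        show False
        proof (cases "v = u \<or> w = u")
          case True
          then show ?thesis using slot[OF \<psi>, of v] slot[OF \<psi>, of w] vw X \<phi>u \<phi>v by metis
        next
          case False
          then have "(\<psi> v, \<psi> w) \<notin> R" "\<psi> v = \<psi> w" "\<psi> v < n"
            using avoid[OF \<psi>, of v w] slot[OF \<psi>, of v] vw \<phi>v by auto
          then show ?thesis unfolding R_def conflict_pairs_def by auto
        qed
      qed
      moreover have "{\<phi> v, \<phi> w} \<in> EG" if vw: "v \<in> V" "w \<in> V" "{v, w} \<in> E" for v w
      proof -
        have ne: "v \<noteq> w" using simple_graphD(4)[OF F vw(3)] .
        have wv: "{w, v} \<in> E" using vw(3) by (simp add: insert_commute)
        consider "v = u" | "w = u" | "v \<noteq> u" "w \<noteq> u" by blast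
        then show ?thesis
        proof cases
          case 1
          then show ?thesis using slot[OF \<psi>, of w] vw ne \<phi>u \<phi>v by auto
        next
          case 2
          then have "{x, \<psi> v} \<in> EG" using slot[OF \<psi>, of v] vw wv ne by auto
          then show ?thesis using 2 \<phi>u \<phi>v ne by (simp add: insert_commute)
        next
          case 3
          have "c v \<noteq> c w" using colorings_uD(2)[OF c] vw 3 by auto
          then have "p (\<psi> v) \<noteq> p (\<psi> w)" using slot[OF \<psi>, of v] slot[OF \<psi>, of w] vw 3 by auto
          then show ?thesis using avoid[OF \<psi> vw(1) 3(1) vw(2) 3(2) ne] \<phi>v 3 slot[OF \<psi>, of v] slot[OF \<psi>, of w] vw
            unfolding R_def conflict_pairs_def missing_pairs_def by auto
        qed
      qed
      moreover have "\<phi> ` V \<inter> X = {x}"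
      proof -
        have "\<phi> v \<notin> X" if "v \<in> V" "v \<noteq> u" for v using slot[OF \<psi> that] \<phi>v that by auto
        then show ?thesis using \<phi>u u X by auto
      qed
      ultimately show "(case s of (q, \<psi>) \<Rightarrow> \<psi>(fst q := x)) \<in> ?D"
        unfolding embeddings_def s \<phi>_def by auto
    qed
    show "finite ?D" using finite_embeddings[OF fV] by auto
  qed
  then have le: "(\<Sum>q\<in>pointed_colorings. real (card (Good q))) \<le> real (card ?D)"
    by (rule sum_card_le_if_card_Sigma_le[OF finite_pointed_colorings fGood])
  define err where "err = (real f)\<^sup>2 * (real (card (missing_pairs n EG p)) + real n) / (real n)\<^sup>2"
  have "real n ^ (f - 1) * ((case q of (u, c) \<Rightarrow> \<Prod>v\<in>V - {u}. if {u, v} \<in> E then \<zeta> (c v) else \<tau>) - err) \<le> real (card (Good q))"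
    if q: "q \<in> pointed_colorings" for q
  proof -
    obtain u c where qq: "q = (u, c)" "u \<in> V" and c: "c \<in> colorings_u r V E u" using q by auto
    have ck: "card (V - {u}) = f - 1" using fV qq by simp
    have "real n ^ card (V - {u}) * ((\<Prod>v\<in>V - {u}. real (card (?S q v)) / real n)
        - (real (card (V - {u})))\<^sup>2 * real (card R) / (real n)\<^sup>2) \<le> real (card (Good q))"
      unfolding Good_def qq fst_conv by (rule card_PiE_avoiding) (use fV slot_sub n fR in auto)
    moreover have "(\<Prod>v\<in>V - {u}. if {u, v} \<in> E then \<zeta> (c v) else \<tau>) \<le> (\<Prod>v\<in>V - {u}. real (card (?S q v)) / real n)"
    proof (rule prod_mono)
      fix v assume v: "v \<in> V - {u}"
      then have cv: "c v < r" using colorings_uD(1)[OF c] by auto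
      have "?S q v = (if {u, v} \<in> E then {a. a < n \<and> a \<notin> X \<and> p a = c v \<and> {x, a} \<in> EG} else {a. a < n \<and> a \<notin> X \<and> p a = c v})"
        unfolding vertex_slots_def qq by auto
      then show "0 \<le> (if {u, v} \<in> E then \<zeta> (c v) else \<tau>) \<and> (if {u, v} \<in> E then \<zeta> (c v) else \<tau>) \<le> real (card (?S q v)) / real n"
        using \<tau>(1) \<tau>(2)[OF cv] \<zeta>(1)[OF cv] \<zeta>(2)[OF cv] by auto
    qed
    moreover have "(real (card (V - {u})))\<^sup>2 * real (card R) / (real n)\<^sup>2 \<le> err"
      unfolding err_def
    proof (rule divide_right_mono, rule mult_mono[OF _ cR])
      show "(real (card (V - {u})))\<^sup>2 \<le> (real f)\<^sup>2" unfolding ck by (rule power_mono) auto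
    qed auto
    ultimately have "real n ^ (f - 1) * ((\<Prod>v\<in>V - {u}. if {u, v} \<in> E then \<zeta> (c v) else \<tau>) - err)
      \<le> real n ^ card (V - {u}) * ((\<Prod>v\<in>V - {u}. real (card (?S q v)) / real n)
        - (real (card (V - {u})))\<^sup>2 * real (card R) / (real n)\<^sup>2)"
      unfolding ck by (intro mult_left_mono) auto
    then show ?thesis using \<open>_ \<le> real (card (Good q))\<close> qq by simp
  qed
  then have "(\<Sum>q\<in>pointed_colorings. real n ^ (f - 1) * ((case q of (u, c) \<Rightarrow> \<Prod>v\<in>V - {u}. if {u, v} \<in> E then \<zeta> (c v) else \<tau>) - err))
      \<le> (\<Sum>q\<in>pointed_colorings. real (card (Good q)))" by (rule sum_mono)
  also note le
  finally show ?thesis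
    unfolding sum_distrib_left[symmetric] sum_subtractf err_def by (simp add: mult.assoc)
qed

definition edge_slots :: "nat \<Rightarrow> nat set set \<Rightarrow> (nat \<Rightarrow> nat) \<Rightarrow> nat set \<Rightarrow> nat \<Rightarrow> nat \<Rightarrow> 'a \<Rightarrow> 'a \<Rightarrow> ('a \<Rightarrow> nat) \<Rightarrow> 'a \<Rightarrow> nat set" where
  "edge_slots n EG p X x y u v c w = {a. a < n \<and> a \<notin> X \<and> a \<noteq> x \<and> a \<noteq> y \<and> p a = c w \<and>
      ({u, w} \<in> E \<longrightarrow> {x, a} \<in> EG) \<and> ({v, w} \<in> E \<longrightarrow> {y, a} \<in> EG)}"

text \<open>Remembers in both orientations which same-part edges an embedding uses, so that
  embeddings counted at different edges can be told apart.\<close>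

definition monochromatic_pairs :: "(nat \<Rightarrow> nat) \<Rightarrow> ('a \<Rightarrow> nat) \<Rightarrow> (nat \<times> nat) set" where
  "monochromatic_pairs p \<phi> = {(\<phi> v, \<phi> w) | v w. v \<in> V \<and> w \<in> V \<and> {v, w} \<in> E \<and> p (\<phi> v) = p (\<phi> w)}"

text \<open>Copies through a same-part edge are to avoid \<open>X\<close>, so only non-neighbours
  outside \<open>X\<close> matter. Their total can then be charged to missing pairs with both ends
  outside \<open>X\<close>.\<close>

definition missing_outside :: "nat \<Rightarrow> nat set set \<Rightarrow> (nat \<Rightarrow> nat) \<Rightarrow> nat set \<Rightarrow> nat \<Rightarrow> nat set" where
  "missing_outside n EG p X x = {a. a < n \<and> a \<notin> X \<and> p a \<noteq> p x \<and> {x, a} \<notin> EG}"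

text \<open>A vertex \<open>w\<close> adjacent to \<open>u\<close> or to \<open>v\<close> has a
  colour other than \<open>i\<close>, because \<open>v\<close> is the single neighbour of
  \<open>u\<close> of that colour and \<open>c\<close> is proper. So \<open>x\<close> and
  \<open>y\<close> need only cross edges to its image, and apart from \<open>x\<close> and
  \<open>y\<close> themselves, which account for the 2, only missing cross pairs shrink the
  slot.\<close>

lemma card_edge_slots:
  assumes c: "c \<in> colorings_u r V E u" and s: "single_nbr V E u c i v" and p: "p x = i" "p y = i"
    and w: "w \<in> V - {u, v}"
  shows "real (card {a. a < n \<and> a \<notin> X \<and> p a = c w}) - real (card (missing_outside n EG p X x))
      - real (card (missing_outside n EG p X y)) - 2 \<le> real (card (edge_slots n EG p X x y u v c w))"
proof -
  note s' = single_nbrD[OF s]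
  let ?M = "missing_outside n EG p X"
  let ?S = "edge_slots n EG p X x y u v c w"
  have fM: "finite (?M z)" for z unfolding missing_outside_def by (rule finite_subset[of _ "{..<n}"]) auto
  have fS: "finite ?S" unfolding edge_slots_def by (rule finite_subset[of _ "{..<n}"]) auto
  have 1: "c w \<noteq> i" if "{u, w} \<in> E" using s'(5)[of w] w that by auto
  have 2: "c w \<noteq> i" if "{v, w} \<in> E" using colorings_uD(2)[OF c, of v w] s' w that by auto
  have "{a. a < n \<and> a \<notin> X \<and> p a = c w} \<subseteq> ?S \<union> ?M x \<union> ?M y \<union> {x, y}"
    using 1 2 p unfolding edge_slots_def missing_outside_def by auto
  then have "card {a. a < n \<and> a \<notin> X \<and> p a = c w} \<le> card (?S \<union> ?M x \<union> ?M y \<union> {x, y})"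
    by (rule card_mono[rotated]) (use fM fS in auto)
  also have "\<dots> \<le> card ?S + card (?M x) + card (?M y) + card {x, y}"
    by (meson card_Un_le le_trans add_right_mono)
  also have "card {x, y} \<le> 2" by (simp add: card_insert_if)
  finally show ?thesis by linarith
qed

text \<open>The edge \<open>u, v\<close> of a critical pair goes to \<open>x, y\<close>, the other
  vertices into their slots. The preimages of \<open>x\<close> and \<open>y\<close> recover
  \<open>u\<close> and \<open>v\<close>, and the parts recover the colouring, so distinct choices
  give distinct embeddings.\<close>

lemma embeddings_through_edge:
  assumes G: "simple_graph {0..<n} EG" and xy: "{x, y} \<in> EG" "x \<notin> X" "y \<notin> X" "p x = i" "p y = i"
    and n: "0 < n"
    and \<tau>: "0 \<le> \<tau>" "\<And>u c v w. u \<in> V \<Longrightarrow> c \<in> colorings_u r V E u \<Longrightarrow> single_nbr V E u c i v \<Longrightarrow> w \<in> V - {u, v} \<Longrightarrow>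
        \<tau> \<le> real (card (edge_slots n EG p X x y u v c w)) / real n"
  shows "real n ^ (f - 2) * (real (card (critical_pairs i)) * \<tau> ^ (f - 2)
      - real (card pointed_colorings) * (real f)\<^sup>2 * (real (card (missing_pairs n EG p)) + real n) / (real n)\<^sup>2)
    \<le> real (card {\<phi> \<in> embeddings V E n EG. \<phi> ` V \<inter> X = {} \<and> monochromatic_pairs p \<phi> = {(x, y), (y, x)}})"
proof -
  let ?D = "{\<phi> \<in> embeddings V E n EG. \<phi> ` V \<inter> X = {} \<and> monochromatic_pairs p \<phi> = {(x, y), (y, x)}}"
  have xyn: "x < n" "y < n" "x \<noteq> y" using simple_graphD(2-4)[OF G xy(1)] by auto
  define R where "R = conflict_pairs n EG p"
  note fR = finite_conflict_pairs[of n EG p, folded R_def] and cR = card_conflict_pairs[of n EG p, folded R_def]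
  define nb where "nb q = (SOME v. single_nbr V E (fst q) (snd q) i v)" for q
  let ?S = "\<lambda>q. edge_slots n EG p X x y (fst q) (nb q) (snd q)"
  let ?K = "\<lambda>q. V - {fst q, nb q}"
  have nb: "single_nbr V E u c i (nb (u, c))" if "(u, c) \<in> critical_pairs i" for u c
    using that unfolding critical_pairs_def nb_def by (auto intro: someI_ex)
  define Good where "Good = (\<lambda>q. {\<psi> \<in> Pi\<^sub>E (?K q) (?S q).
      \<forall>v\<in>?K q. \<forall>w\<in>?K q. v \<noteq> w \<longrightarrow> (\<psi> v, \<psi> w) \<notin> R})"
  have slot_sub: "?S q v \<subseteq> {0..<n}" for q v unfolding edge_slots_def by auto
  have fcp: "finite (critical_pairs i)" using critical_pairs_subset finite_pointed_colorings by (rule finite_subset)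
  have fGood: "finite (Good q)" for q
    unfolding Good_def using fV slot_sub[of q]
    by (intro finite_subset[OF _ finite_PiE[of "?K q" "?S q"]]) (auto intro: finite_subset)
  have slot: "\<psi> w < n \<and> \<psi> w \<notin> X \<and> \<psi> w \<noteq> x \<and> \<psi> w \<noteq> y \<and> p (\<psi> w) = c w \<and>
      ({u, w} \<in> E \<longrightarrow> {x, \<psi> w} \<in> EG) \<and> ({nb (u, c), w} \<in> E \<longrightarrow> {y, \<psi> w} \<in> EG)"
    if "\<psi> \<in> Good (u, c)" "w \<in> V" "w \<noteq> u" "w \<noteq> nb (u, c)" for \<psi> u c w
  proof -
    have "\<psi> \<in> Pi\<^sub>E (?K (u, c)) (?S (u, c))" using that unfolding Good_def by simp
    then have "\<psi> w \<in> ?S (u, c) w" by (rule PiE_mem) (use that in auto)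
    then show ?thesis unfolding edge_slots_def by simp
  qed
  have ext: "\<psi> w = undefined" if "\<psi> \<in> Good (u, c)" "w \<notin> V - {u, nb (u, c)}" for \<psi> u c w
  proof -
    have "\<psi> \<in> Pi\<^sub>E (?K (u, c)) (?S (u, c))" using that unfolding Good_def by simp
    then show ?thesis by (rule PiE_arb) (use that(2) in simp)
  qed
  have avoid: "(\<psi> v, \<psi> w) \<notin> R" if "\<psi> \<in> Good (u, c)" "v \<in> V - {u, nb (u, c)}" "w \<in> V - {u, nb (u, c)}" "v \<noteq> w" for \<psi> u c v w
    using that unfolding Good_def by auto
  let ?ext = "\<lambda>(q, \<psi>). \<psi>(fst q := x, nb q := y)"
  have "card (Sigma (critical_pairs i) Good) \<le> card ?D"
  proof (rule card_inj_on_le[where f = ?ext])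
    show "inj_on ?ext (Sigma (critical_pairs i) Good)"
    proof (rule inj_onI)
      fix s t assume "s \<in> Sigma (critical_pairs i) Good" "t \<in> Sigma (critical_pairs i) Good"
        and eq0: "?ext s = ?ext t"
      then obtain q1 q2 where "s = (q1, snd s)" "q1 \<in> critical_pairs i" "snd s \<in> Good q1"
        "t = (q2, snd t)" "q2 \<in> critical_pairs i" "snd t \<in> Good q2" by auto
      then obtain u c \<psi> u' c' \<psi>' where s: "s = ((u, c), \<psi>)" and t: "t = ((u', c'), \<psi>')"
        and q: "(u, c) \<in> critical_pairs i" and \<psi>: "\<psi> \<in> Good (u, c)"
        and q': "(u', c') \<in> critical_pairs i" and \<psi>': "\<psi>' \<in> Good (u', c')" by (cases q1, cases q2) blast
      have u: "u \<in> V" and c: "c \<in> colorings_u r V E u" and u': "u' \<in> V" and c': "c' \<in> colorings_u r V E u'"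
        using q q' critical_pairs_subset by auto
      note v = single_nbrD[OF nb[OF q]] and v' = single_nbrD[OF nb[OF q']]
      have eq: "(\<psi>(u := x, nb (u, c) := y)) z = (\<psi>'(u' := x, nb (u', c') := y)) z" for z using eq0 s t by simp
      have uu: "u = u'"
      proof (rule ccontr)
        assume ne: "u \<noteq> u'"
        show False using eq[of u] slot[OF \<psi>' u ne] v(2) xyn ne by (auto split: if_splits)
      qed
      have vv: "nb (u, c) = nb (u', c')"
      proof (rule ccontr)
        assume ne: "nb (u, c) \<noteq> nb (u', c')"
        show False using eq[of "nb (u, c)"] slot[OF \<psi>' v(1) _ ne] v(2) xyn ne uu by (auto split: if_splits)
      qed
      have "\<psi> z = \<psi>' z" for z
      proof (cases "z = u \<or> z = nb (u, c)")
        case True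
        then show ?thesis using ext[OF \<psi>, of z] ext[OF \<psi>', of z] uu vv by auto
      next
        case False
        then show ?thesis using eq[of z] uu vv by simp
      qed
      then have pp: "\<psi> = \<psi>'" by auto
      have "c = c'"
      proof (rule PiE_ext)
        show "c \<in> (V - {u}) \<rightarrow>\<^sub>E {0..<r}" "c' \<in> (V - {u}) \<rightarrow>\<^sub>E {0..<r}"
          using c c' uu unfolding colorings_u_def by auto
        fix z assume z: "z \<in> V - {u}"
        show "c z = c' z"
        proof (cases "z = nb (u, c)")
          case True
          then show ?thesis using v(4) v'(4) vv by simp
        next
          case False
          then show ?thesis using slot[OF \<psi>, of z] slot[OF \<psi>', of z] uu vv pp z by auto
        qed
      qed
      then show "s = t" using s t uu pp by simp
    qed
    show "?ext ` Sigma (critical_pairs i) Good \<subseteq> ?D"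
    proof (rule image_subsetI)
      fix s assume "s \<in> Sigma (critical_pairs i) Good"
      then obtain q1 where "s = (q1, snd s)" "q1 \<in> critical_pairs i" "snd s \<in> Good q1" by auto
      then obtain u c \<psi> where s: "s = ((u, c), \<psi>)" and q: "(u, c) \<in> critical_pairs i"
        and \<psi>: "\<psi> \<in> Good (u, c)" by (cases q1) blast
      have u: "u \<in> V" and c: "c \<in> colorings_u r V E u" using q critical_pairs_subset by auto
      define v where "v = nb (u, c)"
      note v = single_nbrD[OF nb[OF q], folded v_def]
      note slot = slot[OF \<psi>, folded v_def]
      define \<phi> where "\<phi> = \<psi>(u := x, v := y)"
      have \<phi>u: "\<phi> u = x" "\<phi> v = y" and \<phi>w: "\<And>w. w \<noteq> u \<Longrightarrow> w \<noteq> v \<Longrightarrow> \<phi> w = \<psi> w" unfolding \<phi>_def using v(2) by auto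
      have "\<phi> \<in> V \<rightarrow>\<^sub>E {0..<n}"
      proof (rule PiE_I)
        fix w assume "w \<in> V"
        then show "\<phi> w \<in> {0..<n}" using slot[of w] xyn \<phi>u \<phi>w by (cases "w = u"; cases "w = v") auto
      next
        fix w assume "w \<notin> V"
        then show "\<phi> w = undefined" using ext[OF \<psi>, of w] \<phi>w u v(1) by (cases "w = u"; cases "w = v") auto
      qed
      moreover have "inj_on \<phi> V"
      proof (rule inj_onI, rule ccontr)
        fix a b assume ab: "a \<in> V" "b \<in> V" "\<phi> a = \<phi> b" "a \<noteq> b"
        show False
        proof (cases "a \<in> {u, v} \<or> b \<in> {u, v}")
          case True
          then show ?thesis
            using slot[of a] slot[of b] ab xyn \<phi>u \<phi>w[of a] \<phi>w[of b] by (cases "a = u"; cases "a = v"; cases "b = u"; cases "b = v") auto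
        next
          case False
          then have "(\<psi> a, \<psi> b) \<notin> R" "\<psi> a = \<psi> b" "\<psi> a < n"
            using avoid[OF \<psi>, of a b] slot[of a] ab \<phi>w unfolding v_def by auto
          then show ?thesis unfolding R_def conflict_pairs_def by auto
        qed
      qed
      moreover have edge: "{\<phi> a, \<phi> b} \<in> EG \<and> (p (\<phi> a) = p (\<phi> b) \<longrightarrow> {a, b} = {u, v})"
        if ab: "a \<in> V" "b \<in> V" "{a, b} \<in> E" for a b
      proof -
        \<comment> \<open>An edge of \<open>F\<close> leaving \<open>{u, v}\<close> has its other
          end coloured differently from \<open>i\<close>, so it is mapped across parts; only
          \<open>u, v\<close> itself stays inside a part.\<close>
        have at_uv: "{\<phi> a, \<phi> b} \<in> EG \<and> (p (\<phi> a) = p (\<phi> b) \<longrightarrow> {a, b} = {u, v})"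
          if ab: "a \<in> V" "b \<in> V" "{a, b} \<in> E" "a \<in> {u, v}" for a b
        proof (cases "b \<in> {u, v}")
          case True
          have "a \<noteq> b" using simple_graphD(4)[OF F ab(3)] .
          then have "{a, b} = {u, v}" "{\<phi> a, \<phi> b} = {x, y}" using True ab(4) \<phi>u by auto
          then show ?thesis using xy(1) by simp
        next
          case False
          then have sb: "p (\<phi> b) = c b" "{u, b} \<in> E \<Longrightarrow> {x, \<phi> b} \<in> EG" "{v, b} \<in> E \<Longrightarrow> {y, \<phi> b} \<in> EG"
            using slot[of b] \<phi>w ab by auto
          have "c b \<noteq> i" using ab False v(4) v(5)[of b] colorings_uD(2)[OF c, of v b] v(1,2) by auto
          moreover have "p (\<phi> a) = i" using ab(4) \<phi>u xy by auto
          ultimately show ?thesis using sb ab \<phi>u by auto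
        qed
        consider "a \<in> {u, v}" | "b \<in> {u, v}" | "a \<notin> {u, v}" "b \<notin> {u, v}" by blast
        then show ?thesis
        proof cases
          case 1
          then show ?thesis using at_uv ab by blast
        next
          case 2
          then show ?thesis using at_uv[of b a] ab by (simp add: insert_commute eq_commute)
        next
          case 3
          have ne: "a \<noteq> b" using simple_graphD(4)[OF F ab(3)] .
          have "c a \<noteq> c b" using colorings_uD(2)[OF c, of a b] ab 3 by auto
          then have "p (\<psi> a) \<noteq> p (\<psi> b)" using slot[of a] slot[of b] ab 3 by auto
          moreover have "(\<psi> a, \<psi> b) \<notin> R" using avoid[OF \<psi>, of a b] ab 3 ne unfolding v_def by auto
          ultimately show ?thesis using \<phi>w 3 slot[of a] slot[of b] ab
            unfolding R_def conflict_pairs_def missing_pairs_def by auto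
        qed
      qed
      moreover have "\<phi> ` V \<inter> X = {}"
      proof -
        have "\<phi> w \<notin> X" if "w \<in> V" for w
          using slot[of w] \<phi>w[of w] \<phi>u xy that by (cases "w = u"; cases "w = v") auto
        then show ?thesis by auto
      qed
      moreover have "monochromatic_pairs p \<phi> = {(x, y), (y, x)}"
      proof
        show "monochromatic_pairs p \<phi> \<subseteq> {(x, y), (y, x)}"
          unfolding monochromatic_pairs_def using edge \<phi>u by (auto simp: doubleton_eq_iff)
        have "{v, u} \<in> E" using v(3) by (simp add: insert_commute)
        then show "{(x, y), (y, x)} \<subseteq> monochromatic_pairs p \<phi>"
          unfolding monochromatic_pairs_def using u v \<phi>u xy by force
      qed
      ultimately show "?ext s \<in> ?D"
        unfolding embeddings_def s \<phi>_def v_def by auto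
    qed
    show "finite ?D" using finite_embeddings[OF fV] by auto
  qed
  then have le: "(\<Sum>q\<in>critical_pairs i. real (card (Good q))) \<le> real (card ?D)"
    by (rule sum_card_le_if_card_Sigma_le[OF fcp fGood])
  define err where "err = (real f)\<^sup>2 * (real (card (missing_pairs n EG p)) + real n) / (real n)\<^sup>2"
  have err: "0 \<le> err" unfolding err_def by simp
  have "real n ^ (f - 2) * (\<tau> ^ (f - 2) - err) \<le> real (card (Good q))"
    if q: "q \<in> critical_pairs i" for q
  proof -
    obtain u c where qq: "q = (u, c)" by (cases q)
    have u: "u \<in> V" and c: "c \<in> colorings_u r V E u" using q critical_pairs_subset qq by auto
    note nbq = nb[OF q[unfolded qq]]
    note v = single_nbrD[OF nbq]
    have ck: "card (V - {u, nb q}) = f - 2" using card_V_minus[of u "nb q"] u v qq by auto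
    have "real n ^ card (V - {u, nb q}) * ((\<Prod>v\<in>V - {u, nb q}. real (card (?S q v)) / real n)
        - (real (card (V - {u, nb q})))\<^sup>2 * real (card R) / (real n)\<^sup>2) \<le> real (card (Good q))"
      unfolding Good_def qq fst_conv by (rule card_PiE_avoiding) (use fV slot_sub[of "(u, c)"] n fR in auto)
    moreover have "\<tau> ^ (f - 2) \<le> (\<Prod>v\<in>V - {u, nb q}. real (card (?S q v)) / real n)"
    proof -
      have "(\<Prod>w\<in>V - {u, nb q}. \<tau>) \<le> (\<Prod>v\<in>V - {u, nb q}. real (card (?S q v)) / real n)"
        by (intro prod_mono conjI \<tau>(1)) (use \<tau>(2)[OF u c nbq] qq in auto)
      then show ?thesis using ck by simp
    qed
    moreover have "(real (card (V - {u, nb q})))\<^sup>2 * real (card R) / (real n)\<^sup>2 \<le> err"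
      unfolding err_def
    proof (rule divide_right_mono, rule mult_mono[OF _ cR])
      show "(real (card (V - {u, nb q})))\<^sup>2 \<le> (real f)\<^sup>2" unfolding ck by (rule power_mono) auto
    qed auto
    ultimately have "real n ^ (f - 2) * (\<tau> ^ (f - 2) - err)
      \<le> real n ^ card (V - {u, nb q}) * ((\<Prod>v\<in>V - {u, nb q}. real (card (?S q v)) / real n)
        - (real (card (V - {u, nb q})))\<^sup>2 * real (card R) / (real n)\<^sup>2)"
      unfolding ck by (intro mult_left_mono) auto
    then show ?thesis using \<open>_ \<le> real (card (Good q))\<close> by linarith
  qed
  then have "(\<Sum>q\<in>critical_pairs i. real n ^ (f - 2) * (\<tau> ^ (f - 2) - err))
      \<le> (\<Sum>q\<in>critical_pairs i. real (card (Good q)))" by (rule sum_mono)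
  also note le
  finally have main: "real (card (critical_pairs i)) * (real n ^ (f - 2) * (\<tau> ^ (f - 2) - err)) \<le> real (card ?D)" by simp
  have "real (card (critical_pairs i)) \<le> real (card pointed_colorings)"
    using card_mono[OF finite_pointed_colorings critical_pairs_subset] by simp
  then have "real (card (critical_pairs i)) * err \<le> real (card pointed_colorings) * err"
    using err by (rule mult_right_mono)
  then have "real n ^ (f - 2) * (real (card (critical_pairs i)) * \<tau> ^ (f - 2) - real (card pointed_colorings) * err)
    \<le> real n ^ (f - 2) * (real (card (critical_pairs i)) * \<tau> ^ (f - 2) - real (card (critical_pairs i)) * err)"
    by (intro mult_left_mono) auto
  also have "\<dots> = real (card (critical_pairs i)) * (real n ^ (f - 2) * (\<tau> ^ (f - 2) - err))" by (simp add: algebra_simps)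
  also note main
  finally show ?thesis unfolding err_def by (simp add: mult.assoc)
qed

end

section \<open>Partitions close to the Turan graph\<close>

text \<open>Pairs meeting \<open>X\<close> are covered by those starting in \<open>X\<close> and
  their converses, pairs inside \<open>X\<close> being covered twice. In the final count the first
  direction serves for same-part pairs and the second for missing pairs, where the overlap
  \<open>card X * card X\<close> has to be compensated.\<close>

lemma card_sym_rel_le:
  assumes S: "finite S" "sym S" and X: "finite X"
  shows "card S \<le> 2 * (\<Sum>x\<in>X. card (S `` {x})) + card (S \<inter> (- X) \<times> (- X))"
    and "2 * (\<Sum>x\<in>X. card (S `` {x})) + card (S \<inter> (- X) \<times> (- X)) \<le> card S + card X * card X"
proof -
  define A where "A = Sigma X (\<lambda>x. S `` {x})"
  have fim: "finite (S `` {x})" for x using S(1) by (rule finite_Image)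
  have fA: "finite A" unfolding A_def using X fim by auto
  have cA: "card A = (\<Sum>x\<in>X. card (S `` {x}))" unfolding A_def using X fim by simp
  have cA': "card (A\<inverse>) = card A" by (rule card_inverse)
  have S': "S = (A \<union> A\<inverse>) \<union> S \<inter> (- X) \<times> (- X)"
    unfolding A_def using S(2) by (auto dest: symD)
  have dis: "(A \<union> A\<inverse>) \<inter> (S \<inter> (- X) \<times> (- X)) = {}" unfolding A_def by auto
  have cS: "card S = card (A \<union> A\<inverse>) + card (S \<inter> (- X) \<times> (- X))"
    by (subst S', rule card_Un_disjoint) (use fA S dis in auto)
  have un: "card A + card (A\<inverse>) = card (A \<union> A\<inverse>) + card (A \<inter> A\<inverse>)"
    using fA by (intro card_Un_Int) auto
  show "card S \<le> 2 * (\<Sum>x\<in>X. card (S `` {x})) + card (S \<inter> (- X) \<times> (- X))"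
    using cS un cA cA' by linarith
  have "card (A \<inter> A\<inverse>) \<le> card (X \<times> X)" by (rule card_mono) (use X in \<open>auto simp: A_def\<close>)
  then have "card (A \<inter> A\<inverse>) \<le> card X * card X" by (simp add: card_cartesian_product)
  then show "2 * (\<Sum>x\<in>X. card (S `` {x})) + card (S \<inter> (- X) \<times> (- X)) \<le> card S + card X * card X"
    using cS un cA cA' by linarith
qed

lemma sum_sym_rel_less:
  fixes S :: "(nat \<times> nat) set" and h :: "nat \<Rightarrow> nat \<Rightarrow> real"
  assumes S: "finite S" "sym S" "\<And>x. (x, x) \<notin> S"
  shows "(\<Sum>(x, y)\<in>S. h x y) = (\<Sum>(x, y)\<in>{(x, y)\<in>S. x < y}. h x y + h y x)"
proof -
  let ?L = "{(x, y)\<in>S. x < y}" and ?U = "{(x, y)\<in>S. y < x}"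
  have SLU: "S = ?L \<union> ?U" using S(3) by (auto, metis linorder_neqE_nat)
  have fin: "finite ?L" "finite ?U" using S(1) by (auto intro: finite_subset[of _ S])
  have "(\<Sum>(x, y)\<in>S. h x y) = (\<Sum>(x, y)\<in>?L. h x y) + (\<Sum>(x, y)\<in>?U. h x y)"
    by (subst SLU, rule sum.union_disjoint) (use fin in auto)
  also have "(\<Sum>(x, y)\<in>?U. h x y) = (\<Sum>(x, y)\<in>?L. h y x)"
    by (rule sum.reindex_bij_witness[where i = prod.swap and j = prod.swap]) (use S(2) in \<open>auto dest: symD\<close>)
  also have "(\<Sum>(x, y)\<in>?L. h x y) + (\<Sum>(x, y)\<in>?L. h y x) = (\<Sum>(x, y)\<in>?L. h x y + h y x)"
    unfolding sum.distrib[symmetric] by (rule sum.cong) auto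
  finally show ?thesis .
qed

text \<open>A Bernoulli-type bound that survives truncation at 0, so \<open>t\<close> may exceed
  \<open>a\<close>. The loss is linear in \<open>t\<close>, hence additive over the missing pairs
  that cause it.\<close>

lemma power_diff_ge:
  fixes a t :: real
  assumes "0 \<le> a" "a \<le> 1" "0 \<le> t"
  shows "a ^ k - real k * t \<le> (max 0 (a - t)) ^ k"
proof (induction k)
  case 0
  then show ?case by simp
next
  case (Suc k)
  define b where "b = max 0 (a - t)"
  have b: "0 \<le> b" "a - t \<le> b" "b \<le> 1" using assms unfolding b_def by auto
  have ak: "a ^ k \<le> 1" "0 \<le> a ^ k" using assms by (auto intro: power_le_one)
  have "a ^ Suc k - real (Suc k) * t \<le> b * (a ^ k - real k * t)"
  proof -
    have "a * a ^ k \<le> (b + t) * a ^ k" using b ak by (intro mult_right_mono) auto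
    also have "\<dots> \<le> b * a ^ k + t" using mult_left_mono[OF ak(1) assms(3)] by (simp add: algebra_simps)
    finally have 1: "a ^ Suc k \<le> b * a ^ k + t" by simp
    have "b * (real k * t) \<le> 1 * (real k * t)" using b assms by (intro mult_right_mono) auto
    then show ?thesis using 1 by (simp add: algebra_simps)
  qed
  also have "\<dots> \<le> b * b ^ k" using Suc b unfolding b_def[symmetric] by (intro mult_left_mono) auto
  finally show ?case unfolding b_def by simp
qed

definition same_part_pairs :: "nat \<Rightarrow> nat set set \<Rightarrow> (nat \<Rightarrow> nat) \<Rightarrow> (nat \<times> nat) set" where
  "same_part_pairs n EG p = {(a, b). a < n \<and> b < n \<and> p a = p b \<and> {a, b} \<in> EG}"

lemma finite_same_part_pairs [simp]: "finite (same_part_pairs n EG p)"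
  unfolding same_part_pairs_def by (rule finite_subset[of _ "{..<n} \<times> {..<n}"]) auto

definition edge_pairs :: "nat \<Rightarrow> nat set set \<Rightarrow> (nat \<times> nat) set" where
  "edge_pairs n EG = {(a, b). a < n \<and> b < n \<and> {a, b} \<in> EG}"

lemma finite_edge_pairs [simp]: "finite (edge_pairs n EG)"
  unfolding edge_pairs_def by (rule finite_subset[of _ "{..<n} \<times> {..<n}"]) auto

lemma sum_part_sizes:
  fixes p :: "nat \<Rightarrow> nat"
  assumes "\<And>a. p a < r"
  shows "(\<Sum>i<r. real (card {a. a < n \<and> p a = i})) = real n"
proof -
  have "(\<Sum>i<r. card {a. a < n \<and> p a = i}) = (\<Sum>i<r. card {a\<in>{..<n}. p a = i})" by simp
  also have "\<dots> = (\<Sum>i<r. \<Sum>a\<in>{a\<in>{..<n}. p a = i}. 1)" by simp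
  also have "\<dots> = (\<Sum>a\<in>{..<n}. 1)" by (rule sum.group) (use assms in auto)
  finally have "(\<Sum>i<r. card {a. a < n \<and> p a = i}) = n" by simp
  then show ?thesis by (metis of_nat_sum)
qed

text \<open>All ordered pairs and all edges are split by parts; eliminating the cross edges leaves
  the sum of squared part sizes, which is expanded around the mean. Together with a lower bound on
  the edges it yields two facts at once: the parts are nearly equal, and same-part pairs outnumber
  missing pairs by twice the excess.\<close>

lemma part_deviation:
  assumes p: "\<And>a. p a < r" and r: "0 < r"
  shows "(\<Sum>i<r. (real (card {a. a < n \<and> p a = i}) - real n / real r)\<^sup>2)
    = real (card (same_part_pairs n EG p)) - real (card (missing_pairs n EG p))
      - (real (card (edge_pairs n EG)) - (1 - 1 / real r) * (real n)\<^sup>2)"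
proof -
  define P where "P i = {a. a < n \<and> p a = i}" for i
  define C where "C = {(a, b). a < n \<and> b < n \<and> p a \<noteq> p b \<and> {a, b} \<in> EG}"
  define S where "S = {(a, b). a < n \<and> b < n \<and> p a = p b}"
  have fin: "finite C" "finite S" unfolding C_def S_def by (auto intro: finite_subset[of _ "{..<n} \<times> {..<n}"])
  have fP: "finite (P i)" for i unfolding P_def by auto
  have dis: "same_part_pairs n EG p \<inter> C = {}" "S \<inter> (C \<union> missing_pairs n EG p) = {}" "C \<inter> missing_pairs n EG p = {}"
    unfolding S_def C_def same_part_pairs_def missing_pairs_def by auto
  have "edge_pairs n EG = same_part_pairs n EG p \<union> C"
    unfolding edge_pairs_def same_part_pairs_def C_def by auto
  then have 1: "card (edge_pairs n EG) = card (same_part_pairs n EG p) + card C"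
    using card_Un_disjoint[of "same_part_pairs n EG p" C] fin dis(1) by simp
  have "{..<n} \<times> {..<n} = S \<union> (C \<union> missing_pairs n EG p)"
    unfolding S_def C_def missing_pairs_def by auto
  then have "card ({..<n} \<times> {..<n}) = card (S \<union> (C \<union> missing_pairs n EG p))" by simp
  also have "\<dots> = card S + card (C \<union> missing_pairs n EG p)"
    using card_Un_disjoint[of S "C \<union> missing_pairs n EG p"] fin dis(2) by simp
  also have "card (C \<union> missing_pairs n EG p) = card C + card (missing_pairs n EG p)"
    using card_Un_disjoint[of C "missing_pairs n EG p"] fin dis(3) by simp
  finally have 2: "n * n = card S + (card C + card (missing_pairs n EG p))" by (simp add: card_cartesian_product)
  have "S = (\<Union>i<r. P i \<times> P i)" unfolding S_def P_def using p by auto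
  also have "card \<dots> = (\<Sum>i<r. card (P i \<times> P i))"
    by (rule card_UN_disjoint) (use fP in \<open>auto simp: P_def\<close>)
  finally have 3: "real (card S) = (\<Sum>i<r. (real (card (P i)))\<^sup>2)" by (simp add: card_cartesian_product power2_eq_square)
  have sumP: "(\<Sum>i<r. real (card (P i))) = real n" unfolding P_def by (rule sum_part_sizes[OF p])
  have "(\<Sum>i<r. (real (card (P i)) - real n / real r)\<^sup>2)
      = (\<Sum>i<r. (real (card (P i)))\<^sup>2 - 2 * (real n / real r) * real (card (P i)) + (real n / real r)\<^sup>2)"
    by (simp add: power2_diff algebra_simps)
  also have "\<dots> = real (card S) - 2 * (real n / real r) * real n + real r * (real n / real r)\<^sup>2"
    by (simp only: sum.distrib sum_subtractf sum_distrib_left[symmetric] sumP 3) simp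
  also have "\<dots> = real (card S) - (real n)\<^sup>2 / real r" using r by (simp add: field_simps power2_eq_square)
  also have "real (card S) = real (n * n) - real (card C) - real (card (missing_pairs n EG p))" using 2 by simp
  also have "real (card C) = real (card (edge_pairs n EG)) - real (card (same_part_pairs n EG p))" using 1 by simp
  finally show ?thesis unfolding P_def by (simp add: algebra_simps power2_eq_square)
qed

text \<open>\<open>e\<close> is the relative own-part degree from which a vertex is exceptional;
  \<open>\<eta>\<close> is small in terms of it and controls all error terms. Of the two bounds on
  same-part pairs, the first controls part sizes and the second the number of exceptional vertices.
  \<open>cut\<close> is the local optimality of a maximum cut.\<close>

locale near_turan = critical_graph r V E
  for r :: nat and V :: "'a set" and E :: "'a set set" +
  fixes \<epsilon> e \<eta> :: real and n :: nat and EG :: "nat set set" and p :: "nat \<Rightarrow> nat" and q :: real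
  assumes eps: "0 < \<epsilon>" "\<epsilon> < 1" and e: "0 < e" "e \<le> 1 / real r" and eta: "0 < \<eta>"
    and cond_power: "8 * real f * \<eta> \<le> \<epsilon> * e"
    and cond_err: "8 * (real (card pointed_colorings) * (real f)\<^sup>2) * \<eta> \<le> \<epsilon> * e ^ (f - 1)"
    and cond_excess: "2 * (aut * \<beta> * (real r + 2)) * \<eta> \<le> \<epsilon> * e ^ (f - 1)"
    and cond_edge: "(4 * real (card pointed_colorings) * real f + 2 * (real (card pointed_colorings) * (real f)\<^sup>2)) * \<eta> \<le> \<epsilon> * (aut * \<beta>)"
    and cond_e: "2 * (real (card pointed_colorings) * real f) * e \<le> (1 - \<epsilon>) * (aut * \<beta>)"
    and n: "1 \<le> \<eta> * real n"
    and G: "simple_graph {0..<n} EG" and p: "\<And>a. p a < r"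
    and cut: "\<And>x i. x < n \<Longrightarrow> i < r \<Longrightarrow>
      card {a. a < n \<and> p a = p x \<and> {x, a} \<in> EG} \<le> card {a. a < n \<and> p a = i \<and> {x, a} \<in> EG}"
    and edges: "(1 - 1 / real r) * (real n)\<^sup>2 + 2 * q \<le> real (card (edge_pairs n EG))"
    and q: "0 \<le> q"
    and few_bad: "real (card (same_part_pairs n EG p)) \<le> \<eta>\<^sup>2 * (real n)\<^sup>2"
      "real (card (same_part_pairs n EG p)) \<le> e * \<eta> * (real n)\<^sup>2"
begin

definition "bad_rel = same_part_pairs n EG p"
definition "miss_rel = missing_pairs n EG p"
definition "bad x = real (card (bad_rel `` {x}))"
definition "miss x = real (card (miss_rel `` {x}))"
definition "X = {x. x < n \<and> e * real n \<le> bad x}"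
definition "outer = missing_outside n EG p X"

lemma npos: "0 < n"
  using n eta by (cases "n = 0") auto

lemma eta_le_one: "\<eta> \<le> 1" "\<eta> \<le> 1 / real r" "e \<le> 1"
proof -
  have "1 / real r \<le> 1" using r2 by simp
  then show e1: "e \<le> 1" using e by linarith
  have f1: "1 \<le> real f" using f2 by simp
  have "1 * \<eta> \<le> (8 * real f) * \<eta>" using f1 eta by (intro mult_right_mono) auto
  also have "\<dots> \<le> \<epsilon> * e" using cond_power by simp
  also have "\<dots> \<le> 1 * e" using eps e by (intro mult_right_mono) auto
  finally have "\<eta> \<le> e" by simp
  then show "\<eta> \<le> 1" "\<eta> \<le> 1 / real r" using e e1 by linarith+
qed

lemma bad_rel: "finite bad_rel" "sym bad_rel" "(x, x) \<notin> bad_rel"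
  using simple_graphD(4)[OF G, of x x] unfolding bad_rel_def sym_def same_part_pairs_def
  by (auto simp: finite_same_part_pairs[unfolded same_part_pairs_def] insert_commute)

lemma miss_rel: "finite miss_rel" "sym miss_rel"
  unfolding miss_rel_def sym_def missing_pairs_def
  by (auto simp: finite_missing_pairs[unfolded missing_pairs_def] insert_commute)

lemma deviation:
  "(\<Sum>i<r. (real (card {a. a < n \<and> p a = i}) - real n / real r)\<^sup>2) + real (card miss_rel) + 2 * q \<le> real (card bad_rel)"
  using part_deviation[of p r n EG] p r2 edges unfolding bad_rel_def miss_rel_def by simp

lemma card_miss_rel: "real (card miss_rel) + 2 * q \<le> real (card bad_rel)"
proof -
  have "0 \<le> (\<Sum>i<r. (real (card {a. a < n \<and> p a = i}) - real n / real r)\<^sup>2)" by (intro sum_nonneg) auto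
  then show ?thesis using deviation by linarith
qed

lemma part_size:
  assumes "i < r"
  shows "\<bar>real (card {a. a < n \<and> p a = i}) - real n / real r\<bar> \<le> \<eta> * real n"
proof -
  have "(real (card {a. a < n \<and> p a = i}) - real n / real r)\<^sup>2
      \<le> (\<Sum>i<r. (real (card {a. a < n \<and> p a = i}) - real n / real r)\<^sup>2)"
    by (rule member_le_sum) (use assms in auto)
  also have "\<dots> \<le> real (card bad_rel)" using deviation q by linarith
  also have "\<dots> \<le> (\<eta> * real n)\<^sup>2" using few_bad unfolding bad_rel_def by (simp add: power_mult_distrib)
  finally have "\<bar>real (card {a. a < n \<and> p a = i}) - real n / real r\<bar> \<le> \<bar>\<eta> * real n\<bar>"
    by (simp only: abs_le_square_iff)
  then show ?thesis using eta by simp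
qed

lemma finite_X: "finite X" unfolding X_def by auto

lemma card_X: "real (card X) \<le> \<eta> * real n"
proof -
  have "real (card X) * (e * real n) = (\<Sum>x\<in>X. e * real n)" by simp
  also have "\<dots> \<le> (\<Sum>x\<in>X. bad x)" by (rule sum_mono) (auto simp: X_def)
  also have "\<dots> = real (card (Sigma X (\<lambda>x. bad_rel `` {x})))"
    unfolding bad_def using finite_X bad_rel(1) by simp
  also have "\<dots> \<le> real (card bad_rel)"
    by (intro of_nat_mono card_mono bad_rel(1)) auto
  also have "\<dots> \<le> (\<eta> * real n) * (e * real n)"
    using few_bad(2) unfolding bad_rel_def by (simp add: power2_eq_square algebra_simps)
  finally show ?thesis by (rule mult_right_le_imp_le) (use e npos in simp)
qed

lemma error_bound:
  "real (card pointed_colorings) * (real f)\<^sup>2 * (real (card (missing_pairs n EG p)) + real n) / (real n)\<^sup>2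
    \<le> 2 * (real (card pointed_colorings) * (real f)\<^sup>2) * \<eta>"
proof -
  have "real (card (missing_pairs n EG p)) \<le> \<eta>\<^sup>2 * (real n)\<^sup>2"
    using card_miss_rel q few_bad unfolding miss_rel_def bad_rel_def by linarith
  also have "\<dots> \<le> \<eta> * (real n)\<^sup>2"
    using eta eta_le_one by (intro mult_right_mono) (auto simp: power2_eq_square mult_le_cancel_left1)
  finally have 1: "real (card (missing_pairs n EG p)) \<le> \<eta> * (real n)\<^sup>2" .
  have "real n \<le> \<eta> * (real n)\<^sup>2" using mult_right_mono[OF n, of "real n"] by (simp add: power2_eq_square mult.assoc)
  then have "(real (card (missing_pairs n EG p)) + real n) / (real n)\<^sup>2 \<le> 2 * \<eta>"
    using 1 npos by (simp add: pos_divide_le_eq)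
  then have "real (card pointed_colorings) * (real f)\<^sup>2 * ((real (card (missing_pairs n EG p)) + real n) / (real n)\<^sup>2)
     \<le> real (card pointed_colorings) * (real f)\<^sup>2 * (2 * \<eta>)" by (intro mult_left_mono) auto
  then show ?thesis by (simp add: mult_ac)
qed

lemma rest_part_size:
  assumes "i < r"
  shows "1 / real r - 2 * \<eta> \<le> real (card {a. a < n \<and> a \<notin> X \<and> p a = i}) / real n"
proof -
  have "card {a. a < n \<and> p a = i} \<le> card ({a. a < n \<and> a \<notin> X \<and> p a = i} \<union> X)"
    by (rule card_mono) (use finite_X in auto)
  also have "\<dots> \<le> card {a. a < n \<and> a \<notin> X \<and> p a = i} + card X" by (rule card_Un_le)
  finally have "real (card {a. a < n \<and> p a = i}) \<le> real (card {a. a < n \<and> a \<notin> X \<and> p a = i}) + real (card X)" by linarith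
  then have "real n / real r - 2 * \<eta> * real n \<le> real (card {a. a < n \<and> a \<notin> X \<and> p a = i})"
    using part_size[OF assms] card_X by linarith
  then have "(real n / real r - 2 * \<eta> * real n) / real n \<le> real (card {a. a < n \<and> a \<notin> X \<and> p a = i}) / real n"
    by (intro divide_right_mono) auto
  then show ?thesis using npos by (simp add: diff_divide_distrib)
qed

lemma bad_eq: "x < n \<Longrightarrow> bad x = real (card {a. a < n \<and> p a = p x \<and> {x, a} \<in> EG})"
  unfolding bad_def bad_rel_def same_part_pairs_def Image_def by (auto intro: arg_cong[of _ _ card])

lemma miss_eq: "x < n \<Longrightarrow> miss x = real (card {a. a < n \<and> p a \<noteq> p x \<and> {x, a} \<notin> EG})"
  unfolding miss_def miss_rel_def missing_pairs_def Image_def by (auto intro: arg_cong[of _ _ card])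

text \<open>After division by \<open>n\<close> the coordinate sum of the degree vector is about
  \<open>1 - 1/r + (bad x - miss x) / n\<close>, which is the quantity in the linear bound on
  \<open>P_F\<close>.\<close>

lemma degree_eq:
  assumes "x < n"
  shows "(\<Sum>i<r. real (card {a. a < n \<and> p a = i \<and> {x, a} \<in> EG}))
    = real n - real (card {a. a < n \<and> p a = p x}) + bad x - miss x"
proof -
  have "(\<Sum>i<r. card {a. a < n \<and> p a = i \<and> {x, a} \<in> EG}) = (\<Sum>i<r. \<Sum>a\<in>{a \<in> {a. a < n \<and> {x, a} \<in> EG}. p a = i}. 1)"
    by (auto intro!: sum.cong arg_cong[of _ _ card])
  also have "\<dots> = (\<Sum>a\<in>{a. a < n \<and> {x, a} \<in> EG}. 1)" by (rule sum.group) (use p in auto)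
  finally have 1: "(\<Sum>i<r. card {a. a < n \<and> p a = i \<and> {x, a} \<in> EG}) = card {a. a < n \<and> {x, a} \<in> EG}" by simp
  let ?B = "{a. a < n \<and> p a = p x \<and> {x, a} \<in> EG}" and ?M = "{a. a < n \<and> p a \<noteq> p x \<and> {x, a} \<notin> EG}"
  let ?C = "{a. a < n \<and> p a \<noteq> p x \<and> {x, a} \<in> EG}" and ?P = "{a. a < n \<and> p a = p x}"
  have "{a. a < n \<and> {x, a} \<in> EG} = ?B \<union> ?C" by auto
  then have 2: "card {a. a < n \<and> {x, a} \<in> EG} = card ?B + card ?C" by (simp only:, intro card_Un_disjoint) auto
  have "{..<n} = ?P \<union> (?C \<union> ?M)" by auto
  then have "card {..<n} = card (?P \<union> (?C \<union> ?M))" by simp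
  also have "\<dots> = card ?P + card (?C \<union> ?M)" by (rule card_Un_disjoint) auto
  also have "card (?C \<union> ?M) = card ?C + card ?M" by (rule card_Un_disjoint) auto
  finally have 3: "n = card ?P + (card ?C + card ?M)" by simp
  have "real (\<Sum>i<r. card {a. a < n \<and> p a = i \<and> {x, a} \<in> EG}) = real (card ?B) + real (card ?C)" unfolding 1 2 by simp
  moreover have "real n = real (card ?P + (card ?C + card ?M))" by (rule arg_cong[OF 3])
  then have "real n = real (card ?P) + (real (card ?C) + real (card ?M))" by (simp only: of_nat_add)
  ultimately show ?thesis unfolding bad_eq[OF assms] miss_eq[OF assms] by simp
qed

text \<open>By the cut condition an exceptional vertex has at least \<open>e * n\<close> neighbours
  in every part, so \<open>P_F\<close> at its degree vector is bounded below and additive errors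
  become small fractions of it, even when \<open>bad x - miss x\<close> is small or negative. The
  summand \<open>card X\<close> is affordable because it is at most \<open>\<eta> * n\<close>; it is
  there to offset pairs inside \<open>X\<close> later.\<close>

lemma vertex_count:
  assumes x: "x \<in> X"
  shows "real n ^ (f - 2) * ((1 - \<epsilon>) * (aut * \<beta>) * (bad x - miss x + real (card X)))
    \<le> real (card {\<phi> \<in> embeddings V E n EG. \<phi> ` V \<inter> X = {x}})"
proof -
  have xn: "x < n" using x unfolding X_def by simp
  define dg where "dg i = real (card {a. a < n \<and> p a = i \<and> {x, a} \<in> EG})" for i
  \<comment> \<open>Parts may slightly exceed \<open>n / r\<close>; truncation keeps
    \<open>\<xi>\<close> in the box on which \<open>\<beta>\<close> bounds
    \<open>P_F\<close>.\<close>
  define \<xi> where "\<xi> i = min (1 / real r) (dg i / real n)" for i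
  \<comment> \<open>One factor covers all losses: \<open>\<eta>\<close>, lost with \<open>X\<close>,
    is at most the fraction \<open>\<eta> / e\<close> of a coordinate, and
    \<open>2 * \<eta>\<close>, lost from a part, is at most the fraction
    \<open>2 * \<eta> / e\<close> of \<open>1 / r\<close>. Being common to all vertices, it leaves
    \<open>k ^ (f - 1)\<close> times \<open>aut * P_F\<close>.\<close>
  define k where "k = 1 - 2 * \<eta> / e"
  have k: "0 \<le> k"
  proof -
    have "1 * (2 * \<eta>) \<le> real f * (8 * \<eta>)" using f2 eta by (intro mult_mono) auto
    also have "\<dots> \<le> \<epsilon> * e" using cond_power by (simp add: mult_ac)
    also have "\<dots> \<le> 1 * e" using eps e by (intro mult_right_mono) auto
    finally show ?thesis unfolding k_def using e by simp
  qed
  have dge: "e * real n \<le> dg i" if "i < r" for i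
  proof -
    have "e * real n \<le> bad x" using x unfolding X_def by simp
    also have "\<dots> \<le> dg i" unfolding bad_eq[OF xn] dg_def using cut[OF xn that] by simp
    finally show ?thesis .
  qed
  have xie: "e \<le> \<xi> i" if "i < r" for i
    using dge[OF that] e npos unfolding \<xi>_def by (simp add: pos_le_divide_eq)
  have xi0: "0 \<le> \<xi> i" if "i < r" for i using xie[OF that] e by linarith
  have xi1: "\<xi> i \<le> 1 / real r" for i unfolding \<xi>_def by simp
  have kr: "0 \<le> k / real r" "k / real r \<le> 1 / real r - 2 * \<eta>"
  proof -
    show "0 \<le> k / real r" using k by simp
    have "e * real r \<le> 1" using e r2 by (simp add: field_simps)
    then have "2 * \<eta> * (e * real r) \<le> 2 * \<eta> * 1" using eta by (intro mult_left_mono) auto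
    moreover have "0 < e * real r" using e r2 by simp
    ultimately have "2 * \<eta> \<le> 2 * \<eta> / (e * real r)" by (simp add: pos_le_divide_eq)
    moreover have "k / real r = 1 / real r - 2 * \<eta> / (e * real r)" unfolding k_def by (simp add: diff_divide_distrib)
    ultimately show "k / real r \<le> 1 / real r - 2 * \<eta>" by linarith
  qed
  have zeta: "k * \<xi> i \<le> real (card {a. a < n \<and> a \<notin> X \<and> p a = i \<and> {x, a} \<in> EG}) / real n" if i: "i < r" for i
  proof -
    have "card {a. a < n \<and> p a = i \<and> {x, a} \<in> EG} \<le> card ({a. a < n \<and> a \<notin> X \<and> p a = i \<and> {x, a} \<in> EG} \<union> X)"
      by (rule card_mono) (use finite_X in auto)
    also have "\<dots> \<le> card {a. a < n \<and> a \<notin> X \<and> p a = i \<and> {x, a} \<in> EG} + card X" by (rule card_Un_le)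
    finally have "dg i - \<eta> * real n \<le> real (card {a. a < n \<and> a \<notin> X \<and> p a = i \<and> {x, a} \<in> EG})"
      using card_X unfolding dg_def by linarith
    then have "(dg i - \<eta> * real n) / real n \<le> real (card {a. a < n \<and> a \<notin> X \<and> p a = i \<and> {x, a} \<in> EG}) / real n"
      by (intro divide_right_mono) auto
    then have "dg i / real n - \<eta> \<le> real (card {a. a < n \<and> a \<notin> X \<and> p a = i \<and> {x, a} \<in> EG}) / real n"
      using npos by (simp add: diff_divide_distrib)
    moreover have "\<xi> i \<le> dg i / real n" unfolding \<xi>_def by simp
    moreover have "k * \<xi> i \<le> \<xi> i - \<eta>"
    proof -
      have "\<eta> * e \<le> 2 * \<eta> * \<xi> i" using mult_left_mono[OF xie[OF i], of \<eta>] mult_nonneg_nonneg[of \<eta> "\<xi> i"] eta xi0[OF i] by linarith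
      then have "\<eta> \<le> 2 * \<eta> * \<xi> i / e" using e by (simp add: pos_le_divide_eq)
      then show ?thesis unfolding k_def by (simp add: left_diff_distrib)
    qed
    ultimately show ?thesis by linarith
  qed
  define err where "err = real (card pointed_colorings) * (real f)\<^sup>2 * (real (card (missing_pairs n EG p)) + real n) / (real n)\<^sup>2"
  have count: "real n ^ (f - 1) * ((\<Sum>(u, c)\<in>pointed_colorings. \<Prod>v\<in>V - {u}. if {u, v} \<in> E then k * \<xi> (c v) else k / real r) - err)
    \<le> real (card {\<phi> \<in> embeddings V E n EG. \<phi> ` V \<inter> X = {x}})"
    unfolding err_def
    by (rule embeddings_through_vertex[OF x xn npos kr(1)])
      (use rest_part_size kr(2) zeta k xi0 in \<open>auto intro: order.trans mult_nonneg_nonneg\<close>)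
  have prod_eq: "(\<Prod>v\<in>V - {u}. if {u, v} \<in> E then k * \<xi> (c v) else k / real r) = k ^ (f - 1) * coloring_weight r V E \<xi> u c"
    if "u \<in> V" for u c
  proof -
    have "(\<Prod>v\<in>V - {u}. if {u, v} \<in> E then k * \<xi> (c v) else k / real r)
        = (\<Prod>v\<in>V - {u}. k * (if {u, v} \<in> E then \<xi> (c v) else 1 / real r))" by (rule prod.cong) auto
    also have "\<dots> = (\<Prod>v\<in>V - {u}. k) * coloring_weight r V E \<xi> u c"
      unfolding coloring_weight_def by (rule prod.distrib)
    finally show ?thesis using fV that by simp
  qed
  have "(\<Sum>(u, c)\<in>pointed_colorings. \<Prod>v\<in>V - {u}. if {u, v} \<in> E then k * \<xi> (c v) else k / real r)
      = (\<Sum>q\<in>pointed_colorings. k ^ (f - 1) * (case q of (u, c) \<Rightarrow> coloring_weight r V E \<xi> u c))"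
    by (rule sum.cong) (auto simp: prod_eq)
  also have "\<dots> = k ^ (f - 1) * (aut * P_F r V E \<xi>)" unfolding aut_P_F by (simp only: sum_distrib_left)
  finally have sum_eq: "(\<Sum>(u, c)\<in>pointed_colorings. \<Prod>v\<in>V - {u}. if {u, v} \<in> E then k * \<xi> (c v) else k / real r)
    = k ^ (f - 1) * (aut * P_F r V E \<xi>)" .
  define Q where "Q = aut * P_F r V E \<xi>"
  obtain u c v where uc: "u \<in> V" "c \<in> colorings_u r V E u" by (rule some_pointed_coloring)
  have "e ^ (f - 1) = (\<Prod>v\<in>V - {u}. e)" using fV uc by simp
  also have "\<dots> \<le> coloring_weight r V E \<xi> u c"
    unfolding coloring_weight_def
    by (rule prod_mono) (use e xie colorings_uD(1)[OF uc(2)] in auto)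
  also have "\<dots> \<le> Q" unfolding Q_def by (rule coloring_weight_le_aut_P_F) (use uc xi0 in auto)
  finally have Qe: "e ^ (f - 1) \<le> Q" .
  have e0: "0 < e ^ (f - 1)" using e by simp
  have Q0: "0 \<le> Q" using Qe e0 by linarith
  have "1 + real (f - 1) * (- (2 * \<eta> / e)) \<le> (1 + (- (2 * \<eta> / e))) ^ (f - 1)"
    by (rule Bernoulli_inequality) (use k in \<open>simp add: k_def\<close>)
  moreover have "real (f - 1) * (2 * \<eta> / e) \<le> \<epsilon> / 4"
  proof -
    have "real (f - 1) * (2 * \<eta>) \<le> real f * (2 * \<eta>)" using eta by (intro mult_right_mono) auto
    then have "real (f - 1) * (2 * \<eta>) \<le> \<epsilon> / 4 * e" using cond_power by (simp add: algebra_simps)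
    then show ?thesis using e by (simp add: pos_divide_le_eq)
  qed
  ultimately have kp: "1 - \<epsilon> / 4 \<le> k ^ (f - 1)" unfolding k_def by simp
  have errQ: "err \<le> \<epsilon> / 4 * Q"
  proof -
    have "err \<le> 2 * (real (card pointed_colorings) * (real f)\<^sup>2) * \<eta>" unfolding err_def by (rule error_bound)
    also have "\<dots> \<le> \<epsilon> / 4 * e ^ (f - 1)" using cond_err by (simp add: algebra_simps)
    also have "\<dots> \<le> \<epsilon> / 4 * Q" using Qe eps by (intro mult_left_mono) auto
    finally show ?thesis .
  qed
  have "(1 - \<epsilon> / 2) * Q \<le> k ^ (f - 1) * Q - err"
    using mult_right_mono[OF kp Q0] errQ by (simp add: algebra_simps)
  then have "real n ^ (f - 1) * ((1 - \<epsilon> / 2) * Q) \<le> real n ^ (f - 1) * (k ^ (f - 1) * Q - err)"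
    by (intro mult_left_mono) auto
  also have "\<dots> \<le> real (card {\<phi> \<in> embeddings V E n EG. \<phi> ` V \<inter> X = {x}})"
    using count unfolding sum_eq Q_def .
  finally have 1: "real n ^ (f - 1) * ((1 - \<epsilon> / 2) * Q) \<le> real (card {\<phi> \<in> embeddings V E n EG. \<phi> ` V \<inter> X = {x}})" .
  define D where "D = (bad x - miss x) / real n"
  have Dn: "D * real n = bad x - miss x" unfolding D_def using npos by simp
  \<comment> \<open>Truncating the \<open>r\<close> coordinates costs \<open>\<eta>\<close> each,
    and the size of the part of \<open>x\<close> costs one more.\<close>
  have sum_xi: "D - (real r + 1) * \<eta> \<le> (\<Sum>i<r. \<xi> i) - (1 - 1 / real r)"
  proof -
    have "(\<Sum>i<r. dg i / real n - \<eta>) \<le> (\<Sum>i<r. \<xi> i)"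
    proof (rule sum_mono)
      fix i assume "i \<in> {..<r}"
      then have i: "i < r" by simp
      have "dg i \<le> real (card {a. a < n \<and> p a = i})" unfolding dg_def by (intro of_nat_mono card_mono) auto
      then have "dg i \<le> real n / real r + \<eta> * real n" using part_size[OF i] by linarith
      then have "dg i / real n \<le> (real n / real r + \<eta> * real n) / real n" by (intro divide_right_mono) auto
      then have "dg i / real n - \<eta> \<le> 1 / real r" using npos by (simp add: add_divide_distrib)
      then show "dg i / real n - \<eta> \<le> \<xi> i" unfolding \<xi>_def using eta by simp
    qed
    moreover have "(\<Sum>i<r. dg i / real n - \<eta>) = (\<Sum>i<r. dg i) / real n - real r * \<eta>"
      by (simp add: sum_subtractf sum_divide_distrib)
    moreover have "(\<Sum>i<r. dg i) / real n \<ge> (1 - 1 / real r) - \<eta> + D"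
    proof -
      have "real n - (real n / real r + \<eta> * real n) + bad x - miss x \<le> (\<Sum>i<r. dg i)"
        unfolding dg_def degree_eq[OF xn] using part_size[OF p, of x] by linarith
      moreover have "real n - (real n / real r + \<eta> * real n) + bad x - miss x = ((1 - 1 / real r) - \<eta> + D) * real n"
        using Dn by (simp add: left_diff_distrib distrib_right)
      ultimately show ?thesis using npos by (simp add: pos_le_divide_eq)
    qed
    ultimately show ?thesis by (simp add: algebra_simps)
  qed
  have aut\<beta>: "0 < aut * \<beta>" using aut_pos beta_pos by simp
  have QD: "aut * \<beta> * (D - (real r + 1) * \<eta>) \<le> Q"
  \<comment> \<open>Outside the range in which \<open>\<beta>\<close> gives a bound, the left side
    is not positive.\<close>
  proof (cases "1 - 1 / real r < (\<Sum>i<r. \<xi> i)")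
    case True
    have "\<beta> * (D - (real r + 1) * \<eta>) \<le> \<beta> * ((\<Sum>i<r. \<xi> i) - (1 - 1 / real r))"
      using sum_xi beta_pos by (intro mult_left_mono) auto
    also have "\<dots> \<le> P_F r V E \<xi>" by (rule beta_F_mult_le) (use r2 xi0 xi1 True in auto)
    finally show ?thesis unfolding Q_def using aut_pos by simp
  next
    case False
    then have "D - (real r + 1) * \<eta> \<le> 0" using sum_xi by linarith
    then have "aut * \<beta> * (D - (real r + 1) * \<eta>) \<le> 0" using aut\<beta> by (simp add: mult_nonneg_nonpos)
    then show ?thesis using Q0 by linarith
  qed
  \<comment> \<open>\<open>r + 2\<close> instead of \<open>r + 1\<close>: the additional
    \<open>\<eta>\<close> makes room for \<open>card X / n\<close>.\<close>
  define w where "w = aut * \<beta> * (real r + 2) * \<eta>"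
  have w: "w \<le> \<epsilon> / 2 * Q"
  proof -
    have "2 * w \<le> \<epsilon> * e ^ (f - 1)" unfolding w_def using cond_excess by (simp add: algebra_simps)
    also have "\<dots> \<le> \<epsilon> * Q" using Qe eps by (intro mult_left_mono) auto
    finally show ?thesis by simp
  qed
  have w0: "0 \<le> w" unfolding w_def using aut\<beta> eta by simp
  have Dz: "aut * \<beta> * (D + \<eta>) - w \<le> Q" using QD unfolding w_def by (simp add: algebra_simps)
  have "(1 - \<epsilon>) * (aut * \<beta> * (D + \<eta>)) \<le> (1 - \<epsilon>) * (Q + w)"
    using Dz eps by (intro mult_left_mono) auto
  also have "\<dots> \<le> (1 - \<epsilon>) * Q + w" using eps w0 mult_nonneg_nonneg[of \<epsilon> w] by (simp add: algebra_simps)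
  also have "\<dots> \<le> (1 - \<epsilon> / 2) * Q" using w by (simp add: algebra_simps)
  finally have 2: "(1 - \<epsilon>) * (aut * \<beta>) * (D + \<eta>) \<le> (1 - \<epsilon> / 2) * Q" by (simp add: mult.assoc)
  have "bad x - miss x + real (card X) \<le> real n * (D + \<eta>)"
    using card_X Dn by (simp add: distrib_left mult.commute)
  then have "(1 - \<epsilon>) * (aut * \<beta>) * (bad x - miss x + real (card X)) \<le> (1 - \<epsilon>) * (aut * \<beta>) * (real n * (D + \<eta>))"
    using aut\<beta> eps by (intro mult_left_mono) auto
  also have "\<dots> = real n * ((1 - \<epsilon>) * (aut * \<beta>) * (D + \<eta>))" by (simp only: mult_ac)
  also have "\<dots> \<le> real n * ((1 - \<epsilon> / 2) * Q)" by (intro mult_left_mono 2) auto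
  finally have "real n ^ (f - 2) * ((1 - \<epsilon>) * (aut * \<beta>) * (bad x - miss x + real (card X))) \<le> real n ^ (f - 2) * (real n * ((1 - \<epsilon> / 2) * Q))"
    by (intro mult_left_mono) auto
  also have "\<dots> = real n ^ Suc (f - 2) * ((1 - \<epsilon> / 2) * Q)" by simp
  also have "Suc (f - 2) = f - 1" using f2 by simp
  finally show ?thesis using 1 by linarith
qed

text \<open>\<open>aut_beta_le\<close> supplies the main term. Slots shrink with the number of cross
  neighbours that \<open>x\<close> and \<open>y\<close> miss, and \<open>power_diff_ge\<close> makes
  the resulting loss linear in that number, which lets it be summed over edges.\<close>

lemma edge_count:
  assumes xy: "(x, y) \<in> bad_rel" "x \<notin> X" "y \<notin> X"
  shows "real n ^ (f - 2) * ((1 - \<epsilon>) * (aut * \<beta>)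
      - real (card pointed_colorings) * real f * ((real (card (outer x)) + real (card (outer y))) / real n))
    \<le> real (card {\<phi> \<in> embeddings V E n EG. \<phi> ` V \<inter> X = {} \<and> monochromatic_pairs p \<phi> = {(x, y), (y, x)}})"
proof -
  have xy': "{x, y} \<in> EG" "p x = p x" "p y = p x" using xy unfolding bad_rel_def same_part_pairs_def by auto
  \<comment> \<open>The summands stand for unequal parts and the removal of \<open>X\<close>, for
    missing cross pairs at \<open>x\<close> and \<open>y\<close>, and for \<open>x\<close> and
    \<open>y\<close> themselves. The middle one may exceed \<open>1 / r\<close>, hence the
    truncation in \<open>\<tau>\<close>.\<close>
  define t where "t = 2 * \<eta> + (real (card (outer x)) + real (card (outer y))) / real n + 2 / real n"
  define \<tau> where "\<tau> = max 0 (1 / real r - t)"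
  define C1 where "C1 = real (card pointed_colorings)"
  define err where "err = real (card pointed_colorings) * (real f)\<^sup>2 * (real (card (missing_pairs n EG p)) + real n) / (real n)\<^sup>2"
  have t0: "0 \<le> t" unfolding t_def using eta by simp
  have \<tau>: "\<tau> \<le> real (card (edge_slots n EG p X x y u v c w)) / real n"
    if uc: "u \<in> V" and c: "c \<in> colorings_u r V E u" and s: "single_nbr V E u c (p x) v" and w: "w \<in> V - {u, v}" for u c v w
  proof -
    have "c w < r" using colorings_uD(1)[OF c] w by auto
    from rest_part_size[OF this] have "1 / real r - 2 * \<eta> \<le> real (card {a. a < n \<and> a \<notin> X \<and> p a = c w}) / real n" .
    moreover have "(real (card {a. a < n \<and> a \<notin> X \<and> p a = c w}) - real (card (outer x)) - real (card (outer y)) - 2) / real n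
        \<le> real (card (edge_slots n EG p X x y u v c w)) / real n"
      unfolding outer_def by (rule divide_right_mono, rule card_edge_slots[where i = "p x"]) (use c s w xy' in auto)
    ultimately show ?thesis unfolding \<tau>_def t_def by (simp add: diff_divide_distrib add_divide_distrib)
  qed
  have "real n ^ (f - 2) * (real (card (critical_pairs (p x))) * \<tau> ^ (f - 2) - err)
    \<le> real (card {\<phi> \<in> embeddings V E n EG. \<phi> ` V \<inter> X = {} \<and> monochromatic_pairs p \<phi> = {(x, y), (y, x)}})"
    unfolding err_def
    by (rule embeddings_through_edge[OF G xy'(1) xy(2,3) xy'(2,3) npos _ \<tau>]) (auto simp: \<tau>_def)
  moreover have "(1 - \<epsilon>) * (aut * \<beta>)
      - C1 * real f * ((real (card (outer x)) + real (card (outer y))) / real n)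
      \<le> real (card (critical_pairs (p x))) * \<tau> ^ (f - 2) - err"
  proof -
    have cp: "real (card (critical_pairs (p x))) \<le> C1"
      unfolding C1_def using card_mono[OF finite_pointed_colorings critical_pairs_subset] by simp
    have "(1 / real r) ^ (f - 2) - real (f - 2) * t \<le> \<tau> ^ (f - 2)"
      unfolding \<tau>_def by (rule power_diff_ge) (use t0 r2 in auto)
    then have "real (card (critical_pairs (p x))) * ((1 / real r) ^ (f - 2) - real (f - 2) * t) \<le> real (card (critical_pairs (p x))) * \<tau> ^ (f - 2)"
      by (intro mult_left_mono) auto
    then have "real (card (critical_pairs (p x))) * (1 / real r) ^ (f - 2) - real (card (critical_pairs (p x))) * (real (f - 2) * t) \<le> real (card (critical_pairs (p x))) * \<tau> ^ (f - 2)"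
      by (simp only: right_diff_distrib)
    moreover have "real (card (critical_pairs (p x))) * (real (f - 2) * t) \<le> C1 * (real f * t)"
      using cp t0 by (intro mult_mono mult_right_mono) auto
    ultimately have 1: "aut * \<beta> - C1 * (real f * t) \<le> real (card (critical_pairs (p x))) * \<tau> ^ (f - 2)"
      using aut_beta_le[OF p, of x] by linarith
    have "C1 * (real f * t) = C1 * real f * ((real (card (outer x)) + real (card (outer y))) / real n) + C1 * real f * (2 * \<eta> + 2 / real n)"
      unfolding t_def by (simp add: algebra_simps)
    moreover have "C1 * real f * (2 * \<eta> + 2 / real n) \<le> C1 * real f * (4 * \<eta>)"
      using n npos by (intro mult_left_mono) (auto simp: field_simps C1_def)
    moreover have "err \<le> 2 * (C1 * (real f)\<^sup>2) * \<eta>" unfolding err_def C1_def by (rule error_bound)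
    moreover have "C1 * real f * (4 * \<eta>) + 2 * (C1 * (real f)\<^sup>2) * \<eta> \<le> \<epsilon> * (aut * \<beta>)"
      using cond_edge unfolding C1_def by (simp add: algebra_simps)
    ultimately show ?thesis using 1 by (simp add: algebra_simps)
  qed
  then have "real n ^ (f - 2) * ((1 - \<epsilon>) * (aut * \<beta>)
      - C1 * real f * ((real (card (outer x)) + real (card (outer y))) / real n))
      \<le> real n ^ (f - 2) * (real (card (critical_pairs (p x))) * \<tau> ^ (f - 2) - err)"
    by (intro mult_left_mono) auto
  ultimately show ?thesis unfolding C1_def by linarith
qed

end

section \<open>The lower bound\<close>

context near_turan begin

text \<open>Losses at ordinary edges are charged to the missing pairs \<open>ms\<close> outside
  \<open>X\<close>. They are paid by the term \<open>card ms / 2\<close> in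
  \<open>q + card ms / 2 \<le> SX + card L\<close>, where the summand \<open>card X\<close> from
  \<open>vertex_count\<close> makes up for missing pairs inside \<open>X\<close>.\<close>

lemma embeddings_count:
  "real n ^ (f - 2) * ((1 - \<epsilon>) * (aut * \<beta>) * q) \<le> real (card (embeddings V E n EG))"
proof -
  define \<kappa> where "\<kappa> = (1 - \<epsilon>) * (aut * \<beta>)"
  define C where "C = real (card pointed_colorings) * real f"
  define bs where "bs = bad_rel \<inter> (- X) \<times> (- X)"
  define ms where "ms = miss_rel \<inter> (- X) \<times> (- X)"
  \<comment> \<open>One orientation per same-part edge is right, since critical pairs already
    contain both orientations of the edge of \<open>F\<close>.\<close>
  define L where "L = {(x, y) \<in> bs. x < y}"
  define DX where "DX x = {\<phi> \<in> embeddings V E n EG. \<phi> ` V \<inter> X = {x}}" for x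
  define DE where "DE = (\<lambda>(x, y). {\<phi> \<in> embeddings V E n EG. \<phi> ` V \<inter> X = {} \<and> monochromatic_pairs p \<phi> = {(x, y), (y, x)}})"
  define W where "W = {x. x < n \<and> x \<notin> X}"
  have \<kappa>0: "0 \<le> \<kappa>" unfolding \<kappa>_def using eps aut_pos beta_pos by simp
  have C0: "0 \<le> C" unfolding C_def by simp
  have femb: "finite (embeddings V E n EG)" by (rule finite_embeddings[OF fV])
  have fbs: "finite bs" "sym bs" "\<And>x. (x, x) \<notin> bs"
    using bad_rel unfolding bs_def sym_def by auto
  have fL: "finite L" unfolding L_def using fbs(1) by (auto intro: finite_subset[of _ bs])
  have fDX: "finite (DX x)" for x unfolding DX_def using femb by auto
  have fDE: "finite (DE xy)" for xy unfolding DE_def using femb by (auto split: prod.splits)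
  have cDX: "card (\<Union>x\<in>X. DX x) = (\<Sum>x\<in>X. card (DX x))"
    by (rule card_UN_disjoint) (use finite_X fDX in \<open>auto simp: DX_def\<close>)
  have cDE: "card (\<Union>xy\<in>L. DE xy) = (\<Sum>xy\<in>L. card (DE xy))"
  proof (rule card_UN_disjoint[OF fL])
    show "\<forall>a\<in>L. \<forall>b\<in>L. a \<noteq> b \<longrightarrow> DE a \<inter> DE b = {}"
    proof (intro ballI impI, rule ccontr)
      fix a b assume ab: "a \<in> L" "b \<in> L" "a \<noteq> b" "DE a \<inter> DE b \<noteq> {}"
      obtain x y x' y' where xy: "a = (x, y)" "b = (x', y')" by (cases a, cases b)
      then have "{(x, y), (y, x)} = {(x', y'), (y', x')}" using ab(4) unfolding DE_def by auto
      moreover have "x < y" "x' < y'" using ab xy unfolding L_def by auto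
      ultimately show False using ab(3) xy by (auto simp: doubleton_eq_iff)
    qed
  qed (use fDE in auto)
  have "card (\<Union>x\<in>X. DX x) + card (\<Union>xy\<in>L. DE xy) = card ((\<Union>x\<in>X. DX x) \<union> (\<Union>xy\<in>L. DE xy))"
    by (rule card_Un_disjoint[symmetric]) (use finite_X fL fDX fDE in \<open>auto simp: DX_def DE_def\<close>)
  also have "\<dots> \<le> card (embeddings V E n EG)"
    by (rule card_mono[OF femb]) (auto simp: DX_def DE_def)
  finally have "(\<Sum>x\<in>X. card (DX x)) + (\<Sum>xy\<in>L. card (DE xy)) \<le> card (embeddings V E n EG)"
    unfolding cDX cDE .
  then have "real ((\<Sum>x\<in>X. card (DX x)) + (\<Sum>xy\<in>L. card (DE xy))) \<le> real (card (embeddings V E n EG))"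
    by (simp only: of_nat_le_iff)
  then have 1: "(\<Sum>x\<in>X. real (card (DX x))) + (\<Sum>xy\<in>L. real (card (DE xy))) \<le> real (card (embeddings V E n EG))"
    by simp
  have sX: "(\<Sum>x\<in>X. real n ^ (f - 2) * (\<kappa> * (bad x - miss x + real (card X)))) \<le> (\<Sum>x\<in>X. real (card (DX x)))"
    unfolding DX_def \<kappa>_def by (rule sum_mono[OF vertex_count])
  have sL: "(\<Sum>(x, y)\<in>L. real n ^ (f - 2) * (\<kappa> - C / real n * (real (card (outer x)) + real (card (outer y)))))
      \<le> (\<Sum>xy\<in>L. real (card (DE xy)))"
  proof (rule sum_mono)
    fix xy assume "xy \<in> L"
    then obtain x y where xy: "xy = (x, y)" "(x, y) \<in> bad_rel" "x \<notin> X" "y \<notin> X"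
      unfolding L_def bs_def by auto
    show "(case xy of (x, y) \<Rightarrow> real n ^ (f - 2) * (\<kappa> - C / real n * (real (card (outer x)) + real (card (outer y)))))
        \<le> real (card (DE xy))"
      using edge_count[OF xy(2-4)] xy(1) unfolding DE_def \<kappa>_def C_def by simp
  qed
  define SX where "SX = (\<Sum>x\<in>X. bad x - miss x + real (card X))"
  define SO where "SO = (\<Sum>(x, y)\<in>L. real (card (outer x)) + real (card (outer y)))"
  have sX': "(\<Sum>x\<in>X. real n ^ (f - 2) * (\<kappa> * (bad x - miss x + real (card X)))) = real n ^ (f - 2) * (\<kappa> * SX)"
    unfolding SX_def by (simp only: sum_distrib_left)
  have "(\<Sum>(x, y)\<in>L. real n ^ (f - 2) * (\<kappa> - C / real n * (real (card (outer x)) + real (card (outer y)))))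
      = real n ^ (f - 2) * (\<Sum>xy\<in>L. \<kappa> - C / real n * (case xy of (x, y) \<Rightarrow> real (card (outer x)) + real (card (outer y))))"
    by (simp add: sum_distrib_left split_def)
  also have "\<dots> = real n ^ (f - 2) * (\<kappa> * real (card L) - C / real n * SO)"
    unfolding SO_def by (simp add: sum_subtractf sum_distrib_left)
  finally have sL': "(\<Sum>(x, y)\<in>L. real n ^ (f - 2) * (\<kappa> - C / real n * (real (card (outer x)) + real (card (outer y)))))
      = real n ^ (f - 2) * (\<kappa> * real (card L) - C / real n * SO)" .
  have 2: "real n ^ (f - 2) * (\<kappa> * SX + (\<kappa> * real (card L) - C / real n * SO)) \<le> real (card (embeddings V E n EG))"
    using 1 sX sL unfolding sX' sL' by (simp add: distrib_left)
  have "(\<Sum>(x, y)\<in>bs. 1 :: real) = (\<Sum>(x, y)\<in>L. 1 + 1)"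
    unfolding L_def by (rule sum_sym_rel_less[OF fbs])
  then have cL: "real (card bs) = 2 * real (card L)" by simp
  have "SO = (\<Sum>(x, y)\<in>bs. real (card (outer x)))"
    unfolding SO_def L_def by (rule sum_sym_rel_less[OF fbs, symmetric])
  also have "bs = Sigma W (\<lambda>x. bs `` {x})"
    unfolding bs_def W_def bad_rel_def same_part_pairs_def by auto
  also have "(\<Sum>(x, y)\<in>Sigma W (\<lambda>x. bs `` {x}). real (card (outer x))) = (\<Sum>x\<in>W. \<Sum>y\<in>bs `` {x}. real (card (outer x)))"
    by (rule sum.Sigma[symmetric]) (use fbs in \<open>auto simp: W_def\<close>)
  \<comment> \<open>A vertex outside \<open>X\<close> lies on at most \<open>e * n\<close> same-part
    edges, so each missing pair starting there is charged at most that often.\<close>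
  also have "\<dots> \<le> (\<Sum>x\<in>W. e * real n * real (card (outer x)))"
  proof (rule sum_mono)
    fix x assume x: "x \<in> W"
    have "real (card (bs `` {x})) \<le> bad x"
      unfolding bad_def by (intro of_nat_mono card_mono finite_Image bad_rel(1)) (auto simp: bs_def)
    also have "\<dots> \<le> e * real n" using x unfolding W_def X_def by auto
    finally show "(\<Sum>y\<in>bs `` {x}. real (card (outer x))) \<le> e * real n * real (card (outer x))"
      by (simp add: mult_right_mono)
  qed
  also have "\<dots> = e * real n * (\<Sum>x\<in>W. real (card (outer x)))" by (simp only: sum_distrib_left)
  also have "(\<Sum>x\<in>W. real (card (outer x))) = real (card (Sigma W outer))"
    by (simp add: W_def outer_def missing_outside_def)
  also have "Sigma W outer = ms"
    unfolding ms_def W_def outer_def missing_outside_def miss_rel_def missing_pairs_def by auto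
  finally have SO: "SO \<le> e * real n * real (card ms)" .
  have "C / real n * SO \<le> C / real n * (e * real n * real (card ms))"
    using C0 SO by (intro mult_left_mono) auto
  also have "\<dots> = C * e * real (card ms)" using npos by simp
  also have "\<dots> \<le> \<kappa> / 2 * real (card ms)"
    using cond_e unfolding C_def \<kappa>_def by (intro mult_right_mono) auto
  finally have CSO: "C / real n * SO \<le> \<kappa> / 2 * real (card ms)" .
  have b: "real (card bad_rel) \<le> 2 * (\<Sum>x\<in>X. bad x) + real (card bs)"
  proof -
    have "real (card bad_rel) \<le> real (2 * (\<Sum>x\<in>X. card (bad_rel `` {x})) + card bs)"
      unfolding bs_def by (intro of_nat_mono card_sym_rel_le bad_rel finite_X)
    then show ?thesis unfolding bad_def by simp
  qed
  have m: "2 * (\<Sum>x\<in>X. miss x) + real (card ms) \<le> real (card miss_rel) + real (card X) * real (card X)"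
  proof -
    have "real (2 * (\<Sum>x\<in>X. card (miss_rel `` {x})) + card ms) \<le> real (card miss_rel + card X * card X)"
      unfolding ms_def by (intro of_nat_mono card_sym_rel_le miss_rel finite_X)
    then show ?thesis unfolding miss_def by simp
  qed
  have "SX = (\<Sum>x\<in>X. bad x) - (\<Sum>x\<in>X. miss x) + real (card X) * real (card X)"
    unfolding SX_def by (simp add: sum.distrib sum_subtractf)
  moreover have XX: "0 \<le> real (card X) * real (card X)" by simp
  \<comment> \<open>Summing \<open>miss\<close> over \<open>X\<close> counts missing pairs inside
    \<open>X\<close> twice, an overshoot of at most \<open>card X * card X\<close>;
    \<open>2 * SX\<close> contains that amount twice.\<close>
  ultimately have "q + real (card ms) / 2 \<le> SX + real (card L)"
    using b m cL card_miss_rel XX by linarith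
  then have "\<kappa> * (q + real (card ms) / 2) \<le> \<kappa> * (SX + real (card L))" using \<kappa>0 by (rule mult_left_mono)
  then have "\<kappa> * q \<le> \<kappa> * SX + (\<kappa> * real (card L) - C / real n * SO)"
  proof -
    have "\<kappa> * (q + real (card ms) / 2) = \<kappa> * q + \<kappa> / 2 * real (card ms)" "\<kappa> * (SX + real (card L)) = \<kappa> * SX + \<kappa> * real (card L)"
      by (simp_all add: distrib_left)
    then show ?thesis using CSO \<open>\<kappa> * (q + real (card ms) / 2) \<le> \<kappa> * (SX + real (card L))\<close> by linarith
  qed
  then have "real n ^ (f - 2) * (\<kappa> * q) \<le> real n ^ (f - 2) * (\<kappa> * SX + (\<kappa> * real (card L) - C / real n * SO))"
    by (intro mult_left_mono) auto
  then show ?thesis using 2 unfolding \<kappa>_def by linarith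
qed

end

section \<open>Maximum cuts and the choice of constants\<close>

lemma same_part_pairs_sym: "sym (same_part_pairs n EG p)"
  unfolding same_part_pairs_def sym_def by (auto simp: insert_commute)

text \<open>A partition with the fewest same-part pairs. Moving \<open>x\<close> to part
  \<open>i\<close> affects only pairs at \<open>x\<close>, so a vertex with more neighbours in its
  own part than in part \<open>i\<close> would contradict minimality.\<close>

lemma exists_max_cut:
  assumes G: "simple_graph {0..<n} EG" and p0: "\<And>a. p0 a < r"
  obtains p where "\<And>a. p a < r" "card (same_part_pairs n EG p) \<le> card (same_part_pairs n EG p0)"
    "\<And>x i. x < n \<Longrightarrow> i < r \<Longrightarrow>
      card {a. a < n \<and> p a = p x \<and> {x, a} \<in> EG} \<le> card {a. a < n \<and> p a = i \<and> {x, a} \<in> EG}"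
proof -
  obtain p where p: "\<forall>a. p a < r" and least: "\<And>p'. \<forall>a. p' a < r \<Longrightarrow> card (same_part_pairs n EG p) \<le> card (same_part_pairs n EG p')"
    using ex_has_least_nat[of "\<lambda>p. \<forall>a. p a < r" p0 "\<lambda>p. card (same_part_pairs n EG p)"] p0 by blast
  have "card {a. a < n \<and> p a = p x \<and> {x, a} \<in> EG} \<le> card {a. a < n \<and> p a = i \<and> {x, a} \<in> EG}"
    if x: "x < n" and i: "i < r" for x i
  proof (rule ccontr)
    assume less: "\<not> ?thesis"
    define p' where "p' = p(x := i)"
    let ?S = "same_part_pairs n EG"
    have xx: "{x, x} \<notin> EG" using simple_graphD(4)[OF G, of x x] by blast
    have 1: "?S p `` {x} = {a. a < n \<and> p a = p x \<and> {x, a} \<in> EG}"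
      unfolding same_part_pairs_def using x by auto
    have 2: "?S p' `` {x} = {a. a < n \<and> p a = i \<and> {x, a} \<in> EG}"
      unfolding same_part_pairs_def p'_def using x xx by auto
    have 3: "?S p \<inter> (- {x}) \<times> (- {x}) = ?S p' \<inter> (- {x}) \<times> (- {x})"
      unfolding same_part_pairs_def p'_def by auto
    have "card (?S p') \<le> 2 * card (?S p' `` {x}) + card (?S p' \<inter> (- {x}) \<times> (- {x}))"
      using card_sym_rel_le(1)[OF _ same_part_pairs_sym, of n EG p' "{x}"] by simp
    \<comment> \<open>The \<open>+ 1\<close> is the overlap term of a singleton; it is harmless
      because the drop in degree, at least 1, counts twice.\<close>
    moreover have "2 * card (?S p `` {x}) + card (?S p \<inter> (- {x}) \<times> (- {x})) \<le> card (?S p) + 1"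
      using card_sym_rel_le(2)[OF _ same_part_pairs_sym, of n EG p "{x}"] by simp
    ultimately have "card (?S p') < card (?S p)" using less unfolding 1 2 3 by linarith
    moreover have "card (?S p) \<le> card (?S p')" by (rule least) (use p i in \<open>auto simp: p'_def\<close>)
    ultimately show False by simp
  qed
  then show ?thesis using that[of p] p least[of p0] p0 by blast
qed

lemma card_inj_PiE_ge:
  assumes "finite V" "0 < n"
  shows "real n ^ card V * (1 - (real (card V))\<^sup>2 / real n) \<le> real (card {\<phi> \<in> V \<rightarrow>\<^sub>E {0..<n}. inj_on \<phi> V})"
proof -
  define R where "R = (\<lambda>a. (a, a)) ` {0..<n}"
  have "card R = n" unfolding R_def by (subst card_image) (auto simp: inj_on_def)
  then have "(real (card V))\<^sup>2 * real (card R) / (real n)\<^sup>2 = (real (card V))\<^sup>2 / real n"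
    using assms by (simp add: power2_eq_square)
  moreover have "{\<psi> \<in> V \<rightarrow>\<^sub>E {0..<n}. \<forall>v\<in>V. \<forall>w\<in>V. v \<noteq> w \<longrightarrow> (\<psi> v, \<psi> w) \<notin> R} \<subseteq> {\<phi> \<in> V \<rightarrow>\<^sub>E {0..<n}. inj_on \<phi> V}"
    unfolding R_def inj_on_def by (auto dest: PiE_mem)
  then have "real (card {\<psi> \<in> V \<rightarrow>\<^sub>E {0..<n}. \<forall>v\<in>V. \<forall>w\<in>V. v \<noteq> w \<longrightarrow> (\<psi> v, \<psi> w) \<notin> R}) \<le> real (card {\<phi> \<in> V \<rightarrow>\<^sub>E {0..<n}. inj_on \<phi> V})"
    using assms by (intro of_nat_mono card_mono) (auto intro!: finite_subset[OF _ finite_PiE[of V "\<lambda>_. {0..<n}"]])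
  ultimately show ?thesis
    using card_PiE_avoiding[of V "\<lambda>_. {0..<n}" n R] assms unfolding R_def by simp
qed

context critical_graph begin

text \<open>Among all maps from \<open>V\<close>, multipartite homomorphisms have positive density
  and all but a fraction O(1/n) are injective, so many maps are both. An
  \<open>(r+1)\<close>-colouring of \<open>F\<close> ensures that these homomorphisms preserve its
  edges.\<close>

lemma embeddings_if_many_cliques:
  assumes G: "simple_graph {0..<n} EG" and n: "0 < n" and \<delta>: "0 \<le> \<delta>"
    and adj: "finite_adjacency {0..<n} A" "\<And>x y. A x y \<longleftrightarrow> {x, y} \<in> EG"
    and many: "\<delta> * real n ^ Suc r \<le> real (card (finite_adjacency.cliques {0..<n} A (Suc r)))"
  shows "real n ^ f * (\<delta> ^ (2 ^ f) - (real f)\<^sup>2 / real n) \<le> real (card (embeddings V E n EG))"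
proof -
  interpret adj: finite_adjacency "{0..<n}" A by (rule adj(1))
  have "colorable V E (Suc r)" using colorable_chromatic_number[OF F] chrom by simp
  then obtain c :: "'a \<Rightarrow> nat" where c: "\<And>v. v \<in> V \<Longrightarrow> c v < Suc r"
    "\<And>x y. x \<in> V \<Longrightarrow> y \<in> V \<Longrightarrow> {x, y} \<in> E \<Longrightarrow> c x \<noteq> c y" unfolding colorable_def by blast
  let ?H = "adj.multipartite_homs c V" and ?I = "{\<phi> \<in> V \<rightarrow>\<^sub>E {0..<n}. inj_on \<phi> V}" and ?A = "V \<rightarrow>\<^sub>E {0..<n}"
  have fin: "finite ?A" using fV by (intro finite_PiE) auto
  have H: "\<delta> ^ (2 ^ f) * real n ^ f \<le> real (card ?H)"
    using adj.card_multipartite_homs_blowup[of V c "Suc r" \<delta>] c fV n \<delta> many by simp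
  have "?H \<inter> ?I \<subseteq> embeddings V E n EG"
    unfolding adj.multipartite_homs_def embeddings_def using c(2) adj(2) by blast
  then have 1: "card (?H \<inter> ?I) \<le> card (embeddings V E n EG)"
    by (rule card_mono[OF finite_embeddings[OF fV]])
  have sub: "?H \<subseteq> ?A" "?I \<subseteq> ?A" unfolding adj.multipartite_homs_def by auto
  then have fHI: "finite ?H" "finite ?I" using fin finite_subset by blast+
  have "card ?H + card ?I = card (?H \<union> ?I) + card (?H \<inter> ?I)" by (rule card_Un_Int[OF fHI])
  moreover have "card (?H \<union> ?I) \<le> card ?A" by (rule card_mono[OF fin]) (use sub in auto)
  moreover have "card ?A = n ^ f" using fV by (simp add: card_PiE)
  ultimately have "card ?H + card ?I \<le> n ^ f + card (embeddings V E n EG)" using 1 by linarith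
  then have "real (card ?H + card ?I) \<le> real (n ^ f + card (embeddings V E n EG))" by (simp only: of_nat_le_iff)
  then have "real (card ?H) + real (card ?I) \<le> real n ^ f + real (card (embeddings V E n EG))" by simp
  then show ?thesis using H card_inj_PiE_ge[OF fV n] by (simp add: algebra_simps)
qed

text \<open>\<open>q\<close> is a real excess over \<open>(1 - 1/r) n^2 / 2\<close>, so that the
  lemma serves both for bounding the Turan number and, after a shift by \<open>n / 2\<close>, for
  \<open>h_F\<close>. With many \<open>(r+1)\<close>-cliques a positive density of embeddings beats
  \<open>q * n ^ (f - 2)\<close> as long as \<open>q \<le> \<delta> * n^2\<close>; otherwise
  stability and a maximum cut lead to \<open>near_turan\<close>.\<close>

lemma copies_lower_bound:
  assumes \<epsilon>: "0 < \<epsilon>" "\<epsilon> < 1"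
  obtains \<delta> :: real and N :: nat where "0 < \<delta>"
    "\<And>n EG q. N \<le> n \<Longrightarrow> simple_graph {0..<n} EG \<Longrightarrow> 0 \<le> q \<Longrightarrow> q \<le> \<delta> * (real n)\<^sup>2 \<Longrightarrow>
      (1 - 1 / real r) * (real n)\<^sup>2 + 2 * q \<le> real (card (edge_pairs n EG)) \<Longrightarrow>
      (1 - \<epsilon>) * \<beta> * q * real n ^ (f - 2) \<le> real (num_copies V E n EG)"
proof -
  define C1 where "C1 = real (card pointed_colorings)"
  define C0 where "C0 = C1 * (real f)\<^sup>2"
  have C: "0 \<le> C1" "0 \<le> C0" unfolding C1_def C0_def by auto
  have f: "2 \<le> real f" using f2 by simp
  have ab: "0 < aut * \<beta>" using aut_pos beta_pos by simp
  \<comment> \<open>Small enough for \<open>cond_e\<close>, and fixed before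
    \<open>\<eta>\<close>.\<close>
  define e where "e = min (1 / real r) ((1 - \<epsilon>) * (aut * \<beta>) / (2 * (C1 * real f) + 1))"
  have e: "0 < e" "e \<le> 1 / real r" "2 * (C1 * real f) * e \<le> (1 - \<epsilon>) * (aut * \<beta>)"
  proof -
    have pos: "0 < 2 * (C1 * real f) + 1" using C f by (simp add: add_nonneg_pos)
    show e0: "0 < e" unfolding e_def using r2 \<epsilon> ab pos by simp
    show "e \<le> 1 / real r" unfolding e_def by simp
    have "e \<le> (1 - \<epsilon>) * (aut * \<beta>) / (2 * (C1 * real f) + 1)" unfolding e_def by simp
    then have "e * (2 * (C1 * real f) + 1) \<le> (1 - \<epsilon>) * (aut * \<beta>)" using pos by (simp add: pos_le_divide_eq)
    then show "2 * (C1 * real f) * e \<le> (1 - \<epsilon>) * (aut * \<beta>)" using e0 by (simp add: algebra_simps)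
  qed
  \<comment> \<open>Each condition on \<open>\<eta>\<close> says that a coefficient times
    \<open>\<eta>\<close> is at most a positive number. With \<open>b\<close> the least of these
    numbers and \<open>K\<close> the sum of the coefficients, \<open>\<eta> = b / K\<close> meets
    them all.\<close>
  define b where "b = min (\<epsilon> * e) (min (\<epsilon> * e ^ (f - 1)) (\<epsilon> * (aut * \<beta>)))"
  define K where "K = 8 * real f + 8 * C0 + 2 * (aut * \<beta> * (real r + 2)) + (4 * C1 * real f + 2 * C0)"
  define \<eta> where "\<eta> = b / K"
  have b: "0 < b" unfolding b_def using \<epsilon> e ab by simp
  have parts: "0 \<le> 8 * real f" "0 \<le> 8 * C0" "0 \<le> 2 * (aut * \<beta> * (real r + 2))" "0 \<le> 4 * C1 * real f + 2 * C0" "0 < 8 * real f"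
    using C f ab by auto
  then have K: "0 < K" unfolding K_def by linarith
  have \<eta>: "0 < \<eta>" unfolding \<eta>_def using b K by simp
  have small: "x * \<eta> \<le> b" if "x \<le> K" for x
  proof -
    have "x * \<eta> \<le> K * \<eta>" using that \<eta> by (intro mult_right_mono) auto
    then show ?thesis unfolding \<eta>_def using K by simp
  qed
  have bb: "b \<le> \<epsilon> * e" "b \<le> \<epsilon> * e ^ (f - 1)" "b \<le> \<epsilon> * (aut * \<beta>)" unfolding b_def by auto
  have conds: "8 * real f * \<eta> \<le> \<epsilon> * e" "8 * C0 * \<eta> \<le> \<epsilon> * e ^ (f - 1)"
    "2 * (aut * \<beta> * (real r + 2)) * \<eta> \<le> \<epsilon> * e ^ (f - 1)" "(4 * C1 * real f + 2 * C0) * \<eta> \<le> \<epsilon> * (aut * \<beta>)"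
    using small[of "8 * real f"] small[of "8 * C0"] small[of "2 * (aut * \<beta> * (real r + 2))"] small[of "4 * C1 * real f + 2 * C0"]
      parts bb unfolding K_def by linarith+
  define \<epsilon>0 where "\<epsilon>0 = min (\<eta>\<^sup>2) (e * \<eta>)"
  have "0 < \<epsilon>0" unfolding \<epsilon>0_def using \<eta> e by simp
  from clique_stability[OF r2 this] obtain \<delta>1 where \<delta>1: "0 < \<delta>1"
    and stab: "\<And>(U :: nat set) A. finite_adjacency U A \<Longrightarrow>
      (1 - 1 / real r) * (real (card U))\<^sup>2 \<le> real (card {(x, y) \<in> U \<times> U. A x y}) \<Longrightarrow>
      real (card (finite_adjacency.cliques U A (Suc r))) \<le> \<delta>1 * real (card U) ^ Suc r \<Longrightarrow>
      \<exists>p. (\<forall>x. p x < r) \<and> real (card {(x, y) \<in> U \<times> U. A x y \<and> p x = p y}) \<le> \<epsilon>0 * (real (card U))\<^sup>2"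
    by blast
  define c1 where "c1 = \<delta>1 ^ (2 ^ f)"
  have c1: "0 < c1" unfolding c1_def using \<delta>1 by simp
  \<comment> \<open>For large \<open>n\<close> at least half of \<open>c1 * n ^ f\<close> survives
    the removal of non-injective maps, and \<open>aut * \<beta> * \<delta> = c1 / 2\<close>.\<close>
  define \<delta> where "\<delta> = c1 / (2 * (aut * \<beta>))"
  have \<delta>: "0 < \<delta>" unfolding \<delta>_def using c1 ab by simp
  define N where "N = nat \<lceil>1 / \<eta>\<rceil> + nat \<lceil>2 * (real f)\<^sup>2 / c1\<rceil> + 1"
  show ?thesis
  proof (rule that[OF \<delta>])
    fix n EG and q :: real
    assume nN: "N \<le> n" and G: "simple_graph {0..<n} EG" and q: "0 \<le> q" "q \<le> \<delta> * (real n)\<^sup>2"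
      and edges: "(1 - 1 / real r) * (real n)\<^sup>2 + 2 * q \<le> real (card (edge_pairs n EG))"
    have n0: "0 < n" using nN unfolding N_def by simp
    have "1 / \<eta> \<le> real n" "2 * (real f)\<^sup>2 / c1 \<le> real n" using nN unfolding N_def by linarith+
    then have n1: "1 \<le> \<eta> * real n" and n2: "2 * (real f)\<^sup>2 \<le> c1 * real n"
      using \<eta> c1 by (simp_all add: pos_divide_le_eq mult.commute)
    have key: "real n ^ (f - 2) * ((1 - \<epsilon>) * (aut * \<beta>) * q) \<le> real (card (embeddings V E n EG))"
    proof -
      define A where "A = (\<lambda>x y. {x, y} \<in> EG)"
      have adj: "finite_adjacency {0..<n} A"
      proof
        show "A y x" if "A x y" for x y using that unfolding A_def by (simp add: insert_commute)
        show "\<not> A x x" for x using simple_graphD(4)[OF G, of x x] unfolding A_def by blast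
      qed simp
      have ep: "{(x, y) \<in> {0..<n} \<times> {0..<n}. A x y} = edge_pairs n EG" unfolding A_def edge_pairs_def by auto
      show ?thesis
      proof (cases "real (card (finite_adjacency.cliques {0..<n} A (Suc r))) \<le> \<delta>1 * real n ^ Suc r")
        case False
        have "real n ^ f * (c1 - (real f)\<^sup>2 / real n) \<le> real (card (embeddings V E n EG))"
          unfolding c1_def
          by (rule embeddings_if_many_cliques[OF G n0 _ adj]) (use \<delta>1 False in \<open>auto simp: A_def\<close>)
        moreover have "c1 / 2 \<le> c1 - (real f)\<^sup>2 / real n" using n2 n0 by (simp add: field_simps)
        then have "real n ^ f * (c1 / 2) \<le> real n ^ f * (c1 - (real f)\<^sup>2 / real n)" by (intro mult_left_mono) auto
        moreover have "real n ^ (f - 2) * ((1 - \<epsilon>) * (aut * \<beta>) * q) \<le> real n ^ f * (c1 / 2)"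
        proof -
          have "(1 - \<epsilon>) * (aut * \<beta>) * q \<le> 1 * (aut * \<beta>) * (\<delta> * (real n)\<^sup>2)"
            using \<epsilon> aut_pos beta_pos q \<delta> by (intro mult_mono) auto
          also have "\<dots> = c1 / 2 * (real n)\<^sup>2" unfolding \<delta>_def using ab aut_pos beta_pos by simp
          finally have "real n ^ (f - 2) * ((1 - \<epsilon>) * (aut * \<beta>) * q) \<le> real n ^ (f - 2) * (c1 / 2 * (real n)\<^sup>2)"
            by (intro mult_left_mono) auto
          also have "\<dots> = real n ^ (f - 2 + 2) * (c1 / 2)" by (simp only: power_add mult_ac)
          also have "f - 2 + 2 = f" using f2 by simp
          finally show ?thesis .
        qed
        ultimately show ?thesis by linarith
      next
        case True
        have "(1 - 1 / real r) * (real (card {0..<n}))\<^sup>2 \<le> real (card {(x, y) \<in> {0..<n} \<times> {0..<n}. A x y})"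
          unfolding ep using edges q by simp
        then obtain p0 where p0: "\<forall>x. p0 x < r"
          and bad0: "real (card {(x, y) \<in> {0..<n} \<times> {0..<n}. A x y \<and> p0 x = p0 y}) \<le> \<epsilon>0 * (real (card {0..<n}))\<^sup>2"
          using stab[OF adj] True by auto
        have "{(x, y) \<in> {0..<n} \<times> {0..<n}. A x y \<and> p0 x = p0 y} = same_part_pairs n EG p0"
          unfolding same_part_pairs_def A_def by auto
        then have bad0: "real (card (same_part_pairs n EG p0)) \<le> \<epsilon>0 * (real n)\<^sup>2" using bad0 by simp
        obtain p where p: "\<And>a. p a < r" and ple: "card (same_part_pairs n EG p) \<le> card (same_part_pairs n EG p0)"
          and cut: "\<And>x i. x < n \<Longrightarrow> i < r \<Longrightarrow>
            card {a. a < n \<and> p a = p x \<and> {x, a} \<in> EG} \<le> card {a. a < n \<and> p a = i \<and> {x, a} \<in> EG}"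
          using exists_max_cut[OF G, of p0 r] p0 by blast
        have bad: "real (card (same_part_pairs n EG p)) \<le> \<epsilon>0 * (real n)\<^sup>2" using bad0 ple by linarith
        have few: "real (card (same_part_pairs n EG p)) \<le> \<eta>\<^sup>2 * (real n)\<^sup>2" "real (card (same_part_pairs n EG p)) \<le> e * \<eta> * (real n)\<^sup>2"
          using bad mult_right_mono[of \<epsilon>0 "\<eta>\<^sup>2" "(real n)\<^sup>2"] mult_right_mono[of \<epsilon>0 "e * \<eta>" "(real n)\<^sup>2"]
          unfolding \<epsilon>0_def by auto
        interpret near_turan r V E \<epsilon> e \<eta> n EG p q
          by unfold_locales (use \<epsilon> e \<eta> conds n1 G p cut edges q few in \<open>simp_all add: C1_def C0_def\<close>)
        show ?thesis by (rule embeddings_count)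
      qed
    qed
    have "aut * ((1 - \<epsilon>) * \<beta> * q * real n ^ (f - 2)) = real n ^ (f - 2) * ((1 - \<epsilon>) * (aut * \<beta>) * q)" by (simp only: mult_ac)
    also have "\<dots> \<le> aut * real (num_copies V E n EG)"
      using key unfolding card_embeddings[OF F G] by simp
    finally show "(1 - \<epsilon>) * \<beta> * q * real n ^ (f - 2) \<le> real (num_copies V E n EG)"
      using aut_pos by simp
  qed
qed

end

section \<open>The upper bound\<close>

lemma card_mod_class:
  assumes r: "0 < r" and i: "i < r"
  shows "real (card {b. b < m \<and> b mod r = i}) \<le> real m / real r + 1"
    and "real m / real r - 1 \<le> real (card {b. b < m \<and> b mod r = i})"
proof -
  have fin: "finite {b. b < m \<and> b mod r = i}" by simp
  have "card {b. b < m \<and> b mod r = i} \<le> card {..m div r}"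
  proof (rule card_inj_on_le[where f = "\<lambda>b. b div r"])
    show "inj_on (\<lambda>b. b div r) {b. b < m \<and> b mod r = i}"
      by (rule inj_onI) (metis (mono_tags, lifting) div_mult_mod_eq mem_Collect_eq)
    show "(\<lambda>b. b div r) ` {b. b < m \<and> b mod r = i} \<subseteq> {..m div r}" by (auto intro: div_le_mono)
  qed simp
  then have "real (card {b. b < m \<and> b mod r = i}) \<le> real (m div r) + 1" by simp
  moreover have dv: "real (m div r) \<le> real m / real r" "real m / real r - 1 \<le> real (m div r)"
  proof -
    have "real m = real (m div r) * real r + real (m mod r)"
      by (metis div_mult_mod_eq of_nat_add of_nat_mult)
    moreover have "real (m mod r) < real r" using r by simp
    ultimately show "real (m div r) \<le> real m / real r" "real m / real r - 1 \<le> real (m div r)"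
      using r by (simp_all add: field_simps)
  qed
  ultimately show "real (card {b. b < m \<and> b mod r = i}) \<le> real m / real r + 1" by linarith
  have "card {..<m div r} \<le> card {b. b < m \<and> b mod r = i}"
  proof (rule card_inj_on_le[where f = "\<lambda>j. j * r + i"])
    show "inj_on (\<lambda>j. j * r + i) {..<m div r}" using r by (auto simp: inj_on_def)
    show "(\<lambda>j. j * r + i) ` {..<m div r} \<subseteq> {b. b < m \<and> b mod r = i}"
    proof clarify
      fix j assume "j < m div r"
      then have "Suc j * r \<le> (m div r) * r" by (intro mult_right_mono) auto
      also have "\<dots> \<le> m" by simp
      finally show "j * r + i < m \<and> (j * r + i) mod r = i" using i by simp
    qed
  qed (rule fin)
  then show "real m / real r - 1 \<le> real (card {b. b < m \<and> b mod r = i})" using dv(2) by simp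
qed

text \<open>The first \<open>k\<close> vertices are pairwise non-adjacent hubs with common
  neighbourhood \<open>T\<close>; the others form a complete multipartite graph with parts given by
  \<open>p\<close>. With \<open>k = 0\<close> and balanced parts this is a Turan graph.\<close>

definition hub_graph :: "nat \<Rightarrow> nat \<Rightarrow> (nat \<Rightarrow> nat) \<Rightarrow> nat set \<Rightarrow> nat set set" where
  "hub_graph n k p T = {{a, b} | a b. k \<le> a \<and> a < n \<and> k \<le> b \<and> b < n \<and> p a \<noteq> p b}
     \<union> {{x, b} | x b. x < k \<and> b \<in> T}"

lemma hub_graph_iff:
  "{a, b} \<in> hub_graph n k p T \<longleftrightarrow> (k \<le> a \<and> a < n \<and> k \<le> b \<and> b < n \<and> p a \<noteq> p b)
     \<or> (a < k \<and> b \<in> T) \<or> (b < k \<and> a \<in> T)"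
  unfolding hub_graph_def by (auto simp: doubleton_eq_iff)

lemma simple_hub_graph:
  assumes "k \<le> n" "T \<subseteq> {k..<n}"
  shows "simple_graph {0..<n} (hub_graph n k p T)"
  unfolding simple_graph_def
proof (intro conjI ballI)
  fix e assume "e \<in> hub_graph n k p T"
  then consider a b where "e = {a, b}" "a < n" "b < n" "p a \<noteq> p b"
    | a b where "e = {a, b}" "a < k" "b \<in> T"
    unfolding hub_graph_def by blast
  then show "\<exists>x y. x \<noteq> y \<and> x \<in> {0..<n} \<and> y \<in> {0..<n} \<and> e = {x, y}"
  proof cases
    case 1
    then show ?thesis by (intro exI[of _ a] exI[of _ b]) auto
  next
    case 2
    then have "k \<le> b" "b < n" using assms by auto
    then show ?thesis using 2 assms by (intro exI[of _ a] exI[of _ b]) auto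
  qed
qed simp

text \<open>The loss \<open>real (n - k)\<close> stems from parts exceeding the average by up to
  1.\<close>

lemma card_edge_pairs_hub_graph:
  assumes k: "k \<le> n" and T: "T \<subseteq> {k..<n}"
    and part: "\<And>i. real (card {a. k \<le> a \<and> a < n \<and> p a = i}) \<le> real (n - k) / real r + 1"
  shows "(1 - 1 / real r) * (real (n - k))\<^sup>2 - real (n - k) + 2 * real k * real (card T)
    \<le> real (card (edge_pairs n (hub_graph n k p T)))"
proof -
  define m where "m = real (n - k)"
  define C where "C = {(a, b). k \<le> a \<and> a < n \<and> k \<le> b \<and> b < n \<and> p a \<noteq> p b}"
  define S where "S = Sigma {k..<n} (\<lambda>a. {b. k \<le> b \<and> b < n \<and> p b = p a})"
  have fC: "finite C" unfolding C_def by (rule finite_subset[of _ "{..<n} \<times> {..<n}"]) auto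
  have fS: "finite S" unfolding S_def by auto
  have fT: "finite T" using T finite_subset by blast
  have "{k..<n} \<times> {k..<n} = C \<union> S" unfolding C_def S_def by auto
  then have "card ({k..<n} \<times> {k..<n}) = card (C \<union> S)" by simp
  also have "\<dots> = card C + card S" by (rule card_Un_disjoint[OF fC fS]) (auto simp: C_def S_def)
  finally have "(n - k) * (n - k) = card C + card S" by (simp add: card_cartesian_product)
  then have "real ((n - k) * (n - k)) = real (card C + card S)" by (rule arg_cong)
  then have 1: "m * m = real (card C) + real (card S)" unfolding m_def by (simp only: of_nat_mult of_nat_add)
  have "real (card S) = (\<Sum>a\<in>{k..<n}. real (card {b. k \<le> b \<and> b < n \<and> p b = p a}))" unfolding S_def by simp
  also have "\<dots> \<le> (\<Sum>a\<in>{k..<n}. m / real r + 1)" unfolding m_def by (rule sum_mono[OF part])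
  also have "\<dots> = m * (m / real r + 1)" unfolding m_def by (simp only: sum_constant card_atLeastLessThan)
  finally have 2: "real (card S) \<le> m * (m / real r + 1)" .
  have "C \<union> ({..<k} \<times> T \<union> T \<times> {..<k}) \<subseteq> edge_pairs n (hub_graph n k p T)"
    using k T unfolding C_def edge_pairs_def hub_graph_iff by auto
  then have "card (C \<union> ({..<k} \<times> T \<union> T \<times> {..<k})) \<le> card (edge_pairs n (hub_graph n k p T))"
    by (rule card_mono[OF finite_edge_pairs])
  moreover have "card (C \<union> ({..<k} \<times> T \<union> T \<times> {..<k})) = card C + card ({..<k} \<times> T \<union> T \<times> {..<k})"
    by (rule card_Un_disjoint) (use fC fT T in \<open>auto simp: C_def\<close>)
  moreover have "card ({..<k} \<times> T \<union> T \<times> {..<k}) = card ({..<k} \<times> T) + card (T \<times> {..<k})"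
    by (rule card_Un_disjoint) (use fT T in auto)
  ultimately have "card C + 2 * (k * card T) \<le> card (edge_pairs n (hub_graph n k p T))"
    by (simp add: card_cartesian_product mult.commute)
  then have "real (card C + 2 * (k * card T)) \<le> real (card (edge_pairs n (hub_graph n k p T)))" by (simp only: of_nat_le_iff)
  then have "real (card C) + 2 * real k * real (card T) \<le> real (card (edge_pairs n (hub_graph n k p T)))" by simp
  moreover have "m * m - m * (m / real r + 1) = (1 - 1 / real r) * m\<^sup>2 - m" by (simp add: algebra_simps power2_eq_square)
  ultimately show ?thesis using 1 2 unfolding m_def[symmetric] by linarith
qed

context critical_graph begin

text \<open>Without hubs the host is \<open>r\<close>-partite, so every embedding sends some
  \<open>u\<close> to a hub. If only \<open>u\<close> goes there, the parts of the other images
  colour F - u and neighbours of \<open>u\<close> land in \<open>T\<close>, which gives the product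
  \<open>coloring_weight\<close>. Embeddings with two vertices at hubs are bounded crudely.\<close>

lemma card_embeddings_hub_graph:
  assumes T: "T \<subseteq> {k..<n}" and p: "\<And>a. p a < r"
    and \<xi>: "\<And>i. i < r \<Longrightarrow> real (card {a \<in> T. p a = i}) \<le> \<xi> i * real n"
    and part: "\<And>i. i < r \<Longrightarrow> 0 < k \<Longrightarrow> real (card {a. k \<le> a \<and> a < n \<and> p a = i}) \<le> real n / real r"
  shows "real (card (embeddings V E n (hub_graph n k p T)))
    \<le> real k * real n ^ (f - 1) * (aut * P_F r V E \<xi>) + (real f)\<^sup>2 * (real k)\<^sup>2 * real n ^ (f - 2)"
proof -
  let ?H = "hub_graph n k p T"
  define Multi where "Multi = (\<lambda>(u, v). Pi\<^sub>E V (\<lambda>w. if w \<in> {u, v} then {..<k} else {..<n}))"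
  define pairs where "pairs = {(u, v) \<in> V \<times> V. u \<noteq> v}"
  define Fib where "Fib = (\<lambda>(u, c). Pi\<^sub>E V (\<lambda>v. if v = u then {..<k} else
      if {u, v} \<in> E then {a \<in> T. p a = c v} else {a. k \<le> a \<and> a < n \<and> p a = c v}))"
  have fT: "finite T" using T finite_subset by blast
  have fpairs: "finite pairs" unfolding pairs_def by (rule finite_subset[of _ "V \<times> V"]) (use fV in auto)
  have fM: "finite (Multi q)" for q unfolding Multi_def using fV by (auto split: prod.splits intro!: finite_PiE)
  have fF: "finite (Fib q)" for q unfolding Fib_def using fV fT by (auto split: prod.splits intro!: finite_PiE)
  have sub: "embeddings V E n ?H \<subseteq> (\<Union>q\<in>pointed_colorings. Fib q) \<union> (\<Union>q\<in>pairs. Multi q)"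
  proof
    fix \<phi> assume "\<phi> \<in> embeddings V E n ?H"
    then have fn: "\<phi> \<in> V \<rightarrow>\<^sub>E {0..<n}" and hom: "\<And>x y. x \<in> V \<Longrightarrow> y \<in> V \<Longrightarrow> {x, y} \<in> E \<Longrightarrow> {\<phi> x, \<phi> y} \<in> ?H"
      unfolding embeddings_def by auto
    have \<phi>n: "\<phi> v < n" if "v \<in> V" for v using PiE_mem[OF fn that] by simp
    have ext: "\<phi> v = undefined" if "v \<notin> V" for v using PiE_arb[OF fn that] .
    have proper: "p (\<phi> x) \<noteq> p (\<phi> y)" if "x \<in> V" "y \<in> V" "{x, y} \<in> E" "k \<le> \<phi> x" "k \<le> \<phi> y" for x y
      using hom[OF that(1-3)] that(4,5) unfolding hub_graph_iff by auto
    have "\<exists>u\<in>V. \<phi> u < k"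
    proof (rule ccontr)
      assume "\<not> ?thesis"
      then have "colorable V E r" unfolding colorable_def
        by (intro exI[of _ "\<lambda>v. p (\<phi> v)"]) (use p proper in \<open>auto simp: not_less\<close>)
      then show False using ncol by simp
    qed
    then obtain u where u: "u \<in> V" "\<phi> u < k" by blast
    show "\<phi> \<in> (\<Union>q\<in>pointed_colorings. Fib q) \<union> (\<Union>q\<in>pairs. Multi q)"
    proof (cases "\<exists>v\<in>V. v \<noteq> u \<and> \<phi> v < k")
      case True
      then obtain v where v: "v \<in> V" "v \<noteq> u" "\<phi> v < k" by blast
      have "\<phi> \<in> Multi (u, v)" unfolding Multi_def using u v \<phi>n ext by (auto intro!: PiE_I)
      moreover have "(u, v) \<in> pairs" unfolding pairs_def using u v by auto
      ultimately show ?thesis by blast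
    next
      case False
      then have large: "k \<le> \<phi> v" if "v \<in> V" "v \<noteq> u" for v using that by (auto simp: not_less)
      define c where "c = restrict (\<lambda>v. p (\<phi> v)) (V - {u})"
      have "c \<in> colorings_u r V E u"
        unfolding colorings_u_def c_def using p proper large by auto
      moreover have "\<phi> \<in> Fib (u, c)"
        unfolding Fib_def prod.case
      proof (rule PiE_I)
        fix v assume v: "v \<in> V"
        show "\<phi> v \<in> (if v = u then {..<k} else
            if {u, v} \<in> E then {a \<in> T. p a = c v} else {a. k \<le> a \<and> a < n \<and> p a = c v})"
        proof (cases "v = u")
          case True
          then show ?thesis using u by simp
        next
          case False
          then have cv: "c v = p (\<phi> v)" unfolding c_def using v by simp
          have "\<phi> v \<in> T" if "{u, v} \<in> E"
            using hom[OF u(1) v that] u(2) large[OF v False] unfolding hub_graph_iff by auto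
          then show ?thesis using False cv large[OF v False] \<phi>n[OF v] by simp
        qed
      qed (rule ext)
      ultimately show ?thesis using u by blast
    qed
  qed
  have cM: "real (card (Multi q)) = (real k)\<^sup>2 * real n ^ (f - 2)" if q: "q \<in> pairs" for q
  proof -
    obtain u v where uv: "q = (u, v)" "u \<in> V" "v \<in> V" "u \<noteq> v" using q unfolding pairs_def by auto
    have Veq: "V = insert u (insert v (V - {u, v}))" using uv by auto
    have "(\<Prod>w\<in>V. card (if w \<in> {u, v} then {..<k} else {..<n}))
        = (\<Prod>w\<in>insert u (insert v (V - {u, v})). card (if w \<in> {u, v} then {..<k} else {..<n}))" by (rule prod.cong[OF Veq refl])
    also have "\<dots> = k * (k * (\<Prod>w\<in>V - {u, v}. card (if w \<in> {u, v} then {..<k} else {..<n})))"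
      using fV uv by simp
    also have "(\<Prod>w\<in>V - {u, v}. card (if w \<in> {u, v} then {..<k} else {..<n})) = (\<Prod>w\<in>V - {u, v}. n)"
      by (rule prod.cong) auto
    finally have "card (Multi q) = k * (k * n ^ (f - 2))"
      unfolding Multi_def uv prod.case using fV card_V_minus[OF uv(2-4)] by (simp add: card_PiE)
    then show ?thesis by (simp add: power2_eq_square)
  qed
  have cF: "real (card (Fib (u, c))) \<le> real k * real n ^ (f - 1) * coloring_weight r V E \<xi> u c"
    if u: "u \<in> V" and c: "c \<in> colorings_u r V E u" for u c
  proof -
    let ?s = "\<lambda>v. if {u, v} \<in> E then {a \<in> T. p a = c v} else {a. k \<le> a \<and> a < n \<and> p a = c v}"
    have "(\<Prod>v\<in>V. card (if v = u then {..<k} else ?s v)) = k * (\<Prod>v\<in>V - {u}. card (if v = u then {..<k} else ?s v))"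
      using prod.remove[OF fV u, of "\<lambda>v. card (if v = u then {..<k} else ?s v)"] by simp
    also have "(\<Prod>v\<in>V - {u}. card (if v = u then {..<k} else ?s v)) = (\<Prod>v\<in>V - {u}. card (?s v))" by (rule prod.cong) auto
    finally have eq: "card (Fib (u, c)) = k * (\<Prod>v\<in>V - {u}. card (?s v))"
      unfolding Fib_def prod.case using fV by (simp add: card_PiE)
    show ?thesis
    proof (cases "k = 0")
      case True
      then show ?thesis using eq by simp
    next
      case False
      have "(\<Prod>v\<in>V - {u}. real (card (?s v))) \<le> (\<Prod>v\<in>V - {u}. real n * (if {u, v} \<in> E then \<xi> (c v) else 1 / real r))"
      proof (intro prod_mono conjI)
        fix v assume "v \<in> V - {u}"
        then have "c v < r" using colorings_uD(1)[OF c] by auto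
        then show "real (card (?s v)) \<le> real n * (if {u, v} \<in> E then \<xi> (c v) else 1 / real r)"
          using \<xi>[of "c v"] part[of "c v"] False by (auto simp: mult.commute)
      qed simp
      also have "\<dots> = real n ^ (f - 1) * coloring_weight r V E \<xi> u c"
        unfolding coloring_weight_def prod.distrib using fV u by simp
      finally have "real k * (\<Prod>v\<in>V - {u}. real (card (?s v))) \<le> real k * (real n ^ (f - 1) * coloring_weight r V E \<xi> u c)"
        by (intro mult_left_mono) auto
      then show ?thesis using eq by (simp add: mult.assoc)
    qed
  qed
  have "card (embeddings V E n ?H) \<le> card ((\<Union>q\<in>pointed_colorings. Fib q) \<union> (\<Union>q\<in>pairs. Multi q))"
    by (rule card_mono[OF _ sub]) (use fpairs fM fF in auto)
  also have "\<dots> \<le> card (\<Union>q\<in>pointed_colorings. Fib q) + card (\<Union>q\<in>pairs. Multi q)" by (rule card_Un_le)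
  also have "\<dots> \<le> (\<Sum>q\<in>pointed_colorings. card (Fib q)) + (\<Sum>q\<in>pairs. card (Multi q))"
    by (intro add_mono card_UN_le finite_pointed_colorings fpairs)
  finally have "real (card (embeddings V E n ?H)) \<le> real ((\<Sum>q\<in>pointed_colorings. card (Fib q)) + (\<Sum>q\<in>pairs. card (Multi q)))"
    by (simp only: of_nat_le_iff)
  also have "\<dots> = (\<Sum>q\<in>pointed_colorings. real (card (Fib q))) + (\<Sum>q\<in>pairs. real (card (Multi q)))" by simp
  also have "(\<Sum>q\<in>pointed_colorings. real (card (Fib q)))
      \<le> (\<Sum>q\<in>pointed_colorings. real k * real n ^ (f - 1) * (case q of (u, c) \<Rightarrow> coloring_weight r V E \<xi> u c))"
    by (rule sum_mono) (use cF in auto)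
  also have "\<dots> = real k * real n ^ (f - 1) * (aut * P_F r V E \<xi>)" unfolding aut_P_F by (simp only: sum_distrib_left)
  also have "(\<Sum>q\<in>pairs. real (card (Multi q))) = real (card pairs) * ((real k)\<^sup>2 * real n ^ (f - 2))" using cM by simp
  also have "\<dots> \<le> (real f)\<^sup>2 * ((real k)\<^sup>2 * real n ^ (f - 2))"
  proof (rule mult_right_mono)
    have "card pairs \<le> card (V \<times> V)" unfolding pairs_def by (rule card_mono) (use fV in auto)
    then have "card pairs \<le> f * f" by (simp add: card_cartesian_product)
    then have "real (card pairs) \<le> real (f * f)" by (simp only: of_nat_le_iff)
    then show "real (card pairs) \<le> (real f)\<^sup>2" by (simp add: power2_eq_square)
  qed simp
  finally show ?thesis by (simp add: mult.assoc)
qed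

text \<open>Turning a vertex of the Turan graph into a hub trades degree about
  \<open>(1 - 1/r) * n\<close> for degree about \<open>n\<close> times the coordinate sum. The
  alternative \<open>k = 0\<close> or \<open>r \<le> k\<close> ensures
  \<open>(n - k) / r + 1 \<le> n / r\<close> whenever hubs exist, so no rounding error enters the
  count of copies.\<close>

lemma hub_graph_construction:
  assumes k: "k \<le> n" "k = 0 \<or> r \<le> k"
    and \<xi>: "\<And>i. i < r \<Longrightarrow> 0 \<le> \<xi> i" "\<And>i. i < r \<Longrightarrow> \<xi> i \<le> 1 / real r"
  obtains EG where "simple_graph {0..<n} EG"
    "(1 - 1 / real r) * (real n)\<^sup>2 + 2 * real k * real n * ((\<Sum>i<r. \<xi> i) - (1 - 1 / real r))
        - real n - 2 * (real k)\<^sup>2 - 2 * real k * real r \<le> real (card (edge_pairs n EG))"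
    "real (num_copies V E n EG) \<le> real k * real n ^ (f - 1) * P_F r V E \<xi> + (real f)\<^sup>2 * (real k)\<^sup>2 * real n ^ (f - 2)"
proof -
  have r0: "0 < r" using r2 by simp
  define p where "p a = (a - k) mod r" for a
  define P where "P i = {a. k \<le> a \<and> a < n \<and> p a = i}" for i
  have p: "p a < r" for a unfolding p_def using r0 by simp
  have cP: "card (P i) = card {b. b < n - k \<and> b mod r = i}" for i
  proof (rule bij_betw_same_card[of "\<lambda>a. a - k"], rule bij_betw_byWitness[where f' = "\<lambda>b. b + k"])
    show "(\<lambda>a. a - k) ` P i \<subseteq> {b. b < n - k \<and> b mod r = i}" unfolding P_def p_def by auto
    show "(\<lambda>b. b + k) ` {b. b < n - k \<and> b mod r = i} \<subseteq> P i" unfolding P_def p_def by auto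
  qed (auto simp: P_def)
  have up: "real (card (P i)) \<le> real (n - k) / real r + 1" for i
  proof (cases "i < r")
    case True
    then show ?thesis using card_mod_class(1)[OF r0 True, of "n - k"] cP by simp
  next
    case False
    then have "P i = {}" unfolding P_def using p by auto
    then show ?thesis by simp
  qed
  have low: "real (n - k) / real r - 1 \<le> real (card (P i))" if "i < r" for i
    using card_mod_class(2)[OF r0 that, of "n - k"] cP by simp
  have fP: "finite (P i)" for i unfolding P_def by auto
  \<comment> \<open>The minimum is needed because removing the hubs leaves parts smaller than
    \<open>n / r\<close>, while \<open>\<xi> i\<close> may equal \<open>1 / r\<close>.\<close>
  define t where "t i = min (card (P i)) (nat \<lfloor>\<xi> i * real n\<rfloor>)" for i
  have "\<exists>S. S \<subseteq> P i \<and> card S = t i" for i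
    using obtain_subset_with_card_n[of "t i" "P i"] unfolding t_def by (metis min.cobounded1)
  then obtain S where S: "\<And>i. S i \<subseteq> P i" "\<And>i. card (S i) = t i" by metis
  define T where "T = (\<Union>i<r. S i)"
  have T: "T \<subseteq> {k..<n}" unfolding T_def using S(1) unfolding P_def by fastforce
  have Ti: "{a \<in> T. p a = i} = S i" if "i < r" for i
    unfolding T_def using S(1) that unfolding P_def by blast
  have t_up: "real (t i) \<le> \<xi> i * real n" if "i < r" for i
  proof -
    have "0 \<le> \<xi> i * real n" using \<xi>(1)[OF that] by simp
    then have "real (nat \<lfloor>\<xi> i * real n\<rfloor>) \<le> \<xi> i * real n" by simp
    then show ?thesis unfolding t_def by linarith
  qed
  have nk: "real (n - k) = real n - real k" using k by simp
  have t_low: "\<xi> i * real n - real k / real r - 1 \<le> real (t i)" if i: "i < r" for i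
  proof -
    have "0 \<le> real k / real r" by simp
    moreover have "\<xi> i * real n \<le> real n / real r" using mult_right_mono[OF \<xi>(2)[OF i], of "real n"] by simp
    then have "\<xi> i * real n - real k / real r - 1 \<le> real (card (P i))"
      using low[OF i] unfolding nk by (simp add: diff_divide_distrib)
    moreover have "\<xi> i * real n - 1 \<le> real (nat \<lfloor>\<xi> i * real n\<rfloor>)" by linarith
    ultimately show ?thesis unfolding t_def by linarith
  qed
  have "card T = (\<Sum>i<r. card (S i))"
    unfolding T_def
    by (rule card_UN_disjoint) (use S(1) fP in \<open>auto simp: P_def intro: finite_subset[OF _ fP] dest!: subsetD[OF S(1)]\<close>)
  then have "real (card T) = (\<Sum>i<r. real (t i))" using S(2) by simp
  moreover have "(\<Sum>i<r. \<xi> i * real n - real k / real r - 1) \<le> (\<Sum>i<r. real (t i))"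
    by (rule sum_mono) (use t_low in auto)
  moreover have "(\<Sum>i<r. \<xi> i * real n - real k / real r - 1) = (\<Sum>i<r. \<xi> i) * real n - real k - real r"
    using r0 by (simp add: sum_subtractf sum_distrib_right)
  ultimately have cT: "(\<Sum>i<r. \<xi> i) * real n - real k - real r \<le> real (card T)" by linarith
  define EG where "EG = hub_graph n k p T"
  have G: "simple_graph {0..<n} EG" unfolding EG_def by (rule simple_hub_graph[OF k(1) T])
  have "(1 - 1 / real r) * (real (n - k))\<^sup>2 - real (n - k) + 2 * real k * real (card T) \<le> real (card (edge_pairs n EG))"
    unfolding EG_def by (rule card_edge_pairs_hub_graph[OF k(1) T]) (use up in \<open>simp add: P_def\<close>)
  moreover have "2 * real k * ((\<Sum>i<r. \<xi> i) * real n - real k - real r) \<le> 2 * real k * real (card T)"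
    by (intro mult_left_mono cT) simp
  moreover have "(1 - 1 / real r) * ((real n)\<^sup>2 - 2 * real n * real k) \<le> (1 - 1 / real r) * (real (n - k))\<^sup>2"
    unfolding nk using r2 by (intro mult_left_mono) (auto simp: power2_diff)
  moreover have "0 \<le> real k" by simp
  ultimately have edges: "(1 - 1 / real r) * (real n)\<^sup>2 + 2 * real k * real n * ((\<Sum>i<r. \<xi> i) - (1 - 1 / real r))
        - real n - 2 * (real k)\<^sup>2 - 2 * real k * real r \<le> real (card (edge_pairs n EG))"
    unfolding nk by (simp add: algebra_simps power2_eq_square)
  have "real (card (embeddings V E n EG))
    \<le> real k * real n ^ (f - 1) * (aut * P_F r V E \<xi>) + (real f)\<^sup>2 * (real k)\<^sup>2 * real n ^ (f - 2)"
    unfolding EG_def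
  proof (rule card_embeddings_hub_graph[OF T p])
    show "real (card {a \<in> T. p a = i}) \<le> \<xi> i * real n" if "i < r" for i
      using Ti[OF that] S(2) t_up[OF that] by simp
    show "real (card {a. k \<le> a \<and> a < n \<and> p a = i}) \<le> real n / real r" if "i < r" "0 < k" for i
    proof -
      have "real r \<le> real k" using k(2) that by auto
      then have "1 \<le> real k / real r" using r0 by simp
      then show ?thesis using up[of i] unfolding P_def nk by (simp add: diff_divide_distrib)
    qed
  qed
  \<comment> \<open>As \<open>aut\<close> is at least 1, the error term can be kept as it is when
    the inequality is divided by \<open>aut\<close>.\<close>
  moreover have "(real f)\<^sup>2 * (real k)\<^sup>2 * real n ^ (f - 2) \<le> aut * ((real f)\<^sup>2 * (real k)\<^sup>2 * real n ^ (f - 2))"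
  proof -
    have "1 \<le> aut" using aut_pos by simp
    then have "1 * ((real f)\<^sup>2 * (real k)\<^sup>2 * real n ^ (f - 2)) \<le> aut * ((real f)\<^sup>2 * (real k)\<^sup>2 * real n ^ (f - 2))"
      by (rule mult_right_mono) simp
    then show ?thesis by simp
  qed
  ultimately have "aut * real (num_copies V E n EG)
      \<le> aut * (real k * real n ^ (f - 1) * P_F r V E \<xi> + (real f)\<^sup>2 * (real k)\<^sup>2 * real n ^ (f - 2))"
    unfolding card_embeddings[OF F G] by (simp add: algebra_simps)
  then have "real (num_copies V E n EG) \<le> real k * real n ^ (f - 1) * P_F r V E \<xi> + (real f)\<^sup>2 * (real k)\<^sup>2 * real n ^ (f - 2)"
    using aut_pos by (rule mult_left_le_imp_le)
  then show ?thesis using that G edges by blast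
qed

end

section \<open>The limit\<close>

lemma card_edge_pairs:
  assumes G: "simple_graph {0..<n} EG"
  shows "card (edge_pairs n EG) = 2 * card EG"
proof -
  interpret adj: finite_adjacency "{0..<n}" "\<lambda>x y. {x, y} \<in> EG"
  proof
    show "{y, x} \<in> EG" if "{x, y} \<in> EG" for x y using that by (simp add: insert_commute)
    show "{x, x} \<notin> EG" for x using simple_graphD(4)[OF G, of x x] by blast
  qed simp
  have "adj.cliques 2 = EG"
  proof (rule set_eqI, rule iffI)
    fix S assume S: "S \<in> adj.cliques 2"
    then obtain x y where "S = {x, y}" "x \<noteq> y" unfolding adj.cliques_def by (auto simp: card_2_iff)
    then show "S \<in> EG" using S unfolding adj.cliques_def by auto
  next
    fix S assume S: "S \<in> EG"
    obtain x y where "x \<noteq> y" "x \<in> {0..<n}" "y \<in> {0..<n}" "S = {x, y}" using G S by (rule simple_graph_edgeE)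
    then show "S \<in> adj.cliques 2" using S unfolding adj.cliques_def by (auto simp: insert_commute)
  qed
  moreover have "{(x, y) \<in> {0..<n} \<times> {0..<n}. {x, y} \<in> EG} = edge_pairs n EG"
    unfolding edge_pairs_def by auto
  ultimately show ?thesis using adj.card_cliques_2 by simp
qed

lemma finite_simple_graphs: "finite {EG. simple_graph {0..<n :: nat} EG}"
  by (rule finite_subset[of _ "Pow (Pow {0..<n})"]) (auto simp: simple_graph_def)

lemma num_copies_mono:
  assumes F: "simple_graph V E" and G: "simple_graph {0..<n} EG" and sub: "D \<subseteq> EG"
  shows "num_copies V E n D \<le> num_copies V E n EG"
  unfolding num_copies_def
proof (rule card_mono)
  show "finite (copies V E n EG)"
    unfolding copies_eq_image[OF F G] by (intro finite_imageI finite_embeddings simple_graphD(1)[OF F])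
  show "copies V E n D \<subseteq> copies V E n EG" unfolding copies_def using sub by blast
qed

section \<open>The Turan number up to O(n), and two-sided bounds on \<open>h_F\<close>\<close>

context critical_graph begin

lemma finite_turan_set: "finite {card EG | EG. simple_graph {0..<n} EG \<and> num_copies V E n EG = 0}"
proof (rule finite_subset)
  show "{card EG | EG. simple_graph {0..<n} EG \<and> num_copies V E n EG = 0} \<subseteq> card ` {EG. simple_graph {0..<n} EG}" by auto
qed (intro finite_imageI finite_simple_graphs)

text \<open>The construction without hubs: for \<open>k = 0\<close> its bound on the number of
  copies is 0.\<close>

lemma turan_graph:
  obtains EG where "simple_graph {0..<n} EG" "num_copies V E n EG = 0"
    "(1 - 1 / real r) * (real n)\<^sup>2 - real n \<le> 2 * real (card EG)"
proof (rule hub_graph_construction[of 0 n "\<lambda>_. 1 / real r"])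
  fix EG assume G: "simple_graph {0..<n} EG"
    and "(1 - 1 / real r) * (real n)\<^sup>2 + 2 * real 0 * real n * ((\<Sum>i<r. 1 / real r) - (1 - 1 / real r))
        - real n - 2 * (real 0)\<^sup>2 - 2 * real 0 * real r \<le> real (card (edge_pairs n EG))"
    and "real (num_copies V E n EG) \<le> real 0 * real n ^ (f - 1) * P_F r V E (\<lambda>_. 1 / real r) + (real f)\<^sup>2 * (real 0)\<^sup>2 * real n ^ (f - 2)"
  then show thesis using that[of EG] card_edge_pairs[OF G] by simp
qed auto

lemma turan_ex_ge: "(1 - 1 / real r) * (real n)\<^sup>2 - real n \<le> 2 * real (turan_ex V E n)"
proof -
  obtain EG where EG: "simple_graph {0..<n} EG" "num_copies V E n EG = 0"
    "(1 - 1 / real r) * (real n)\<^sup>2 - real n \<le> 2 * real (card EG)" by (rule turan_graph)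
  have "card EG \<le> turan_ex V E n" unfolding turan_ex_def
    by (rule Max_ge[OF finite_turan_set]) (use EG in auto)
  then have "2 * real (card EG) \<le> 2 * real (turan_ex V E n)" by simp
  then show ?thesis using EG(3) by linarith
qed

text \<open>The count of copies also bounds the Turan number: an extremal graph with more than
  \<open>(1 - 1/r) n^2 / 2\<close> edges would have positive excess and hence contain
  \<open>F\<close>.\<close>

lemma turan_ex_le:
  obtains N where "\<And>n. N \<le> n \<Longrightarrow> 2 * real (turan_ex V E n) \<le> (1 - 1 / real r) * (real n)\<^sup>2"
proof -
  obtain \<delta> N where \<delta>: "0 < \<delta>" and bound: "\<And>n EG q. N \<le> n \<Longrightarrow> simple_graph {0..<n} EG \<Longrightarrow> 0 \<le> q \<Longrightarrow> q \<le> \<delta> * (real n)\<^sup>2 \<Longrightarrow>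
      (1 - 1 / real r) * (real n)\<^sup>2 + 2 * q \<le> real (card (edge_pairs n EG)) \<Longrightarrow>
      (1 - 1 / 2) * \<beta> * q * real n ^ (f - 2) \<le> real (num_copies V E n EG)"
    using copies_lower_bound[of "1 / 2"] by auto
  have "2 * real (turan_ex V E n) \<le> (1 - 1 / real r) * (real n)\<^sup>2" if n: "N + 1 \<le> n" for n
  proof (rule ccontr)
    assume contr: "\<not> ?thesis"
    have "{card EG | EG. simple_graph {0..<n} EG \<and> num_copies V E n EG = 0} \<noteq> {}"
      using turan_graph[of n] by blast
    from Max_in[OF finite_turan_set this] obtain EG where EG: "simple_graph {0..<n} EG" "num_copies V E n EG = 0"
      "turan_ex V E n = card EG" unfolding turan_ex_def by auto
    \<comment> \<open>The excess, cut off to the range in which the bound applies; any positive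
      value yields the contradiction.\<close>
    define q where "q = min (\<delta> * (real n)\<^sup>2) (real (card EG) - (1 - 1 / real r) * (real n)\<^sup>2 / 2)"
    have "0 < \<delta> * (real n)\<^sup>2" using \<delta> n by simp
    then have q: "0 < q" using contr EG(3) unfolding q_def by simp
    have q2: "q \<le> real (card EG) - (1 - 1 / real r) * (real n)\<^sup>2 / 2" unfolding q_def by simp
    have "(1 - 1 / 2) * \<beta> * q * real n ^ (f - 2) \<le> real (num_copies V E n EG)"
    proof (rule bound)
      show "(1 - 1 / real r) * (real n)\<^sup>2 + 2 * q \<le> real (card (edge_pairs n EG))"
      proof -
        have "2 * q \<le> 2 * (real (card EG) - (1 - 1 / real r) * (real n)\<^sup>2 / 2)" by (rule mult_left_mono[OF q2]) simp
        also have "\<dots> = 2 * real (card EG) - (1 - 1 / real r) * (real n)\<^sup>2" by (simp only: right_diff_distrib) simp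
        finally show ?thesis using card_edge_pairs[OF EG(1)] by simp
      qed
      show "q \<le> \<delta> * (real n)\<^sup>2" unfolding q_def by simp
    qed (use n EG q in auto)
    moreover have "0 < (1 - 1 / 2) * \<beta> * q * real n ^ (f - 2)" using beta_pos q n by simp
    ultimately show False using EG(2) by simp
  qed
  then show ?thesis using that by blast
qed

lemma finite_h_F_set: "finite {num_copies V E n EG | EG. simple_graph {0..<n} EG \<and> card EG = m}"
proof (rule finite_subset)
  show "{num_copies V E n EG | EG. simple_graph {0..<n} EG \<and> card EG = m} \<subseteq> num_copies V E n ` {EG. simple_graph {0..<n} EG}" by auto
qed (intro finite_imageI finite_simple_graphs)

text \<open>Surplus edges can be deleted without creating copies. The graph thus obtained also shows
  that the set under \<open>Min\<close> is nonempty, so that the minimum is attained.\<close>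

lemma h_F_le:
  assumes G: "simple_graph {0..<n} EG" and m: "turan_ex V E n + q \<le> card EG"
  shows "h_F V E n q \<le> num_copies V E n EG"
    and "\<exists>D. simple_graph {0..<n} D \<and> card D = turan_ex V E n + q \<and> h_F V E n q = num_copies V E n D"
proof -
  obtain D where D: "D \<subseteq> EG" "card D = turan_ex V E n + q" using obtain_subset_with_card_n[OF m] by blast
  have sD: "simple_graph {0..<n} D" using G D(1) by (rule simple_graph_subset)
  let ?S = "{num_copies V E n EG | EG. simple_graph {0..<n} EG \<and> card EG = turan_ex V E n + q}"
  have mem: "num_copies V E n D \<in> ?S" using sD D by auto
  then have "h_F V E n q \<le> num_copies V E n D" unfolding h_F_def by (rule Min_le[OF finite_h_F_set])
  also have "\<dots> \<le> num_copies V E n EG" by (rule num_copies_mono[OF F G D(1)])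
  finally show "h_F V E n q \<le> num_copies V E n EG" .
  have "h_F V E n q \<in> ?S" unfolding h_F_def by (rule Min_in[OF finite_h_F_set]) (use mem in blast)
  then show "\<exists>D. simple_graph {0..<n} D \<and> card D = turan_ex V E n + q \<and> h_F V E n q = num_copies V E n D" by auto
qed

text \<open>A hub gains about \<open>d * n\<close> edges and creates about
  \<open>Q * n ^ (f - 1)\<close> copies, so an edge costs about \<open>Q / d\<close> in units of
  \<open>n ^ (f - 2)\<close>, which is nearly \<open>\<beta>\<close>. A graph is asserted instead of
  a bound on \<open>h_F\<close>, because the lower bound needs the existence of a graph with that
  many edges.\<close>

lemma eventually_h_F_le:
  fixes q :: "nat \<Rightarrow> nat"
  assumes q0: "(\<lambda>n. real (q n) / real n ^ 2) \<longlonglongrightarrow> 0"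
    and qinf: "filterlim (\<lambda>n. real (q n) / real n) at_top sequentially"
    and \<epsilon>: "0 < \<epsilon>" "\<epsilon> \<le> 1"
  shows "\<forall>\<^sub>F n in sequentially. (\<exists>EG. simple_graph {0..<n} EG \<and> turan_ex V E n + q n \<le> card EG \<and>
    real (num_copies V E n EG) \<le> ((1 + \<epsilon>) * (\<beta> + \<epsilon>) + 2 * \<epsilon>) * (real (q n) * real n ^ (f - 2)))"
proof -
  have r0: "0 < r" using r2 by simp
  obtain \<xi> where \<xi>: "\<And>i. i < r \<Longrightarrow> 0 \<le> \<xi> i" "\<And>i. i < r \<Longrightarrow> \<xi> i \<le> 1 / real r"
    and \<rho>: "1 - 1 / real r < (\<Sum>i<r. \<xi> i)"
    and P: "P_F r V E \<xi> < (\<beta> + \<epsilon>) * ((\<Sum>i<r. \<xi> i) - (1 - 1 / real r))"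
    using beta_F_approx[OF r0 \<epsilon>(1)] by blast
  define d where "d = (\<Sum>i<r. \<xi> i) - (1 - 1 / real r)"
  have d: "0 < d" unfolding d_def using \<rho> by simp
  define Q where "Q = P_F r V E \<xi>"
  have Q: "0 \<le> Q" "Q \<le> (\<beta> + \<epsilon>) * d" unfolding Q_def d_def using P \<xi>(1) by (auto intro: P_F_nonneg)
  \<comment> \<open>Chosen so that \<open>k \<le> C * s\<close> for \<open>s = q / n\<close>; the
    final 1 absorbs the rounding of \<open>k\<close>, as \<open>s \<ge> 1\<close>.\<close>
  define C where "C = (1 + \<epsilon>) / d + 1"
  have C: "1 \<le> C" unfolding C_def using \<epsilon> d by simp
  obtain N where N: "\<And>n. N \<le> n \<Longrightarrow> 2 * real (turan_ex V E n) \<le> (1 - 1 / real r) * (real n)\<^sup>2"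
    by (rule turan_ex_le) blast
  \<comment> \<open>The three terms yield \<open>2 * k^2 \<le> \<epsilon> / 2 * q\<close>,
    \<open>f^2 * k^2 \<le> \<epsilon> * q\<close> and \<open>k \<le> n\<close>.\<close>
  define \<theta> where "\<theta> = min (\<epsilon> / (4 * C\<^sup>2)) (min (\<epsilon> / ((real f)\<^sup>2 * C\<^sup>2)) (1 / C))"
  have f0: "0 < real f" using f2 by simp
  have \<theta>: "0 < \<theta>" unfolding \<theta>_def using \<epsilon> C f0 by simp
  \<comment> \<open>In this order: \<open>n \<le> q\<close>,
    \<open>n \<le> \<epsilon> / 2 * q\<close>, \<open>Q \<le> \<epsilon> * s\<close> for the cost of
    rounding \<open>k\<close> up, and \<open>r \<le> k\<close>.\<close>
  define B where "B = max 1 (max (2 / \<epsilon>) (max (Q / \<epsilon>) (real r * d)))"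
  have ev1: "\<forall>\<^sub>F n in sequentially. real (q n) / real n ^ 2 < \<theta>" using order_tendstoD(2)[OF q0 \<theta>] .
  have ev2: "\<forall>\<^sub>F n in sequentially. B \<le> real (q n) / real n" using qinf unfolding filterlim_at_top by blast
  have ev3: "\<forall>\<^sub>F n in sequentially. max N (nat \<lceil>4 * C * real r / \<epsilon>\<rceil> + 1) \<le> n" by (rule eventually_ge_at_top)
  show ?thesis using ev1 ev2 ev3
  proof eventually_elim
    case (elim n)
    define s where "s = real (q n) / real n"
    have n0: "0 < real n" using elim(3) by simp
    have nN: "N \<le> n" using elim(3) by simp
    have n4: "4 * C * real r / \<epsilon> \<le> real n" using elim(3) by linarith
    have qs: "real (q n) = s * real n" unfolding s_def using n0 by simp
    have s: "1 \<le> s" "2 / \<epsilon> \<le> s" "Q / \<epsilon> \<le> s" "real r * d \<le> s" using elim(2) unfolding B_def s_def by auto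
    have sn: "s / real n < \<theta>" using elim(1) unfolding s_def by (simp add: power2_eq_square)
    have sn': "s < \<theta> * real n" using sn n0 by (simp add: pos_divide_less_eq)
    \<comment> \<open>The factor \<open>1 + \<epsilon>\<close> provides
      \<open>2 * \<epsilon> * q\<close> spare ordered pairs, of which the three loss terms of the
      construction use at most \<open>3/2 * \<epsilon> * q\<close>.\<close>
    define k where "k = nat \<lceil>(1 + \<epsilon>) * s / d\<rceil>"
    have pos: "0 \<le> (1 + \<epsilon>) * s / d" using \<epsilon> s d by simp
    have k1: "(1 + \<epsilon>) * s / d \<le> real k" "real k \<le> (1 + \<epsilon>) * s / d + 1" unfolding k_def using pos by linarith+
    have kC: "real k \<le> C * s"
    proof -
      have "C * s = (1 + \<epsilon>) * s / d + s" unfolding C_def by (simp add: distrib_right)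
      then show ?thesis using k1(2) s(1) by linarith
    qed
    have kr: "r \<le> k"
    proof -
      have "real r \<le> s / d" using s(4) d by (simp add: pos_le_divide_eq)
      also have "\<dots> \<le> (1 + \<epsilon>) * s / d" using \<epsilon> s d by (intro divide_right_mono) (auto simp: algebra_simps)
      finally have "real r \<le> real k" using k1(1) by linarith
      then show ?thesis by simp
    qed
    have kn: "k \<le> n"
    proof -
      have "C * s \<le> C * (1 / C * real n)"
      proof (rule mult_left_mono)
        have "\<theta> * real n \<le> 1 / C * real n" by (rule mult_right_mono) (auto simp: \<theta>_def)
        then show "s \<le> 1 / C * real n" using sn' by linarith
      qed (use C in simp)
      also have "\<dots> = real n" using C by simp
      finally have "real k \<le> real n" using kC by linarith
      then show ?thesis by simp
    qed
    have k2: "(real k)\<^sup>2 \<le> C\<^sup>2 * s\<^sup>2" using power_mono[OF kC, of 2] by (simp add: power_mult_distrib)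
    have s2: "c * (C\<^sup>2 * s\<^sup>2) \<le> \<epsilon> * real (q n)" if c: "0 < c" "\<theta> \<le> \<epsilon> / (c * C\<^sup>2)" for c
    proof -
      have "0 < c * C\<^sup>2" using c C by simp
      then have "\<theta> * (c * C\<^sup>2) \<le> \<epsilon>" using c(2) by (simp add: pos_le_divide_eq)
      then have "s * real n * (\<theta> * (c * C\<^sup>2)) \<le> s * real n * \<epsilon>" using s n0 by (intro mult_left_mono) auto
      moreover have "s * (c * C\<^sup>2) * s \<le> s * (c * C\<^sup>2) * (\<theta> * real n)" using sn' s c by (intro mult_left_mono) auto
      ultimately show ?thesis unfolding qs by (simp add: power2_eq_square mult_ac)
    qed
    obtain EG where G: "simple_graph {0..<n} EG"
      and edges: "(1 - 1 / real r) * (real n)\<^sup>2 + 2 * real k * real n * d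
        - real n - 2 * (real k)\<^sup>2 - 2 * real k * real r \<le> real (card (edge_pairs n EG))"
      and copies: "real (num_copies V E n EG) \<le> real k * real n ^ (f - 1) * Q + (real f)\<^sup>2 * (real k)\<^sup>2 * real n ^ (f - 2)"
      using hub_graph_construction[of k n \<xi>] kn kr \<xi> unfolding d_def Q_def by blast
    have knd: "(1 + \<epsilon>) * real (q n) \<le> real k * real n * d"
    proof -
      have "(1 + \<epsilon>) * s \<le> real k * d" using k1(1) d by (simp add: pos_divide_le_eq)
      then have "(1 + \<epsilon>) * s * real n \<le> real k * d * real n" using n0 by (intro mult_right_mono) auto
      then show ?thesis unfolding qs by (simp add: mult_ac)
    qed
    have e1: "real n \<le> \<epsilon> / 2 * real (q n)"
    proof -
      have "2 \<le> s * \<epsilon>" using s(2) \<epsilon> by (simp add: pos_divide_le_eq)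
      then have "2 * real n \<le> s * \<epsilon> * real n" using n0 by (intro mult_right_mono) auto
      then show ?thesis unfolding qs by (simp add: mult_ac)
    qed
    have e2: "2 * (real k)\<^sup>2 \<le> \<epsilon> / 2 * real (q n)"
      using s2[of 4] k2 unfolding \<theta>_def by simp
    have e3: "2 * real k * real r \<le> \<epsilon> / 2 * real (q n)"
    proof -
      have "4 * C * real r \<le> \<epsilon> * real n" using n4 \<epsilon> by (simp add: pos_divide_le_eq mult.commute)
      then have "s * (4 * C * real r) \<le> s * (\<epsilon> * real n)" using s by (intro mult_left_mono) auto
      moreover have "4 * real r * real k \<le> 4 * real r * (C * s)" by (intro mult_left_mono kC) simp
      ultimately show ?thesis unfolding qs by (simp add: mult_ac)
    qed
    have "2 * real (turan_ex V E n) + 2 * real (q n) \<le> real (card (edge_pairs n EG))"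
    proof -
      have "0 \<le> \<epsilon> * real (q n)" using \<epsilon> by simp
      then show ?thesis using edges knd e1 e2 e3 N[OF nN] by (simp add: algebra_simps)
    qed
    then have "real (2 * (turan_ex V E n + q n)) \<le> real (2 * card EG)" unfolding card_edge_pairs[OF G] by simp
    then have m: "turan_ex V E n + q n \<le> card EG" by (simp only: of_nat_le_iff) simp
    have kQ: "real k * real n * Q \<le> ((1 + \<epsilon>) * (\<beta> + \<epsilon>) + \<epsilon>) * real (q n)"
    proof -
      have "real k * Q \<le> ((1 + \<epsilon>) * s / d + 1) * Q" by (rule mult_right_mono[OF k1(2) Q(1)])
      also have "\<dots> = (1 + \<epsilon>) * s * (Q / d) + Q" by (simp add: distrib_right)
      also have "\<dots> \<le> (1 + \<epsilon>) * s * (\<beta> + \<epsilon>) + \<epsilon> * s"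
      proof (intro add_mono mult_left_mono)
        show "Q / d \<le> \<beta> + \<epsilon>" using Q(2) d by (simp add: pos_divide_le_eq)
        show "Q \<le> \<epsilon> * s" using s(3) \<epsilon> by (simp add: pos_divide_le_eq mult.commute)
      qed (use \<epsilon> s in auto)
      finally have "real k * Q * real n \<le> ((1 + \<epsilon>) * s * (\<beta> + \<epsilon>) + \<epsilon> * s) * real n"
        using n0 by (intro mult_right_mono) auto
      then show ?thesis unfolding qs by (simp add: algebra_simps)
    qed
    have kf: "(real f)\<^sup>2 * (real k)\<^sup>2 \<le> \<epsilon> * real (q n)"
    proof -
      have "(real f)\<^sup>2 * (real k)\<^sup>2 \<le> (real f)\<^sup>2 * (C\<^sup>2 * s\<^sup>2)" by (intro mult_left_mono k2) simp
      also have "\<dots> \<le> \<epsilon> * real (q n)" by (rule s2) (use f0 in \<open>auto simp: \<theta>_def\<close>)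
      finally show ?thesis .
    qed
    have "f - 1 = Suc (f - 2)" using f2 by simp
    then have "real k * real n ^ (f - 1) * Q + (real f)\<^sup>2 * (real k)\<^sup>2 * real n ^ (f - 2)
        = (real k * real n * Q + (real f)\<^sup>2 * (real k)\<^sup>2) * real n ^ (f - 2)" by (simp add: algebra_simps)
    also have "\<dots> \<le> (((1 + \<epsilon>) * (\<beta> + \<epsilon>) + \<epsilon>) * real (q n) + \<epsilon> * real (q n)) * real n ^ (f - 2)"
      by (intro mult_right_mono add_mono kQ kf) simp
    also have "\<dots> = ((1 + \<epsilon>) * (\<beta> + \<epsilon>) + 2 * \<epsilon>) * (real (q n) * real n ^ (f - 2))" by (simp add: algebra_simps)
    finally show ?case using G m copies by (meson order.trans)
  qed
qed

text \<open>The Turan number is at least \<open>(1 - 1/r) n^2 / 2 - n / 2\<close>, so the excess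
  over \<open>(1 - 1/r) n^2 / 2\<close> is at least \<open>q - n / 2\<close>. Eventually
  \<open>n \<le> \<epsilon> * q\<close>, which accounts for the second factor
  \<open>1 - \<epsilon>\<close>.\<close>

lemma eventually_h_F_ge:
  fixes q :: "nat \<Rightarrow> nat"
  assumes q0: "(\<lambda>n. real (q n) / real n ^ 2) \<longlonglongrightarrow> 0"
    and qinf: "filterlim (\<lambda>n. real (q n) / real n) at_top sequentially"
    and \<epsilon>: "0 < \<epsilon>" "\<epsilon> < 1"
  shows "\<forall>\<^sub>F n in sequentially. (1 - \<epsilon>) * \<beta> * (1 - \<epsilon>) * (real (q n) * real n ^ (f - 2)) \<le> real (h_F V E n (q n))"
proof -
  obtain \<delta> N where \<delta>: "0 < \<delta>" and bound: "\<And>n EG q. N \<le> n \<Longrightarrow> simple_graph {0..<n} EG \<Longrightarrow> 0 \<le> q \<Longrightarrow> q \<le> \<delta> * (real n)\<^sup>2 \<Longrightarrow>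
      (1 - 1 / real r) * (real n)\<^sup>2 + 2 * q \<le> real (card (edge_pairs n EG)) \<Longrightarrow>
      (1 - \<epsilon>) * \<beta> * q * real n ^ (f - 2) \<le> real (num_copies V E n EG)"
    by (rule copies_lower_bound[OF \<epsilon>]) blast
  have ev1: "\<forall>\<^sub>F n in sequentially. real (q n) / real n ^ 2 < \<delta>" using order_tendstoD(2)[OF q0 \<delta>] .
  have ev2: "\<forall>\<^sub>F n in sequentially. 1 / \<epsilon> \<le> real (q n) / real n" using qinf unfolding filterlim_at_top by blast
  have ev3: "\<forall>\<^sub>F n in sequentially. max N 1 \<le> n" by (rule eventually_ge_at_top)
  \<comment> \<open>Taken with \<open>\<epsilon> = 1\<close>, merely to have a graph with enough
    edges, so that \<open>h_F\<close> is attained by some graph.\<close>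
  have ev4: "\<forall>\<^sub>F n in sequentially. (\<exists>EG. simple_graph {0..<n} EG \<and> turan_ex V E n + q n \<le> card EG \<and>
    real (num_copies V E n EG) \<le> ((1 + 1) * (\<beta> + 1) + 2 * 1) * (real (q n) * real n ^ (f - 2)))"
    by (rule eventually_h_F_le[OF q0 qinf]) auto
  show ?thesis using ev1 ev2 ev3 ev4
  proof eventually_elim
    case (elim n)
    then obtain EG where "simple_graph {0..<n} EG" "turan_ex V E n + q n \<le> card EG" by blast
    from h_F_le(2)[OF this] obtain D where D: "simple_graph {0..<n} D" "card D = turan_ex V E n + q n"
      "h_F V E n (q n) = num_copies V E n D" by blast
    have n0: "0 < real n" using elim(3) by simp
    define q' where "q' = real (q n) - real n / 2"
    have "1 / \<epsilon> * real n \<le> real (q n)" using elim(2) n0 by (simp add: pos_le_divide_eq)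
    then have nq: "real n \<le> \<epsilon> * real (q n)" using \<epsilon> by (simp add: pos_divide_le_eq mult.commute)
    have q1: "(1 - \<epsilon>) * real (q n) \<le> q'" unfolding q'_def using nq n0 by (simp add: algebra_simps)
    have q'0: "0 \<le> q'" using q1 \<epsilon> by (meson diff_ge_0_iff_ge less_imp_le mult_nonneg_nonneg of_nat_0_le_iff order.trans)
    have "real (q n) \<le> \<delta> * (real n)\<^sup>2" using elim(1) n0 by (simp add: pos_divide_less_eq)
    then have q2: "q' \<le> \<delta> * (real n)\<^sup>2" unfolding q'_def using n0 by linarith
    have "(1 - \<epsilon>) * \<beta> * q' * real n ^ (f - 2) \<le> real (num_copies V E n D)"
    proof (rule bound)
      have "real (card (edge_pairs n D)) = 2 * real (turan_ex V E n) + 2 * real (q n)"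
        unfolding card_edge_pairs[OF D(1)] D(2) by simp
      then show "(1 - 1 / real r) * (real n)\<^sup>2 + 2 * q' \<le> real (card (edge_pairs n D))"
        using turan_ex_ge[of n] unfolding q'_def by simp
    qed (use elim(3) D(1) q'0 q2 in auto)
    moreover have "(1 - \<epsilon>) * \<beta> * ((1 - \<epsilon>) * real (q n)) * real n ^ (f - 2) \<le> (1 - \<epsilon>) * \<beta> * q' * real n ^ (f - 2)"
      using q1 \<epsilon> beta_pos by (intro mult_right_mono mult_left_mono) auto
    ultimately show ?case unfolding D(3) by (simp add: mult.assoc)
  qed
qed

end

theorem theorem7:
  fixes r :: nat and V :: "'a set" and E :: "'a set set" and q :: "nat \<Rightarrow> nat"
  assumes "r \<ge> 2"
    and "simple_graph V E"
    and "r_critical r V E"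
    and "(\<lambda>n. real (q n) / real n ^ 2) \<longlonglongrightarrow> 0"
    and "filterlim (\<lambda>n. real (q n) / real n) at_top sequentially"
  shows "(\<lambda>n. real (h_F V E n (q n)) / (real (q n) * real n ^ (card V - 2)))
           \<longlonglongrightarrow> beta_F r V E"
proof -
  interpret critical_graph r V E using assms(1-3) by unfold_locales
  have "\<forall>\<^sub>F n in sequentially. 1 \<le> real (q n) / real n" using assms(5) unfolding filterlim_at_top by blast
  then have pos: "\<forall>\<^sub>F n in sequentially. 0 < real (q n) * real n ^ (f - 2)"
  proof eventually_elim
    case (elim n)
    then have "n \<noteq> 0" "q n \<noteq> 0" by (auto intro!: Nat.gr0I)
    then show ?case by simp
  qed
  show ?thesis
  proof (rule order_tendstoI)
    fix a assume a: "a < \<beta>"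
    \<comment> \<open>The first-order loss \<open>2 * \<epsilon> * \<beta>\<close> is then at most
      half of \<open>\<beta> - a\<close>.\<close>
    define \<epsilon> where "\<epsilon> = min (1 / 2) ((\<beta> - a) / (4 * \<beta>))"
    have \<epsilon>: "0 < \<epsilon>" "\<epsilon> < 1" unfolding \<epsilon>_def using a beta_pos by auto
    have "\<epsilon> \<le> (\<beta> - a) / (4 * \<beta>)" unfolding \<epsilon>_def by simp
    then have "\<epsilon> * (4 * \<beta>) \<le> \<beta> - a" using beta_pos by (simp add: pos_le_divide_eq)
    moreover have "(1 - \<epsilon>) * \<beta> * (1 - \<epsilon>) = \<beta> - 2 * (\<epsilon> * \<beta>) + \<epsilon> * \<epsilon> * \<beta>" by (simp add: algebra_simps)
    moreover have "0 < \<epsilon> * \<beta>" "0 \<le> \<epsilon> * \<epsilon> * \<beta>" using \<epsilon> beta_pos by auto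
    ultimately have lt: "a < (1 - \<epsilon>) * \<beta> * (1 - \<epsilon>)" by linarith
    show "\<forall>\<^sub>F n in sequentially. a < real (h_F V E n (q n)) / (real (q n) * real n ^ (card V - 2))"
      using eventually_h_F_ge[OF assms(4,5) \<epsilon>] pos
    proof eventually_elim
      case (elim n)
      then have "(1 - \<epsilon>) * \<beta> * (1 - \<epsilon>) \<le> real (h_F V E n (q n)) / (real (q n) * real n ^ (f - 2))"
        by (simp only: pos_le_divide_eq)
      then show ?case using lt by linarith
    qed
  next
    fix a assume a: "\<beta> < a"
    \<comment> \<open>As \<open>\<epsilon> \<le> 1\<close>, the upper coefficient exceeds
      \<open>\<beta>\<close> by at most \<open>\<epsilon> * (\<beta> + 4)\<close>, which is at most
      half of \<open>a - \<beta>\<close>.\<close>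
    define \<epsilon> where "\<epsilon> = min 1 ((a - \<beta>) / (2 * (\<beta> + 4)))"
    have \<epsilon>: "0 < \<epsilon>" "\<epsilon> \<le> 1" unfolding \<epsilon>_def using a beta_pos by auto
    have "\<epsilon> \<le> (a - \<beta>) / (2 * (\<beta> + 4))" unfolding \<epsilon>_def by simp
    then have "\<epsilon> * (2 * (\<beta> + 4)) \<le> a - \<beta>" using beta_pos by (simp add: pos_le_divide_eq)
    moreover have "0 < \<epsilon> * (\<beta> + 4)" using \<epsilon> beta_pos by simp
    moreover have "\<epsilon> * \<epsilon> \<le> \<epsilon> * 1" using \<epsilon> by (intro mult_left_mono) auto
    moreover have "(1 + \<epsilon>) * (\<beta> + \<epsilon>) + 2 * \<epsilon> = \<beta> + \<epsilon> * \<beta> + 3 * \<epsilon> + \<epsilon> * \<epsilon>" by (simp add: algebra_simps)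
    ultimately have lt: "(1 + \<epsilon>) * (\<beta> + \<epsilon>) + 2 * \<epsilon> < a" by (simp add: algebra_simps)
    show "\<forall>\<^sub>F n in sequentially. real (h_F V E n (q n)) / (real (q n) * real n ^ (card V - 2)) < a"
      using eventually_h_F_le[OF assms(4,5) \<epsilon>] pos
    proof eventually_elim
      case (elim n)
      then obtain EG where G: "simple_graph {0..<n} EG" "turan_ex V E n + q n \<le> card EG"
        and le: "real (num_copies V E n EG) \<le> ((1 + \<epsilon>) * (\<beta> + \<epsilon>) + 2 * \<epsilon>) * (real (q n) * real n ^ (f - 2))" by blast
      have "real (h_F V E n (q n)) \<le> real (num_copies V E n EG)" using h_F_le(1)[OF G] by simp
      then have "real (h_F V E n (q n)) / (real (q n) * real n ^ (f - 2)) \<le> (1 + \<epsilon>) * (\<beta> + \<epsilon>) + 2 * \<epsilon>"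
        using le elim(2) by (simp only: pos_divide_le_eq)
      then show ?case using lt by linarith
    qed
  qed
qed

end
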